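(* Let $N>2$ and $k>1$ be integers with $k\neq N$, and let $c\in\{0,1,\ldots,\lfloor N/2\rfloor\}$. Viewing $F_k$ as an element of the function field $\mathbb{Q}(X_1(N)) = \mathbb{Q}(s)[x]/(q_N)$, the order (valuation) of $F_k$ at the cusp $C_c(N)$ equals $\mathbf{e}_c(N)\cdot v_k\!\left(\frac{c}{N}\right)$, where the functions $v_k:[0,1/2]\to\mathbb{R}$ are defined by $v_2(t) = 4t-1$ and, for $k>2$, \[ v_k(t) = s_k\left(-\frac{m_k}{3}\,t + \sum_{c'=1}^{\lfloor k/2\rfloor} \mathbf{n}_{c'}(k)\,\min\!\left(t,\frac{c'}{k}\right)\right),\] with $s_3 = 3$ and $s_k = 1$ for $k>3$.
   Context: Let $j$ be transcendental over $\mathbb{Q}$, $s = 1/j$, $j_0 = j/(j-1728)$, and let $E: y^2 = x^3 + ax + b$ with $a = -3j_0$, $b=-2j_0$, an elliptic curve over $\mathbb{Q}(j)$. Division polynomials: $Q_1 = 1$, $Q_2 = 2y$, $Q_3 = 3x^4+6ax^2+12bx-a^2$, $Q_4 = 4y(x^6+5ax^4+20bx^3-5a^2x^2-4abx-8b^2-a^3)$, $Q_{2m+1} = Q_{m+2}Q_m^3 - Q_{m-1}Q_{m+1}^3$ for $m\ge2$, $Q_{2m} = (Q_{m+2}Q_{m-1}^2 - Q_{m-2}Q_{m+1}^2)Q_m/Q_2$ for $m\ge3$. Define $q_k$ recursively by $Q_k = \prod_{d\mid k} q_d$ (so $q_1=1$, $q_2 = 2y$, $q_3 = Q_3$, $q_4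 = Q_4/Q_2$); for $k\ge3$, $q_k\in\mathbb{Z}[x,j_0]$ and its roots are the $x$-coordinates of the points of exact order $k$. Let $m_k$ be the number of points of exact order $k$ on $E$ over an algebraic closure (so $m_2=3$, $m_3=8$, and $12\mid m_k$ for $k>3$). Define $F_2 = q_2^4/(1728 j_0^2(j_0-1))$, $F_3 = q_3^3/q_2^8$, and $F_k = q_k/q_2^{m_k/3}$ for $k>3$; since $q_2^2 = 4(x^3+ax+b)$, all $F_k$ lie in $\mathbb{Q}(x,j) = \mathbb{Q}(x,s)$. For $N>2$, $q_N$ is irreducible and $\mathbb{Q}(X_1(N)) = \mathbb{Q}(s)[x]/(q_N)$. A cusp of $X_1(N)$ over $\mathbb{Q}$ is a place above $s=0$, i.e. a conjugacy class over $\mathbb{Q}((s))$ of Puiseux expansions $\mathbf{p}$ (roots in $\bigcup_e\mathbb{C}((s^{1/e}))$) of $q_N$ as a polynomial in $x$; the valuation of $g$ at it is $\mathbf{e}_{\mathbf{p}}\,v_s(g(\mathbf{p}))$, where $v_s$ is the lowest exponent of $s$ and $\mathbf{e}_{\mathbf{p}}$ is the least $e$ with $\mathbf{p}\in\mathbb{C}((s^{1/e}))$. There are exactly $\lfloor N/2\rfloor+1$ such classes, and $C_c(N)$ denotes the one whose members satisfy $v_s(\mathbf{p}+1) = c/N$, except that for $(N,c)=(4,2)$, $C_2(4)$ is the class with $v_s(\mathbf{p}+1)=1$. Numbers: for $0<c<k/2$, $\mathbf{n}_c(k) = \varphi(d)\,k/d$ with $d = \gcd(c,k)$; for even $k>2$,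 $\mathbf{n}_{k/2}(k) = \varphi(k/2)$; $\mathbf{n}_1(2)=2$. Also $\mathbf{e}_2(4) := 1$ and otherwise $\mathbf{e}_c(N) := N/\gcd(c,N)$ (so $\mathbf{e}_0(N)=1$). Here $\varphi$ is Euler's totient function. *)

theory Defs
  imports
    Complex_Main
    "HOL-Library.Extended_Real"
    "HOL-Computational_Algebra.Computational_Algebra"
    "HOL-Number_Theory.Totient"
    "HOL-Algebra.Algebraic_Closure_Type"
begin

section \<open>Puiseux series\<close>

lemma fls_compose_power_inj:
  assumes "d > 0" "fls_compose_power f d = fls_compose_power g d"
  shows "f = g"
proof (rule fls_eqI)
  fix n :: int
  have "fls_nth (fls_compose_power f d) (int d * n) = fls_nth (fls_compose_power g d) (int d * n)"
    using assms by simp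
  thus "fls_nth f n = fls_nth g n"
    using assms(1) by (simp add: fls_nth_compose_power)
qed

lemma fls_compose_power_1_right [simp]: "fls_compose_power f (Suc 0) = f"
  by (intro fls_eqI) (simp add: fls_nth_compose_power)

lemma fls_compose_power_compose_power:
  assumes "d > 0" "e > 0"
  shows "fls_compose_power (fls_compose_power f d) e = fls_compose_power f (d * e)"
  using assms
  by (intro fls_eqI) (auto simp: fls_nth_compose_power div_mult2_eq mult.commute elim!: dvdE)

lemma fls_compose_power_inverse:
  fixes f :: "'a :: field fls"
  assumes "d > 0"
  shows "fls_compose_power (inverse f) d = inverse (fls_compose_power f d)"
proof (cases "f = 0")
  case False
  have "fls_compose_power f d * fls_compose_power (inverse f) d = fls_compose_power (f * inverse f) d"
    by simp
  also have "\<dots> = 1" using False assms by simp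
  finally show ?thesis by (metis inverse_unique)
qed (simp add: assms)

lemma fls_compose_power_eq_0_iff:
  assumes "d > 0" shows "fls_compose_power f d = 0 \<longleftrightarrow> f = 0"
  using fls_compose_power_inj[OF assms, of f 0] by auto

lemma fls_subdegree_compose_power:
  assumes "d > 0"
  shows "fls_subdegree (fls_compose_power f d) = int d * fls_subdegree f"
proof (cases "f = 0")
  case False
  show ?thesis
  proof (rule fls_subdegree_eqI)
    show "fls_nth (fls_compose_power f d) (int d * fls_subdegree f) \<noteq> 0"
      using assms False by (simp add: fls_nth_compose_power)
    show "fls_nth (fls_compose_power f d) k = 0" if "k < int d * fls_subdegree f" for k
      using assms that by (auto simp: fls_nth_compose_power elim!: dvdE)
  qed
qed simp

text \<open>
  The pair \<open>(d, f)\<close> with \<open>d > 0\<close> stands for the series \<open>f(s\<^bsup>1/d\<^esup>)\<close>.  Two pairs are identified when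
  they agree after passing to a common denominator of the exponents, so that the quotient is the
  field \<open>\<Union>\<^sub>d \<complex>((s\<^bsup>1/d\<^esup>))\<close>.
\<close>

lifting_forget fls.lifting

definition puiseux_rel :: "nat \<times> complex fls \<Rightarrow> nat \<times> complex fls \<Rightarrow> bool" where
  "puiseux_rel = (\<lambda>(d, f) (e, g). d > 0 \<and> e > 0 \<and> fls_compose_power f e = fls_compose_power g d)"

quotient_type puiseux = "nat \<times> complex fls" / partial: puiseux_rel
proof (rule part_equivpI)
  show "\<exists>x. puiseux_rel x x"
    by (rule exI[of _ "(1, 0)"]) (simp add: puiseux_rel_def)
  show "symp puiseux_rel"
    by (auto simp: puiseux_rel_def symp_def)
  show "transp puiseux_rel"
  proof (rule transpI)
    fix x y z assume *: "puiseux_rel x y" "puiseux_rel y z"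
    obtain d f where x: "x = (d, f)" by (cases x)
    obtain e g where y: "y = (e, g)" by (cases y)
    obtain c h where z: "z = (c, h)" by (cases z)
    from * have pos: "d > 0" "e > 0" "c > 0"
      and 1: "fls_compose_power f e = fls_compose_power g d"
      and 2: "fls_compose_power g c = fls_compose_power h e"
      by (auto simp: puiseux_rel_def x y z)
    have "fls_compose_power (fls_compose_power f c) e = fls_compose_power (fls_compose_power f e) c"
      using pos by (simp add: fls_compose_power_compose_power mult.commute)
    also have "\<dots> = fls_compose_power (fls_compose_power g c) d"
      using pos 1 by (simp add: fls_compose_power_compose_power mult.commute)
    also have "\<dots> = fls_compose_power (fls_compose_power h d) e"
      using pos 2 by (simp add: fls_compose_power_compose_power mult.commute)
    finally have "fls_compose_power f c = fls_compose_power h d"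
      using fls_compose_power_inj pos by blast
    with pos show "puiseux_rel x z" by (simp add: puiseux_rel_def x z)
  qed
qed

lift_definition puiseux_of :: "nat \<Rightarrow> complex fls \<Rightarrow> puiseux"
  is "\<lambda>d f. if d = 0 then (1, 0) else (d, f)"
  by (simp add: puiseux_rel_def)

lemma puiseux_rel_common:
  assumes "puiseux_rel (d1, f1) (d2, f2)" "puiseux_rel (e1, g1) (e2, g2)"
  shows "fls_compose_power f1 (e1 * (d2 * e2)) = fls_compose_power f2 (e2 * (d1 * e1))"
    and "fls_compose_power g1 (d1 * (d2 * e2)) = fls_compose_power g2 (d2 * (d1 * e1))"
proof -
  from assms have pos: "d1 > 0" "d2 > 0" "e1 > 0" "e2 > 0"
    and 1: "fls_compose_power f1 d2 = fls_compose_power f2 d1"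
    and 2: "fls_compose_power g1 e2 = fls_compose_power g2 e1"
    by (auto simp: puiseux_rel_def)
  have "fls_compose_power (fls_compose_power f1 d2) (e1 * e2)
          = fls_compose_power (fls_compose_power f2 d1) (e1 * e2)"
    using 1 by simp
  thus "fls_compose_power f1 (e1 * (d2 * e2)) = fls_compose_power f2 (e2 * (d1 * e1))"
    using pos by (simp add: fls_compose_power_compose_power mult_ac)
  have "fls_compose_power (fls_compose_power g1 e2) (d1 * d2)
          = fls_compose_power (fls_compose_power g2 e1) (d1 * d2)"
    using 2 by simp
  thus "fls_compose_power g1 (d1 * (d2 * e2)) = fls_compose_power g2 (d2 * (d1 * e1))"
    using pos by (simp add: fls_compose_power_compose_power mult_ac)
qed

instantiation puiseux :: field
begin

lift_definition zero_puiseux :: puiseux is "(1, 0)" by (simp add: puiseux_rel_def)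
lift_definition one_puiseux :: puiseux is "(1, 1)" by (simp add: puiseux_rel_def)

lift_definition plus_puiseux :: "puiseux \<Rightarrow> puiseux \<Rightarrow> puiseux"
  is "\<lambda>(d, f) (e, g). (d * e, fls_compose_power f e + fls_compose_power g d)"
  subgoal for x x' y y'
    using puiseux_rel_common[of "fst x" "snd x" "fst x'" "snd x'" "fst y" "snd y" "fst y'" "snd y'"]
    by (auto simp: puiseux_rel_def fls_compose_power_compose_power split: prod.splits)
  done

lift_definition minus_puiseux :: "puiseux \<Rightarrow> puiseux \<Rightarrow> puiseux"
  is "\<lambda>(d, f) (e, g). (d * e, fls_compose_power f e - fls_compose_power g d)"
  subgoal for x x' y y'
    using puiseux_rel_common[of "fst x" "snd x" "fst x'" "snd x'" "fst y" "snd y" "fst y'" "snd y'"]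
    by (auto simp: puiseux_rel_def fls_compose_power_compose_power split: prod.splits)
  done

lift_definition times_puiseux :: "puiseux \<Rightarrow> puiseux \<Rightarrow> puiseux"
  is "\<lambda>(d, f) (e, g). (d * e, fls_compose_power f e * fls_compose_power g d)"
  subgoal for x x' y y'
    using puiseux_rel_common[of "fst x" "snd x" "fst x'" "snd x'" "fst y" "snd y" "fst y'" "snd y'"]
    by (auto simp: puiseux_rel_def fls_compose_power_compose_power split: prod.splits)
  done

lift_definition uminus_puiseux :: "puiseux \<Rightarrow> puiseux" is "\<lambda>(d, f). (d, - f)"
  by (auto simp: puiseux_rel_def)

lift_definition inverse_puiseux :: "puiseux \<Rightarrow> puiseux" is "\<lambda>(d, f). (d, inverse f)"
  by (auto simp: puiseux_rel_def fls_compose_power_inverse)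

definition divide_puiseux :: "puiseux \<Rightarrow> puiseux \<Rightarrow> puiseux" where
  "divide_puiseux x y = x * inverse y"

instance
proof
  fix a b c :: puiseux
  show "a * b * c = a * (b * c)"
    by transfer (auto simp: puiseux_rel_def fls_compose_power_compose_power mult_ac)
  show "a * b = b * a"
    by transfer (auto simp: puiseux_rel_def fls_compose_power_compose_power mult_ac)
  show "1 * a = a"
    by transfer (auto simp: puiseux_rel_def fls_compose_power_compose_power)
  show "a + b + c = a + (b + c)"
    by transfer (auto simp: puiseux_rel_def fls_compose_power_compose_power mult_ac add_ac)
  show "a + b = b + a"
    by transfer (auto simp: puiseux_rel_def fls_compose_power_compose_power mult_ac add_ac)
  show "0 + a = a"
    by transfer (auto simp: puiseux_rel_def fls_compose_power_compose_power)
  show "- a + a = 0"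
    by transfer (auto simp: puiseux_rel_def fls_compose_power_compose_power)
  show "a - b = a + - b"
    by transfer (auto simp: puiseux_rel_def fls_compose_power_compose_power)
  show "(a + b) * c = a * c + b * c"
    by transfer (auto simp: puiseux_rel_def fls_compose_power_compose_power mult_ac distrib_left)
  show "(0 :: puiseux) \<noteq> 1"
    by transfer (auto simp: puiseux_rel_def)
  show "a \<noteq> 0 \<Longrightarrow> inverse a * a = 1"
    by transfer (auto simp: puiseux_rel_def fls_compose_power_inverse
          fls_compose_power_eq_0_iff fls_compose_power_compose_power)
  show "a div b = a * inverse b"
    by (simp add: divide_puiseux_def)
  show "inverse (0 :: puiseux) = 0"
    by transfer (auto simp: puiseux_rel_def)
qed

end

lemma puiseux_of_1_add: "puiseux_of 1 (f + g) = puiseux_of 1 f + puiseux_of 1 g"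
  by transfer (simp add: puiseux_rel_def)

lemma puiseux_of_1_1: "puiseux_of 1 1 = 1"
  by transfer (simp add: puiseux_rel_def)

lemma puiseux_of_1_0: "puiseux_of 1 0 = 0"
  by transfer (simp add: puiseux_rel_def)

lemma puiseux_of_1_eq_iff: "puiseux_of 1 f = puiseux_of 1 g \<longleftrightarrow> f = g"
  by transfer (auto simp: puiseux_rel_def dest: fls_compose_power_inj[rotated])

lemma puiseux_of_1_of_nat: "puiseux_of 1 (of_nat n) = of_nat n"
  by (induction n) (simp_all add: puiseux_of_1_add[simplified] puiseux_of_1_0[simplified] puiseux_of_1_1[simplified])

instance puiseux :: field_char_0
proof
  show "inj (of_nat :: nat \<Rightarrow> puiseux)"
    by (intro injI) (metis puiseux_of_1_of_nat puiseux_of_1_eq_iff of_nat_eq_iff)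
qed

definition puiseux_s :: puiseux where
  "puiseux_s = puiseux_of 1 fls_X"

text \<open>The lowest exponent of \<open>s\<close> in a Puiseux series, with value \<open>\<infinity>\<close> at \<open>0\<close>.\<close>

lift_definition v_s :: "puiseux \<Rightarrow> ereal"
  is "\<lambda>(d, f). if f = 0 then \<infinity> else ereal (of_int (fls_subdegree f) / of_nat d)"
proof -
  fix x y assume "puiseux_rel x y"
  moreover obtain d f e g where xy: "x = (d, f)" "y = (e, g)" by (cases x, cases y)
  ultimately have *: "d > 0" "e > 0" "fls_compose_power f e = fls_compose_power g d"
    by (auto simp: puiseux_rel_def)
  have "f = 0 \<longleftrightarrow> g = 0" using * fls_compose_power_eq_0_iff by metis
  moreover have "int e * fls_subdegree f = int d * fls_subdegree g"
    using * fls_subdegree_compose_power by metis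
  hence "real e * of_int (fls_subdegree f) = real d * of_int (fls_subdegree g)"
    by (metis of_int_mult of_int_of_nat_eq)
  ultimately show "?thesis x y" using * by (auto simp: xy field_simps)
qed

definition ramification :: "puiseux \<Rightarrow> nat" where
  "ramification p = (LEAST e. e > 0 \<and> p \<in> range (puiseux_of e))"

text \<open>The embedding of \<open>\<rat>((s))\<close>.\<close>

definition puiseux_of_rat_fls :: "rat fls \<Rightarrow> puiseux" where
  "puiseux_of_rat_fls f = puiseux_of 1 (Abs_fls (\<lambda>n. of_rat (fls_nth f n)))"

definition conjugate_over_Qs :: "puiseux \<Rightarrow> puiseux \<Rightarrow> bool" where
  "conjugate_over_Qs p p' \<longleftrightarrow>
     (\<exists>P :: rat fls poly. Factorial_Ring.irreducible P \<and>
        poly (map_poly puiseux_of_rat_fls P) p = 0 \<and> poly (map_poly puiseux_of_rat_fls P) p' = 0)"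

section \<open>Rational functions\<close>

text \<open>
  The value at \<open>x\<close> of a rational function in one variable, with coefficients mapped by \<open>h\<close>, computed
  from any representation as a fraction whose denominator does not vanish at \<open>x\<close>.
\<close>

definition ratfun_eval :: "('a :: idom \<Rightarrow> 'b :: field) \<Rightarrow> 'b \<Rightarrow> 'a poly fract \<Rightarrow> 'b" where
  "ratfun_eval h x r = (THE v. \<exists>n d. r = Fraction_Field.Fract n d \<and>
     poly (map_poly h d) x \<noteq> 0 \<and> v = poly (map_poly h n) x / poly (map_poly h d) x)"

section \<open>The elliptic curve\<close>

text \<open>The field \<open>\<rat>(j) = \<rat>(s)\<close>, with \<open>s\<close> as the indeterminate.\<close>

type_synonym Qj = "rat poly fract"

definition s_var :: Qj where "s_var = to_fract [:0, 1:]"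
definition j_inv :: Qj where "j_inv = 1 / s_var"
definition j0 :: Qj where "j0 = j_inv / (j_inv - 1728)"
definition curve_a :: Qj where "curve_a = - 3 * j0"
definition curve_b :: Qj where "curve_b = - 2 * j0"

datatype 'a ec_point = Infinity | Affine 'a 'a

definition ec_points :: "'a :: field \<Rightarrow> 'a \<Rightarrow> 'a ec_point set" where
  "ec_points a b = insert Infinity {Affine x y | x y. y ^ 2 = x ^ 3 + a * x + b}"

fun ec_add :: "'a :: field \<Rightarrow> 'a ec_point \<Rightarrow> 'a ec_point \<Rightarrow> 'a ec_point" where
  "ec_add a Infinity Q = Q"
| "ec_add a P Infinity = P"
| "ec_add a (Affine x1 y1) (Affine x2 y2) =
     (if x1 = x2 \<and> y1 = - y2 then Infinity
      else let l = (if x1 = x2 then (3 * x1 ^ 2 + a) / (2 * y1) else (y2 - y1) / (x2 - x1));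
               x3 = l ^ 2 - x1 - x2
           in Affine x3 (l * (x1 - x3) - y1))"

definition ec_mult :: "'a :: field \<Rightarrow> nat \<Rightarrow> 'a ec_point \<Rightarrow> 'a ec_point" where
  "ec_mult a n P = (ec_add a P ^^ n) Infinity"

definition exact_order :: "'a :: field \<Rightarrow> nat \<Rightarrow> 'a ec_point \<Rightarrow> bool" where
  "exact_order a k P \<longleftrightarrow>
     k > 0 \<and> ec_mult a k P = Infinity \<and> (\<forall>d. 0 < d \<and> d < k \<longrightarrow> ec_mult a d P \<noteq> Infinity)"

definition num_exact_order :: "nat \<Rightarrow> nat" where
  "num_exact_order k = card {P \<in> ec_points (to_ac curve_a) (to_ac curve_b). exact_order (to_ac curve_a) k P}"

subsection \<open>Its function field\<close>

type_synonym Qjx = "Qj poly fract"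

definition weierstrass_rhs :: "Qj poly" where
  "weierstrass_rhs = [:curve_b, curve_a, 0, 1:]"

lemma weierstrass_rhs_nonsquare:
  fixes u v :: Qjx
  assumes "u ^ 2 = to_fract weierstrass_rhs * v ^ 2"
  shows "u = 0 \<and> v = 0"
proof (rule ccontr)
  assume nz: "\<not> (u = 0 \<and> v = 0)"
  have w: "weierstrass_rhs \<noteq> 0" "degree weierstrass_rhs = 3"
    by (simp_all add: weierstrass_rhs_def)
  have wf: "to_fract weierstrass_rhs \<noteq> (0 :: Qjx)"
    using w by simp
  have vn: "v \<noteq> 0" and un: "u \<noteq> 0"
    using nz assms wf by auto
  obtain n d where uv: "u / v = Fraction_Field.Fract n d" "d \<noteq> 0"
    by (cases "u / v") auto
  hence uv': "u / v = to_fract n / to_fract d"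
    by (simp add: to_fract_def)
  have "(u / v) ^ 2 = to_fract weierstrass_rhs"
    using assms vn by (simp add: power_divide)
  hence "to_fract (n ^ 2) = (to_fract (weierstrass_rhs * d ^ 2) :: Qjx)"
    using uv(2) by (simp add: uv' power_divide field_simps power2_eq_square)
  hence eq: "n ^ 2 = weierstrass_rhs * d ^ 2"
    by (simp only: to_fract_eq_iff)
  hence "n \<noteq> 0"
    using uv(2) w by auto
  hence "2 * degree n = 3 + 2 * degree d"
    using arg_cong[OF eq, of degree] uv(2) w by (simp add: degree_mult_eq power2_eq_square)
  thus False by presburger
qed

text \<open>
  \<open>CF u v\<close> stands for \<open>u + v y\<close> in \<open>\<rat>(j)(x)[y]/(y\<^sup>2 - (x\<^sup>3 + ax + b))\<close>.
\<close>

datatype curve_fun = CF Qjx Qjx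

instantiation curve_fun :: field
begin

definition zero_curve_fun :: curve_fun where "0 = CF 0 0"
definition one_curve_fun :: curve_fun where "1 = CF 1 0"

fun plus_curve_fun :: "curve_fun \<Rightarrow> curve_fun \<Rightarrow> curve_fun" where
  "CF u v + CF u' v' = CF (u + u') (v + v')"
fun minus_curve_fun :: "curve_fun \<Rightarrow> curve_fun \<Rightarrow> curve_fun" where
  "CF u v - CF u' v' = CF (u - u') (v - v')"
fun uminus_curve_fun :: "curve_fun \<Rightarrow> curve_fun" where
  "- CF u v = CF (- u) (- v)"
fun times_curve_fun :: "curve_fun \<Rightarrow> curve_fun \<Rightarrow> curve_fun" where
  "CF u v * CF u' v' = CF (u * u' + to_fract weierstrass_rhs * v * v') (u * v' + v * u')"
fun inverse_curve_fun :: "curve_fun \<Rightarrow> curve_fun" where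
  "inverse (CF u v) = (let n = u ^ 2 - to_fract weierstrass_rhs * v ^ 2 in CF (u / n) (- v / n))"
definition divide_curve_fun :: "curve_fun \<Rightarrow> curve_fun \<Rightarrow> curve_fun" where
  "divide_curve_fun f g = f * inverse g"

instance
proof
  fix f g h :: curve_fun
  show "f * g * h = f * (g * h)"
    by (cases f; cases g; cases h) (simp add: algebra_simps)
  show "f * g = g * f"
    by (cases f; cases g) (simp add: algebra_simps)
  show "1 * f = f"
    by (cases f) (simp add: one_curve_fun_def)
  show "f + g + h = f + (g + h)"
    by (cases f; cases g; cases h) (simp add: algebra_simps)
  show "f + g = g + f"
    by (cases f; cases g) (simp add: algebra_simps)
  show "0 + f = f"
    by (cases f) (simp add: zero_curve_fun_def)
  show "- f + f = 0"
    by (cases f) (simp add: zero_curve_fun_def)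
  show "f - g = f + - g"
    by (cases f; cases g) simp
  show "(f + g) * h = f * h + g * h"
    by (cases f; cases g; cases h) (simp add: algebra_simps)
  show "(0 :: curve_fun) \<noteq> 1"
    by (simp add: zero_curve_fun_def one_curve_fun_def)
  show "f div g = f * inverse g"
    by (simp add: divide_curve_fun_def)
  show "inverse (0 :: curve_fun) = 0"
    by (simp add: zero_curve_fun_def)
  show "inverse f * f = 1" if "f \<noteq> 0"
  proof (cases f)
    case (CF u v)
    define n where "n = u ^ 2 - to_fract weierstrass_rhs * v ^ 2"
    have "n \<noteq> 0"
      using that weierstrass_rhs_nonsquare[of u v] by (auto simp: CF n_def zero_curve_fun_def)
    have "u / n * u + to_fract weierstrass_rhs * (- v / n) * v = n / n"
      unfolding n_def by (simp add: field_simps power2_eq_square diff_divide_distrib)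
    moreover have "u / n * v + - v / n * u = 0"
      by simp
    ultimately show ?thesis
      using \<open>n \<noteq> 0\<close> by (simp add: CF one_curve_fun_def Let_def flip: n_def)
  qed
qed

end

definition of_ratfun :: "Qjx \<Rightarrow> curve_fun" where "of_ratfun u = CF u 0"
definition cf_const :: "Qj \<Rightarrow> curve_fun" where "cf_const c = of_ratfun (to_fract [:c:])"
definition cf_x :: curve_fun where "cf_x = of_ratfun (to_fract [:0, 1:])"
definition cf_y :: curve_fun where "cf_y = CF 0 1"

section \<open>Division polynomials and the functions \<open>F\<^sub>k\<close>\<close>

text \<open>
  \<open>div_pol n\<close> is \<open>Q\<^sub>n\<close> and \<open>prim_div_pol k\<close> is \<open>q\<^sub>k\<close>, the recursion for the latter being
  \<open>Q\<^sub>k = \<Prod>\<^bsub>d | k\<^esub> q\<^sub>d\<close> solved for \<open>q\<^sub>k\<close>.  Only positive indices matter: \<open>div_pol 0\<close> is a dummy.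
\<close>

function div_pol :: "nat \<Rightarrow> curve_fun" where
  "div_pol n =
    (if n = 0 then 0
     else if n = 1 then 1
     else if n = 2 then 2 * cf_y
     else if n = 3 then
       (let x = cf_x; a = cf_const curve_a; b = cf_const curve_b
        in 3 * x ^ 4 + 6 * a * x ^ 2 + 12 * b * x - a ^ 2)
     else if n = 4 then
       (let x = cf_x; y = cf_y; a = cf_const curve_a; b = cf_const curve_b
        in 4 * y * (x ^ 6 + 5 * a * x ^ 4 + 20 * b * x ^ 3 - 5 * a ^ 2 * x ^ 2
                    - 4 * a * b * x - 8 * b ^ 2 - a ^ 3))
     else if odd n then
       (let m = n div 2
        in div_pol (m + 2) * div_pol m ^ 3 - div_pol (m - 1) * div_pol (m + 1) ^ 3)
     else
       (let m = n div 2
        in (div_pol (m + 2) * div_pol (m - 1) ^ 2 - div_pol (m - 2) * div_pol (m + 1) ^ 2) * div_pol m / div_pol 2))"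
  by pat_completeness auto
termination
  by (relation "measure id") (auto elim!: oddE evenE)

declare div_pol.simps [simp del]

function prim_div_pol :: "nat \<Rightarrow> curve_fun" where
  "prim_div_pol k = div_pol k / (\<Prod>d\<in>{d. d dvd k \<and> 0 < d \<and> d < k}. prim_div_pol d)"
  by pat_completeness auto
termination
  by (relation "measure id") auto

declare prim_div_pol.simps [simp del]

text \<open>For \<open>k > 2\<close>, the polynomial in \<open>x\<close> that \<open>q\<^sub>k\<close> is.\<close>

definition q_poly :: "nat \<Rightarrow> Qj poly" where
  "q_poly k = (THE P. of_ratfun (to_fract P) = prim_div_pol k)"

text \<open>The truncating division is exact, as \<open>12\<close> divides \<open>num_exact_order k\<close> for \<open>k > 3\<close>.\<close>

definition F_fun :: "nat \<Rightarrow> curve_fun" where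
  "F_fun k = (if k = 2 then prim_div_pol 2 ^ 4 / cf_const (1728 * j0 ^ 2 * (j0 - 1))
          else if k = 3 then prim_div_pol 3 ^ 3 / prim_div_pol 2 ^ 8
          else prim_div_pol k / prim_div_pol 2 ^ (num_exact_order k div 3))"

text \<open>\<open>F\<^sub>k\<close> as an element of \<open>\<rat>(j)(x)\<close>.\<close>

definition F_ratfun :: "nat \<Rightarrow> Qjx" where
  "F_ratfun k = (THE u. of_ratfun u = F_fun k)"

section \<open>Cusps\<close>

definition Qj_embed :: "Qj \<Rightarrow> puiseux" where
  "Qj_embed = ratfun_eval of_rat puiseux_s"

definition expansions :: "nat \<Rightarrow> puiseux set" where
  "expansions N = {p. poly (map_poly Qj_embed (q_poly N)) p = 0}"

definition cusps :: "nat \<Rightarrow> puiseux set set" where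
  "cusps N = expansions N //
     {(p, p'). p \<in> expansions N \<and> p' \<in> expansions N \<and> conjugate_over_Qs p p'}"

text \<open>\<open>is_cusp N c C\<close> says that \<open>C\<close> is the cusp \<open>C\<^sub>c(N)\<close>.\<close>

definition is_cusp :: "nat \<Rightarrow> nat \<Rightarrow> puiseux set \<Rightarrow> bool" where
  "is_cusp N c C \<longleftrightarrow> C \<in> cusps N \<and>
     (\<forall>p\<in>C. v_s (p + 1) = ereal (if N = 4 \<and> c = 2 then 1 else real c / real N))"

text \<open>
  The valuation at a cusp of the class in \<open>\<rat>(s)[x]/(q\<^sub>N)\<close> of a rational function \<open>g\<close>, defined when
  the denominator of \<open>g\<close> is prime to \<open>q\<^sub>N\<close>.  The value is the same for all members \<open>p\<close> of a cusp.
\<close>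

definition cusp_order :: "puiseux set \<Rightarrow> Qjx \<Rightarrow> ereal" where
  "cusp_order C g =
     (THE v. \<forall>p\<in>C. v = ereal (real (ramification p)) * v_s (ratfun_eval Qj_embed p g))"

definition n_count :: "nat \<Rightarrow> nat \<Rightarrow> nat" where
  "n_count c k =
    (if k = 2 \<and> c = 1 then 2
     else if 0 < c \<and> 2 * c < k then totient (gcd c k) * (k div gcd c k)
     else if k > 2 \<and> 2 * c = k then totient (k div 2)
     else 0)"

definition e_cusp :: "nat \<Rightarrow> nat \<Rightarrow> nat" where
  "e_cusp c N = (if N = 4 \<and> c = 2 then 1 else N div gcd c N)"

definition v_fun :: "nat \<Rightarrow> real \<Rightarrow> real" where
  "v_fun k t =
    (if k = 2 then 4 * t - 1
     else (if k = 3 then 3 else 1) *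
       (- (real (num_exact_order k) / 3) * t + (\<Sum>c = 1..k div 2. real (n_count c k) * min t (real c / real k))))"

end

theory Submission
  imports Defs "HOL-Library.Product_Plus"
begin

text \<open>
  Over the field of Laurent series in a root of \<open>q\<close>, the curve has the Tate parametrization: with
  \<open>\<theta>\<close> Jacobi's odd theta series, \<open>x(u) - x(u')\<close> is a constant times
  \<open>\<theta>(uu') \<theta>(u/u') / (\<theta>(u)\<^sup>2 \<theta>(u')\<^sup>2)\<close>.  Hence \<open>\<theta>(u\<^sup>n) / \<theta>(u)\<^bsup>n\<^sup>2\<^esup>\<close> is, up to scaling, an elliptic
  divisibility sequence, which identifies it with the division polynomials at \<open>x(u)\<close>.  The roots of
  \<open>q\<^sub>k\<close> are therefore the \<open>x(u)\<close> with \<open>u = \<zeta>\<^sup>a q\<^bsup>c/k\<^esup>\<close> of exact order \<open>k\<close>, and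
  \<open>v(x(u) + 1) = c/k\<close> if \<open>0 \<le> c < k/2\<close>.  The leading monomials of \<open>\<theta>\<close> give
  \<open>v(x(u) - x(u')) = min(t, t')\<close> for points of heights \<open>t\<close>, \<open>t'\<close> in \<open>[0, 1/2]\<close>, where \<open>u\<close> has height
  \<open>c/k\<close>, and likewise \<open>v(x\<^sup>3 + ax + b) = 2t\<close>; the formula for \<open>v\<^sub>k\<close> follows by counting the
  points of order \<open>k\<close> at each height.  Since \<open>s = q + \<dots>\<close>, series in \<open>q\<close> can be rewritten as series in
  \<open>s\<close> without changing valuations.  The Somos-4 relation yields the multiples of a point over an algebraic
  closure, and with it the relation between \<open>q\<^sub>k\<close> and the number of points of exact order \<open>k\<close>.
\<close>

text \<open>At s = 0 one has j_0 = 1 and the curve degenerates to y^2 = (x + 1)^2 (x - 2), so -1 is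
  the x-coordinate of the node; this is why heights are read off from x + 1. At height 1/2 there is
  only a lower bound for the valuation of x + 1, because further cancellation is possible there; the
  exceptional cusp C_2(4) is an instance. All series are formal. The variable is q^(1/8M) because
  theta involves q^(1/8) and the square root of u, and for u = zeta^a q^(c/M) both then have
  integral exponents. Points of order N and of order k have to be compared over one field, so M is a
  common multiple of the two. The number m_k is defined over an algebraic closure of Q(j), whereas
  the roots are known explicitly only over Laurent series. What has to pass from one field to the
  other, simplicity of roots and coprimality of division polynomials, is carried by Bezout
  identities with coefficients in Q(j). Polynomial identities over Q(j) are likewise obtained by
  evaluation at infinitely many theta points.\<close>

unbundle fps_syntax

section \<open>Formal theta functions over Laurent series\<close>

section \<open>Sums of monomials\<close>

text \<open>The formal substitute for convergence: finite sublevel sets make every coefficient a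
  finite sum and bound the exponents from below, so that \<open>msum\<close> is a Laurent
  series.\<close>

definition adm :: "'i set \<Rightarrow> ('i \<Rightarrow> int) \<Rightarrow> bool" where
  "adm A d \<longleftrightarrow> (\<forall>k. finite {i\<in>A. d i \<le> k})"

definition msum :: "'i set \<Rightarrow> ('i \<Rightarrow> complex) \<Rightarrow> ('i \<Rightarrow> int) \<Rightarrow> complex fls" where
  "msum A a d = Abs_fls (\<lambda>k. \<Sum>i | i \<in> A \<and> d i = k. a i)"

lemma adm_lower_bound:
  assumes "adm A d"
  obtains m where "\<And>i. i \<in> A \<Longrightarrow> m \<le> d i"
proof -
  have fin: "finite {i\<in>A. d i \<le> 0}" using assms by (auto simp: adm_def)
  show ?thesis
  proof (rule that)
    \<comment> \<open>Only finitely many exponents are at most 0; inserting 0 covers the others and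
      keeps the set nonempty.\<close>
    fix i assume i: "i \<in> A"
    show "Min (insert 0 (d ` {i\<in>A. d i \<le> 0})) \<le> d i"
      using fin i by (cases "d i \<le> 0") (auto intro: Min_le simp: Min_le_iff)
  qed
qed

lemma adm_finite_eq: "adm A d \<Longrightarrow> finite {i. i \<in> A \<and> d i = k}"
  unfolding adm_def by (rule finite_subset[of _ "{i\<in>A. d i \<le> k}"]) auto

lemma msum_nth:
  assumes "adm A d"
  shows "msum A a d $$ k = (\<Sum>i | i \<in> A \<and> d i = k. a i)"
proof -
  obtain m where m: "\<And>i. i \<in> A \<Longrightarrow> m \<le> d i" using adm_lower_bound[OF assms] by blast
  show ?thesis unfolding msum_def
  proof (rule nth_Abs_fls_lower_bound, intro allI impI)
    fix n assume "n < m"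
    hence "{i. i \<in> A \<and> d i = n} = {}" using m by force
    thus "(\<Sum>i | i \<in> A \<and> d i = n. a i) = 0" by (simp only: sum.empty)
  qed
qed

lemma adm_subset: "adm A d \<Longrightarrow> B \<subseteq> A \<Longrightarrow> adm B d"
  unfolding adm_def by (intro allI, rule finite_subset[of _ "{i \<in> A. d i \<le> _}"]) auto

lemma adm_Times:
  assumes "adm A d" "adm B e"
  shows "adm (A \<times> B) (\<lambda>p. d (fst p) + e (snd p))"
  unfolding adm_def
proof
  fix k
  obtain m where m: "\<And>i. i \<in> A \<Longrightarrow> m \<le> d i" using adm_lower_bound[OF assms(1)] by blast
  obtain n where n: "\<And>i. i \<in> B \<Longrightarrow> n \<le> e i" using adm_lower_bound[OF assms(2)] by blast
  have "{p \<in> A \<times> B. d (fst p) + e (snd p) \<le> k} \<subseteq> {i\<in>A. d i \<le> k - n} \<times> {i\<in>B. e i \<le> k - m}"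
    using m n by force
  moreover have "finite \<dots>" using assms by (auto simp: adm_def)
  ultimately show "finite {p \<in> A \<times> B. d (fst p) + e (snd p) \<le> k}" using finite_subset by blast
qed

lemma msum_reindex:
  assumes "bij_betw f A B"
  shows "msum A (\<lambda>i. a (f i)) (\<lambda>i. d (f i)) = msum B a d"
proof -
  have "(\<Sum>i | i \<in> A \<and> d (f i) = k. a (f i)) = (\<Sum>i | i \<in> B \<and> d i = k. a i)" for k
    by (rule sum.reindex_bij_betw) (use assms in \<open>auto simp: bij_betw_def inj_on_def\<close>)
  thus ?thesis by (simp add: msum_def)
qed

lemma msum_cong: "A = B \<Longrightarrow> (\<And>i. i \<in> B \<Longrightarrow> a i = b i) \<Longrightarrow> (\<And>i. i \<in> B \<Longrightarrow> d i = e i) \<Longrightarrow> msum A a d = msum B b e"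
  unfolding msum_def by (intro arg_cong[of _ _ Abs_fls] ext sum.cong) auto

lemma msum_Un:
  assumes "adm A d" "adm B d" "A \<inter> B = {}"
  shows "msum (A \<union> B) a d = msum A a d + msum B a d"
proof (rule fls_eqI)
  fix n
  have "{i \<in> A \<union> B. d i \<le> k} = {i \<in> A. d i \<le> k} \<union> {i \<in> B. d i \<le> k}" for k by auto
  hence adm: "adm (A \<union> B) d" using assms by (simp add: adm_def)
  have "{i. i \<in> A \<union> B \<and> d i = n} = {i. i \<in> A \<and> d i = n} \<union> {i. i \<in> B \<and> d i = n}" by auto
  thus "msum (A \<union> B) a d $$ n = (msum A a d + msum B a d) $$ n"
    using assms by (simp add: msum_nth adm adm_finite_eq sum.union_disjoint disjoint_iff)
qed

lemma msum_uminus: "adm A d \<Longrightarrow> msum A (\<lambda>i. - a i) d = - msum A a d"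
  by (rule fls_eqI) (simp add: msum_nth sum_negf)

lemma msum_shift:
  assumes "adm A d"
  shows "msum A (\<lambda>i. c * a i) (\<lambda>i. d i + n) = fls_shift (- n) (fls_const c * msum A a d)"
proof (rule fls_eqI)
  fix k
  have adm: "adm A (\<lambda>i. d i + n)"
    using assms unfolding adm_def by (simp add: le_diff_eq flip: le_diff_eq)
  have "fls_shift (- n) (fls_const c * msum A a d) $$ k = c * msum A a d $$ (k - n)"
    by simp
  also have "\<dots> = (\<Sum>i | i \<in> A \<and> d i + n = k. c * a i)"
    using assms by (simp add: msum_nth sum_distrib_left eq_diff_eq)
  finally show "msum A (\<lambda>i. c * a i) (\<lambda>i. d i + n) $$ k = fls_shift (- n) (fls_const c * msum A a d) $$ k"
    by (simp add: msum_nth[OF adm])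
qed

text \<open>Lowering the bounds of the convolution below the subdegrees only adds vanishing terms.
  For a formal sum a lower bound is known, the exact subdegree is not.\<close>

lemma fls_times_nth_bounds:
  fixes f g :: "complex fls"
  assumes "\<And>k. k < m \<Longrightarrow> f $$ k = 0" "\<And>k. k < n \<Longrightarrow> g $$ k = 0"
  shows "(f * g) $$ k = (\<Sum>i=m..k - n. f $$ i * g $$ (k - i))"
proof (cases "f = 0 \<or> g = 0")
  case False
  hence "m \<le> fls_subdegree f" "n \<le> fls_subdegree g"
    using assms by (auto simp: fls_subdegree_geI)
  hence "(\<Sum>i=m..k - n. f $$ i * g $$ (k - i)) = (\<Sum>i=fls_subdegree f..k - fls_subdegree g. f $$ i * g $$ (k - i))"
    by (intro sum.mono_neutral_right) (auto simp: not_le)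
  thus ?thesis by (simp add: fls_times_nth(2))
qed auto

text \<open>Cauchy product: pairs of total exponent \<open>k\<close> are grouped by the exponent of
  the first factor, which the two lower bounds confine to a finite range.\<close>

lemma msum_mult:
  assumes "adm A d" "adm B e"
  shows "msum A a d * msum B b e = msum (A \<times> B) (\<lambda>p. a (fst p) * b (snd p)) (\<lambda>p. d (fst p) + e (snd p))"
proof (rule fls_eqI)
  fix k
  obtain m where m: "\<And>i. i \<in> A \<Longrightarrow> m \<le> d i" using adm_lower_bound[OF assms(1)] by blast
  obtain n where n: "\<And>i. i \<in> B \<Longrightarrow> n \<le> e i" using adm_lower_bound[OF assms(2)] by blast
  have 1: "msum A a d $$ i = 0" if "i < m" for i
    using m that by (force simp: msum_nth assms intro!: sum.neutral)
  have 2: "msum B b e $$ i = 0" if "i < n" for i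
    using n that by (force simp: msum_nth assms intro!: sum.neutral)
  let ?S = "\<lambda>i. {x. x \<in> A \<and> d x = i} \<times> {y. y \<in> B \<and> e y = k - i}"
  have "(msum A a d * msum B b e) $$ k = (\<Sum>i=m..k - n. msum A a d $$ i * msum B b e $$ (k - i))"
    by (rule fls_times_nth_bounds) (use 1 2 in auto)
  also have "\<dots> = (\<Sum>i=m..k-n. \<Sum>p\<in>?S i. a (fst p) * b (snd p))"
    by (simp add: msum_nth assms sum_product sum.cartesian_product split_def)
  also have "\<dots> = (\<Sum>p\<in>(\<Union>i\<in>{m..k-n}. ?S i). a (fst p) * b (snd p))"
    by (rule sum.UNION_disjoint[symmetric]) (auto simp: adm_finite_eq assms)
  also have "(\<Union>i\<in>{m..k-n}. ?S i) = {p. p \<in> A \<times> B \<and> d (fst p) + e (snd p) = k}"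
  proof -
    have "d x \<in> {m..k-n}" if "x \<in> A" "y \<in> B" "d x + e y = k" for x y
      using m[OF that(1)] n[OF that(2)] that(3) by auto
    thus ?thesis by (fastforce simp: mem_Times_iff)
  qed
  finally show "(msum A a d * msum B b e) $$ k = msum (A \<times> B) (\<lambda>p. a (fst p) * b (snd p)) (\<lambda>p. d (fst p) + e (snd p)) $$ k"
    by (simp add: msum_nth adm_Times assms)
qed

lemma adm_quadratic:
  assumes "g > 0"
  shows "adm A (\<lambda>r::int. g * r ^ 2 + l * r)"
  unfolding adm_def
proof
  fix k
  have "{i\<in>A. g * i ^ 2 + l * i \<le> k} \<subseteq> {- (\<bar>l\<bar> + \<bar>k\<bar>) .. \<bar>l\<bar> + \<bar>k\<bar>}"
  proof
    fix i assume "i \<in> {i\<in>A. g * i ^ 2 + l * i \<le> k}"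
    hence le: "g * i ^ 2 + l * i \<le> k" by simp
    have "\<bar>i\<bar> \<le> \<bar>l\<bar> + \<bar>k\<bar>"
    proof (rule ccontr)
      assume "\<not> ?thesis"
      hence gt: "\<bar>i\<bar> > \<bar>l\<bar> + \<bar>k\<bar>" by simp
      \<comment> \<open>Since g is at least 1, the inequality bounds |i| (|i| - |l|) by k, which
        fails once |i| exceeds |l| + |k|.\<close>
      have "g * i ^ 2 \<ge> 1 * i ^ 2" using assms by (intro mult_right_mono) auto
      moreover have "l * i \<ge> - (\<bar>l\<bar> * \<bar>i\<bar>)" by (metis abs_ge_minus_self abs_mult minus_le_iff)
      ultimately have "\<bar>i\<bar> * (\<bar>i\<bar> - \<bar>l\<bar>) \<le> k"
        using le by (simp add: power2_eq_square algebra_simps flip: abs_mult)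
      moreover have "\<bar>i\<bar> * (\<bar>i\<bar> - \<bar>l\<bar>) \<ge> \<bar>i\<bar> * 1" using gt by (intro mult_left_mono) auto
      ultimately show False using gt by simp
    qed
    thus "i \<in> {- (\<bar>l\<bar> + \<bar>k\<bar>) .. \<bar>l\<bar> + \<bar>k\<bar>}" by auto
  qed
  thus "finite {i\<in>A. g * i ^ 2 + l * i \<le> k}" by (rule finite_subset) auto
qed

section \<open>Theta series\<close>

text \<open>
  In the variable \<open>T = fls_X\<close>, a point \<open>(z, l)\<close> stands for \<open>u = exp(2z) T\<^bsup>2l\<^esup>\<close>, and \<open>theta g\<close> is Jacobi's
  odd theta series with nome \<open>q = T\<^bsup>8g\<^esup>\<close>.
\<close>

type_synonym point = "complex \<times> int"

text \<open>With \<open>A\<close> a parity class these are theta functions without signs;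
  \<open>m\<close> scales the argument. Products of two of them lead back to the family with
  \<open>h\<close> and \<open>m\<close> doubled.\<close>

definition lat :: "int set \<Rightarrow> int \<Rightarrow> int \<Rightarrow> point \<Rightarrow> complex fls" where
  "lat A h m p = msum A (\<lambda>r. exp (of_int (m * r) * fst p)) (\<lambda>r. h * r ^ 2 + m * snd p * r)"

text \<open>On odd \<open>r\<close> this is minus the nontrivial character modulo 4, the sign that
  makes \<open>theta\<close> an odd function.\<close>

definition chi :: "int \<Rightarrow> complex" where
  "chi r = (if r mod 4 = 3 then 1 else -1)"

definition theta :: "int \<Rightarrow> point \<Rightarrow> complex fls" where
  "theta g p = msum {r. odd r} (\<lambda>r. chi r * exp (of_int r * fst p)) (\<lambda>r. g * r ^ 2 + snd p * r)"

abbreviation rot :: "int \<times> int \<Rightarrow> int \<times> int" where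
  "rot \<equiv> \<lambda>q. (fst q + snd q, fst q - snd q)"

lemma rot_div:
  fixes a b :: int
  assumes "even a \<longleftrightarrow> even b"
  shows "(a + b) div 2 + (a - b) div 2 = a" "(a + b) div 2 - (a - b) div 2 = b"
  using assms by presburger+

lemma parity_rot_div:
  fixes a b :: int
  assumes "odd a" "odd b"
  shows "even ((a + b) div 2) \<longleftrightarrow> odd ((a - b) div 2)"
  using assms by presburger

lemma bij_rot_even: "bij_betw rot {q. even (fst q + snd q)} ({r. even r} \<times> {r. even r})"
  by (rule bij_betw_byWitness[where f' = "\<lambda>q. ((fst q + snd q) div 2, (fst q - snd q) div 2)"])
    (auto simp: rot_div)

lemma bij_rot_odd: "bij_betw rot {q. odd (fst q + snd q)} ({r. odd r} \<times> {r. odd r})"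
  by (rule bij_betw_byWitness[where f' = "\<lambda>q. ((fst q + snd q) div 2, (fst q - snd q) div 2)"])
    (auto simp: rot_div parity_rot_div)

lemma Collect_parity:
  "{q::int \<times> int. even (fst q + snd q)} = {r. even r} \<times> {r. even r} \<union> {r. odd r} \<times> {r. odd r}"
  "{q::int \<times> int. odd (fst q + snd q)} = {r. even r} \<times> {r. odd r} \<union> {r. odd r} \<times> {r. even r}"
  by auto

text \<open>
  Squares add up to \<open>(U + V)\<^sup>2 + (U - V)\<^sup>2 = 2 (U\<^sup>2 + V\<^sup>2)\<close>, so the change of summation indices
  \<open>rot\<close> separates the variables in products of theta series at \<open>p + p'\<close> and \<open>p - p'\<close>.
\<close>

lemma msum_rot:
  fixes a b :: "int \<Rightarrow> complex" and p p' :: point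
  assumes f: "bij_betw rot S (A \<times> B)" and h: "h > 0"
  shows "msum A (\<lambda>r. a r * exp (of_int (m * r) * fst (p + p'))) (\<lambda>r. h * r ^ 2 + m * snd (p + p') * r) *
         msum B (\<lambda>r. b r * exp (of_int (m * r) * fst (p - p'))) (\<lambda>r. h * r ^ 2 + m * snd (p - p') * r) =
         msum S (\<lambda>q. a (fst q + snd q) * b (fst q - snd q) *
                   (exp (of_int (2 * m * fst q) * fst p) * exp (of_int (2 * m * snd q) * fst p')))
           (\<lambda>q. (2 * h * fst q ^ 2 + 2 * m * snd p * fst q) + (2 * h * snd q ^ 2 + 2 * m * snd p' * snd q))"
    (is "?L = ?R")
proof -
  let ?a = "\<lambda>q. (a (fst q) * exp (of_int (m * fst q) * fst (p + p'))) *
                 (b (snd q) * exp (of_int (m * snd q) * fst (p - p')))"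
  let ?d = "\<lambda>q. (h * fst q ^ 2 + m * snd (p + p') * fst q) + (h * snd q ^ 2 + m * snd (p - p') * snd q)"
  have "?L = msum (A \<times> B) ?a ?d"
    by (intro msum_mult adm_quadratic h)
  also have "\<dots> = msum S (\<lambda>q. ?a (rot q)) (\<lambda>q. ?d (rot q))"
    by (rule msum_reindex[OF f, symmetric])
  also have "\<dots> = ?R"
    by (intro msum_cong refl) (simp_all add: power2_eq_square algebra_simps flip: exp_add)
  finally show ?thesis .
qed

lemma adm_double:
  assumes "h > 0"
  shows "adm S (\<lambda>q. (h * fst q ^ 2 + m * fst q) + (h * snd q ^ 2 + m' * snd q))"
proof (rule adm_subset)
  show "adm (UNIV \<times> UNIV) (\<lambda>q. (h * fst q ^ 2 + m * fst q) + (h * snd q ^ 2 + m' * snd q))"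
    using adm_Times[OF adm_quadratic[OF assms, of UNIV m] adm_quadratic[OF assms, of UNIV m']] by simp
qed auto

lemma lat_mult:
  assumes "h > 0"
  shows "lat A h m p * lat B h m p' =
    msum (A \<times> B) (\<lambda>q. exp (of_int (m * fst q) * fst p) * exp (of_int (m * snd q) * fst p'))
      (\<lambda>q. (h * fst q ^ 2 + m * snd p * fst q) + (h * snd q ^ 2 + m * snd p' * snd q))"
  unfolding lat_def by (intro msum_mult adm_quadratic assms)

lemma lat_rot:
  assumes "bij_betw rot S (A \<times> B)" "h > 0"
  shows "lat A h m (p + p') * lat B h m (p - p') =
         msum S (\<lambda>q. exp (of_int (2 * m * fst q) * fst p) * exp (of_int (2 * m * snd q) * fst p'))
           (\<lambda>q. (2 * h * fst q ^ 2 + 2 * m * snd p * fst q) + (2 * h * snd q ^ 2 + 2 * m * snd p' * snd q))"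
  using msum_rot[OF assms, of "\<lambda>_. 1" m p p' "\<lambda>_. 1"] unfolding lat_def by simp

lemma msum_parity_odd:
  assumes "h > 0"
  shows "msum {q. odd (fst q + snd q)} (\<lambda>q. exp (of_int (m * fst q) * fst p) * exp (of_int (m * snd q) * fst p'))
           (\<lambda>q. (h * fst q ^ 2 + m * snd p * fst q) + (h * snd q ^ 2 + m * snd p' * snd q)) =
         lat {r. even r} h m p * lat {r. odd r} h m p' + lat {r. odd r} h m p * lat {r. even r} h m p'"
  unfolding Collect_parity using assms
  by (subst msum_Un) (auto simp: lat_mult intro!: adm_double)

lemma msum_parity_even:
  assumes "h > 0"
  shows "msum {q. even (fst q + snd q)} (\<lambda>q. exp (of_int (m * fst q) * fst p) * exp (of_int (m * snd q) * fst p'))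
           (\<lambda>q. (h * fst q ^ 2 + m * snd p * fst q) + (h * snd q ^ 2 + m * snd p' * snd q)) =
         lat {r. even r} h m p * lat {r. even r} h m p' + lat {r. odd r} h m p * lat {r. odd r} h m p'"
  unfolding Collect_parity using assms
  by (subst msum_Un) (auto simp: lat_mult intro!: adm_double)

text \<open>U + V and U - V are both even exactly when U and V have equal parity, which splits the
  product into an even-even and an odd-odd part.\<close>

lemma lat_even_even:
  assumes "h > 0"
  shows "lat {r. even r} h m (p + p') * lat {r. even r} h m (p - p') =
    lat {r. even r} (2 * h) (2 * m) p * lat {r. even r} (2 * h) (2 * m) p' +
    lat {r. odd r} (2 * h) (2 * m) p * lat {r. odd r} (2 * h) (2 * m) p'"
  using lat_rot[OF bij_rot_even assms, of m p p'] msum_parity_even[of "2 * h" "2 * m" p p'] assms by simp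

lemma lat_odd_odd:
  assumes "h > 0"
  shows "lat {r. odd r} h m (p + p') * lat {r. odd r} h m (p - p') =
    lat {r. even r} (2 * h) (2 * m) p * lat {r. odd r} (2 * h) (2 * m) p' +
    lat {r. odd r} (2 * h) (2 * m) p * lat {r. even r} (2 * h) (2 * m) p'"
  using lat_rot[OF bij_rot_odd assms, of m p p'] msum_parity_odd[of "2 * h" "2 * m" p p'] assms by simp

text \<open>Here \<open>rot\<close> is read in the other direction: the product at \<open>p\<close>
  and \<open>p'\<close> is rewritten in \<open>p + p'\<close> and \<open>p - p'\<close>, so
  \<open>h\<close> doubles while \<open>m\<close> stays.\<close>

lemma lat_mixed:
  assumes "h > 0"
  shows "lat {r. even r} (2 * h) m (p + p') * lat {r. odd r} (2 * h) m (p - p') +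
         lat {r. odd r} (2 * h) m (p + p') * lat {r. even r} (2 * h) m (p - p') =
    lat {r. odd r} h m p * lat {r. odd r} h m p'"
proof -
  let ?a = "\<lambda>q::int \<times> int. exp (of_int (m * fst q) * fst p) * exp (of_int (m * snd q) * fst p')"
  let ?d = "\<lambda>q. (h * fst q ^ 2 + m * snd p * fst q) + (h * snd q ^ 2 + m * snd p' * snd q)"
  have "lat {r. odd r} h m p * lat {r. odd r} h m p' = msum ({r. odd r} \<times> {r. odd r}) ?a ?d"
    by (rule lat_mult[OF assms])
  also have "\<dots> = msum {q. odd (fst q + snd q)} (\<lambda>q. ?a (rot q)) (\<lambda>q. ?d (rot q))"
    by (rule msum_reindex[OF bij_rot_odd, symmetric])
  also have "\<dots> = msum {q. odd (fst q + snd q)}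
      (\<lambda>q. exp (of_int (m * fst q) * fst (p + p')) * exp (of_int (m * snd q) * fst (p - p')))
      (\<lambda>q. (2 * h * fst q ^ 2 + m * snd (p + p') * fst q) + (2 * h * snd q ^ 2 + m * snd (p - p') * snd q))"
    by (intro msum_cong refl) (simp_all add: power2_eq_square algebra_simps flip: exp_add)
  also have "\<dots> = lat {r. even r} (2 * h) m (p + p') * lat {r. odd r} (2 * h) m (p - p') +
         lat {r. odd r} (2 * h) m (p + p') * lat {r. even r} (2 * h) m (p - p')"
    by (rule msum_parity_odd) (use assms in simp)
  finally show ?thesis by simp
qed

text \<open>That the sign depends only on the parity of \<open>u\<close> is what turns the theta
  product into a difference of two separated products.\<close>

lemma chi_add_minus:
  assumes "odd (u + v)"
  shows "chi (u + v) * chi (u - v) = (if odd u then 1 else -1)"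
proof -
  have "u mod 4 = 0 \<or> u mod 4 = 1 \<or> u mod 4 = 2 \<or> u mod 4 = 3" "v mod 4 = 0 \<or> v mod 4 = 1 \<or> v mod 4 = 2 \<or> v mod 4 = 3"
    by presburger+
  moreover have "(u + v) mod 4 = (u mod 4 + v mod 4) mod 4" "(u - v) mod 4 = (u mod 4 - v mod 4) mod 4"
    by (simp_all add: mod_simps)
  moreover have "odd u \<longleftrightarrow> odd (u mod 4)" "odd v \<longleftrightarrow> odd (v mod 4)" by presburger+
  moreover have "odd u \<noteq> odd v" using assms by auto
  ultimately show ?thesis by (elim disjE) (simp_all add: chi_def)
qed

text \<open>The counterpart of the addition formula of the Weierstrass sigma function. The two mixed
  parity classes enter with opposite signs, giving a 2 by 2 determinant in values at
  \<open>p\<close> and at \<open>p'\<close>.\<close>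

lemma theta_add_minus:
  assumes "g > 0"
  shows "theta g (p + p') * theta g (p - p') =
    lat {r. odd r} (2 * g) 2 p * lat {r. even r} (2 * g) 2 p' -
    lat {r. even r} (2 * g) 2 p * lat {r. odd r} (2 * g) 2 p'"
proof -
  let ?a = "\<lambda>q::int \<times> int. exp (of_int (2 * fst q) * fst p) * exp (of_int (2 * snd q) * fst p')"
  let ?d = "\<lambda>q. (2 * g * fst q ^ 2 + 2 * snd p * fst q) + (2 * g * snd q ^ 2 + 2 * snd p' * snd q)"
  have adm: "adm S ?d" for S using assms by (intro adm_double) simp
  have "theta g (p + p') * theta g (p - p') =
    msum {q. odd (fst q + snd q)} (\<lambda>q. chi (fst q + snd q) * chi (fst q - snd q) * ?a q) ?d"
    using msum_rot[OF bij_rot_odd assms, of chi 1 p p' chi] unfolding theta_def by simp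
  also have "\<dots> = msum {q. odd (fst q + snd q)} (\<lambda>q. (if odd (fst q) then ?a q else - ?a q)) ?d"
    by (intro msum_cong refl) (simp add: chi_add_minus)
  also have "\<dots> = msum ({r. even r} \<times> {r. odd r}) (\<lambda>q. (if odd (fst q) then ?a q else - ?a q)) ?d +
      msum ({r. odd r} \<times> {r. even r}) (\<lambda>q. (if odd (fst q) then ?a q else - ?a q)) ?d"
    unfolding Collect_parity by (subst msum_Un) (auto intro: adm)
  also have "msum ({r. even r} \<times> {r. odd r}) (\<lambda>q. (if odd (fst q) then ?a q else - ?a q)) ?d =
      msum ({r. even r} \<times> {r. odd r}) (\<lambda>q. - ?a q) ?d"
    by (intro msum_cong refl) auto
  also have "\<dots> = - msum ({r. even r} \<times> {r. odd r}) ?a ?d"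
    by (rule msum_uminus[OF adm])
  also have "msum ({r. odd r} \<times> {r. even r}) (\<lambda>q. (if odd (fst q) then ?a q else - ?a q)) ?d =
      msum ({r. odd r} \<times> {r. even r}) ?a ?d"
    by (intro msum_cong refl) auto
  finally show ?thesis using assms by (simp add: lat_mult)
qed

section \<open>Multiples of a point\<close>

definition smul :: "int \<Rightarrow> point \<Rightarrow> point" where
  "smul n p = (of_int n * fst p, n * snd p)"

lemma smul_add: "smul m p + smul n p = smul (m + n) p"
  and smul_diff: "smul m p - smul n p = smul (m - n) p"
  and smul_0 [simp]: "smul 0 p = 0"
  and smul_1 [simp]: "smul 1 p = p"
  by (simp_all add: smul_def prod_eq_iff algebra_simps)

text \<open>\<open>B0\<close> and \<open>B1\<close> are projective coordinates on the quotient of the curve by \<open>\<plusminus>1\<close>.\<close>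

locale theta_series =
  fixes g :: int
  assumes g_pos: "g > 0"
begin

abbreviation "T \<equiv> theta g"
definition "B0 = lat {r. even r} (2 * g) 2"
definition "B1 = lat {r. odd r} (2 * g) 2"
text \<open>\<open>b0\<close> and \<open>b1\<close> are the theta constants sum q^(n^2) and sum
  q^((n + 1/2)^2), that is theta_3 and theta_2 at the doubled period.\<close>

definition "b0 = B0 0"
definition "b1 = B1 0"
definition "disc = b0 ^ 4 - b1 ^ 4"

lemma T_add_minus: "T (p + p') * T (p - p') = B1 p * B0 p' - B0 p * B1 p'"
  unfolding B0_def B1_def by (rule theta_add_minus[OF g_pos])

lemma T_sq: "T p ^ 2 = B1 p * b0 - B0 p * b1"
  using T_add_minus[of p 0] by (simp add: b0_def b1_def power2_eq_square)

lemma T_0 [simp]: "T 0 = 0"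
  using T_sq[of 0] by (simp add: b0_def b1_def)

text \<open>Duplication passes through the functions \<open>C0\<close>, \<open>C1\<close> of the
  next level: the squares of \<open>B0\<close> and \<open>B1\<close> are linear in them and the
  doubled values quadratic, so eliminating them leaves quartic forms in \<open>B0\<close>,
  \<open>B1\<close>.\<close>

lemma B_double:
  shows "B0 (p + p) * b0 * disc = b0\<^sup>2 * (B0 p ^ 4 + B1 p ^ 4) - 2 * b1\<^sup>2 * B0 p ^ 2 * B1 p ^ 2"
    and "B1 (p + p) * b1 * disc = 2 * b0\<^sup>2 * B0 p ^ 2 * B1 p ^ 2 - b1\<^sup>2 * (B0 p ^ 4 + B1 p ^ 4)"
proof -
  define C0 C1 where "C0 = lat {r. even r} (4 * g) 4" and "C1 = lat {r. odd r} (4 * g) 4"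
  define \<alpha> \<beta> where "\<alpha> = C0 0" and "\<beta> = C1 0"
  have 0: "B0 (p + p') * B0 (p - p') = C0 p * C0 p' + C1 p * C1 p'" for p p'
    using lat_even_even[of "2 * g" 2 p p'] g_pos by (simp add: B0_def C0_def C1_def)
  have 1: "B1 (p + p') * B1 (p - p') = C0 p * C1 p' + C1 p * C0 p'" for p p'
    using lat_odd_odd[of "2 * g" 2 p p'] g_pos by (simp add: B1_def C0_def C1_def)
  have B: "B0 p ^ 2 = C0 p * \<alpha> + C1 p * \<beta>" "B1 p ^ 2 = C0 p * \<beta> + C1 p * \<alpha>" for p
    using 0[of p 0] 1[of p 0] by (simp_all add: \<alpha>_def \<beta>_def power2_eq_square)
  have b: "b0\<^sup>2 = \<alpha>\<^sup>2 + \<beta>\<^sup>2" "b1\<^sup>2 = 2 * \<alpha> * \<beta>"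
    using B[of 0] by (simp_all add: \<alpha>_def \<beta>_def b0_def b1_def power2_eq_square algebra_simps)
  have d: "disc = (\<alpha>\<^sup>2 - \<beta>\<^sup>2)\<^sup>2"
  proof -
    have "disc = (b0\<^sup>2)\<^sup>2 - (b1\<^sup>2)\<^sup>2" by (simp add: disc_def)
    thus ?thesis unfolding b by (simp add: power2_eq_square algebra_simps)
  qed
  have 4: "B0 p ^ 4 = (B0 p ^ 2)\<^sup>2" "B1 p ^ 4 = (B1 p ^ 2)\<^sup>2" by simp_all
  have "B0 (p + p) * b0 = C0 p ^ 2 + C1 p ^ 2"
    using 0[of p p] by (simp add: b0_def power2_eq_square)
  thus "B0 (p + p) * b0 * disc = b0\<^sup>2 * (B0 p ^ 4 + B1 p ^ 4) - 2 * b1\<^sup>2 * B0 p ^ 2 * B1 p ^ 2"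
    unfolding 4 B b d by (simp add: power2_eq_square algebra_simps)
  have "B1 (p + p) * b1 = 2 * C0 p * C1 p"
    using 1[of p p] by (simp add: b1_def)
  thus "B1 (p + p) * b1 * disc = 2 * b0\<^sup>2 * B0 p ^ 2 * B1 p ^ 2 - b1\<^sup>2 * (B0 p ^ 4 + B1 p ^ 4)"
    unfolding 4 B b d by (simp add: power2_eq_square algebra_simps)
qed

text \<open>The odd series \<open>G\<close> with halved quadratic form is proportional to the
  product of \<open>B0\<close> and \<open>B1\<close>; its addition formula at 2p and p involves 3p
  and p. Only this symmetric combination of the tripled values is needed later.\<close>

lemma B_triple:
  "(B0 (p + p + p) * B1 p + B1 (p + p + p) * B0 p) * (b0 * b1) = 2 * B0 (p + p) * B1 (p + p) * B0 p * B1 p"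
proof -
  define G where "G = lat {r. odd r} g 2"
  have G: "B0 (p + p') * B1 (p - p') + B1 (p + p') * B0 (p - p') = G p * G p'" for p p'
    using lat_mixed[of "g" 2 p p'] g_pos by (simp add: B0_def B1_def G_def)
  have 1: "2 * (B0 p * B1 p) = G p * G 0" for p
    using G[of p 0] by simp
  have 0: "2 * (b0 * b1) = G 0 ^ 2"
    using 1[of 0] by (simp add: b0_def b1_def power2_eq_square)
  have 3: "B0 (p + p + p) * B1 p + B1 (p + p + p) * B0 p = G (p + p) * G p"
    using G[of "p + p" p] by simp
  have "2 * ((B0 (p + p + p) * B1 p + B1 (p + p + p) * B0 p) * (b0 * b1)) = (G (p + p) * G 0) * (G p * G 0)"
  proof -
    have "2 * (G (p + p) * G p * (b0 * b1)) = G (p + p) * G p * (2 * (b0 * b1))" by simp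
    thus ?thesis unfolding 3 0 power2_eq_square by simp
  qed
  also have "\<dots> = 2 * (2 * B0 (p + p) * B1 (p + p) * B0 p * B1 p)"
    unfolding 1[symmetric] by simp
  finally show ?thesis unfolding mult_cancel_left by simp
qed

text \<open>Each product of two thetas is the determinant of two vectors \<open>(B0, B1)\<close>,
  and T squared is one with the vector at the origin. The claim is the Pluecker relation for the
  four vectors at mp, np, p and 0.\<close>

lemma T_pluecker:
  "T (smul (m + n) p) * T (smul (m - n) p) * T p ^ 2 =
   T (smul (m + 1) p) * T (smul (m - 1) p) * T (smul n p) ^ 2 -
   T (smul (n + 1) p) * T (smul (n - 1) p) * T (smul m p) ^ 2"
proof -
  have *: "T (smul (m + n) p) * T (smul (m - n) p) =
     B1 (smul m p) * B0 (smul n p) - B0 (smul m p) * B1 (smul n p)" for m n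
    using T_add_minus[of "smul m p" "smul n p"] by (simp add: smul_add smul_diff)
  show ?thesis unfolding * smul_1 T_sq by (simp add: algebra_simps)
qed

end

section \<open>The Weierstrass equation satisfied by theta quotients, and valuations\<close>

section \<open>The curve attached to a pair of theta constants\<close>

text \<open>\<open>QQ2\<close>, \<open>QQ3\<close> and \<open>QQ4\<close> are y^2, Q_3 and Q_4 /
  (4y) as polynomials in x.\<close>

definition QQ2 :: "'a::field \<Rightarrow> 'a \<Rightarrow> 'a \<Rightarrow> 'a" where
  "QQ2 a b x = x ^ 3 + a * x + b"
definition QQ3 :: "'a::field \<Rightarrow> 'a \<Rightarrow> 'a \<Rightarrow> 'a" where
  "QQ3 a b x = 3 * x ^ 4 + 6 * a * x ^ 2 + 12 * b * x - a ^ 2"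
definition QQ4 :: "'a::field \<Rightarrow> 'a \<Rightarrow> 'a \<Rightarrow> 'a" where
  "QQ4 a b x = x ^ 6 + 5 * a * x ^ 4 + 20 * b * x ^ 3 - 5 * a ^ 2 * x ^ 2 - 4 * a * b * x - 8 * b ^ 2 - a ^ 3"

text \<open>The coefficients are those for which x = e is a 2-torsion point. In z = x - e the cubic
  loses its constant term, and Q_4 splits off z^2 - a4, whose roots are the points that double to z
  = 0.\<close>

lemma QQ_shift:
  fixes e a4 z :: "'a::field"
  assumes "a = a4 - 3 * e ^ 2" "b = 2 * e ^ 3 - e * a4"
  shows "QQ2 a b (z + e) = z ^ 3 + 3 * e * z ^ 2 + a4 * z"
    and "QQ3 a b (z + e) = 3 * z ^ 4 + 12 * e * z ^ 3 + 6 * a4 * z ^ 2 - a4 ^ 2"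
    and "QQ4 a b (z + e) = (z ^ 2 - a4) * (z ^ 4 + 6 * e * z ^ 3 + 6 * a4 * z ^ 2 + 6 * e * a4 * z + a4 ^ 2)"
  unfolding QQ2_def QQ3_def QQ4_def assms by (simp_all add: eval_nat_numeral algebra_simps)

text \<open>To be read with u = b0 B1, v = b1 B0, s = T^2, and with \<beta>, \<gamma> the fourth
  powers of the theta constants. As z is a Moebius function of u/v, powers of s clear all
  denominators and leave forms in u and v. The \<open>e\<close> here is three times the shift in
  \<open>QQ_shift\<close>.\<close>

lemma QQ_theta:
  fixes mu \<beta> \<gamma> u v s :: "'a::field"
  assumes s: "s = u - v" "s \<noteq> 0"
  defines "D \<equiv> \<beta> - \<gamma>"
  defines "e \<equiv> - 2 * mu * (\<beta> + \<gamma>)" and "a4 \<equiv> mu ^ 2 * D ^ 2" and "z \<equiv> mu * D * (u + v) / s"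
  shows "(z ^ 3 + e * z ^ 2 + a4 * z) * s ^ 4 = 2 * mu ^ 3 * D ^ 2 * (2 * \<gamma> * u ^ 2 * v ^ 2 + 2 * \<beta> * u ^ 2 * v ^ 2 - 2 * \<gamma> * u ^ 4 - 2 * \<beta> * v ^ 4)"
    and "(3 * z ^ 4 + 4 * e * z ^ 3 + 6 * a4 * z ^ 2 - a4 ^ 2) * s ^ 4 =
      16 * mu ^ 4 * D ^ 3 * (\<beta> * v ^ 3 * (2 * u + v) - \<gamma> * u ^ 3 * (u + 2 * v))"
    and "(z ^ 2 - a4) * (z ^ 4 + 2 * e * z ^ 3 + 6 * a4 * z ^ 2 + 2 * e * a4 * z + a4 ^ 2) * s ^ 6 =
      64 * mu ^ 6 * D ^ 5 * u * v * (\<beta> * v ^ 4 - \<gamma> * u ^ 4)"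
proof -
  define w S where "w = u + v" and "S = \<beta> + \<gamma>"
  have z: "z * s = mu * D * w" using s by (simp add: z_def w_def)
  have e: "e = - 2 * mu * S" by (simp add: e_def S_def)
  have "(z ^ 3 + e * z ^ 2 + a4 * z) * s ^ 4 = ((z * s) ^ 3 + e * (z * s) ^ 2 * s + a4 * (z * s) * s ^ 2) * s"
    by (simp add: eval_nat_numeral algebra_simps)
  also have "\<dots> = mu ^ 3 * D ^ 2 * ((D * w ^ 2 - 2 * S * w * s + D * s ^ 2) * w * s)"
    unfolding z e a4_def by (simp add: eval_nat_numeral algebra_simps)
  also have "(D * w ^ 2 - 2 * S * w * s + D * s ^ 2) * w * s =
      2 * (2 * \<gamma> * u ^ 2 * v ^ 2 + 2 * \<beta> * u ^ 2 * v ^ 2 - 2 * \<gamma> * u ^ 4 - 2 * \<beta> * v ^ 4)"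
    unfolding w_def S_def D_def s(1) by (simp add: eval_nat_numeral algebra_simps)
  finally show "(z ^ 3 + e * z ^ 2 + a4 * z) * s ^ 4 = 2 * mu ^ 3 * D ^ 2 * (2 * \<gamma> * u ^ 2 * v ^ 2 + 2 * \<beta> * u ^ 2 * v ^ 2 - 2 * \<gamma> * u ^ 4 - 2 * \<beta> * v ^ 4)"
    by simp
  have "(3 * z ^ 4 + 4 * e * z ^ 3 + 6 * a4 * z ^ 2 - a4 ^ 2) * s ^ 4 =
    3 * (z * s) ^ 4 + 4 * e * (z * s) ^ 3 * s + 6 * a4 * (z * s) ^ 2 * s ^ 2 - a4 ^ 2 * s ^ 4"
    by (simp add: eval_nat_numeral algebra_simps)
  also have "\<dots> = mu ^ 4 * D ^ 3 * (3 * D * w ^ 4 - 8 * S * w ^ 3 * s + 6 * D * w ^ 2 * s ^ 2 - D * s ^ 4)"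
    unfolding z e a4_def by (simp add: eval_nat_numeral algebra_simps)
  also have "3 * D * w ^ 4 - 8 * S * w ^ 3 * s + 6 * D * w ^ 2 * s ^ 2 - D * s ^ 4 =
      16 * (\<beta> * v ^ 3 * (2 * u + v) - \<gamma> * u ^ 3 * (u + 2 * v))"
    unfolding w_def S_def D_def s(1) by (simp add: eval_nat_numeral algebra_simps)
  finally show "(3 * z ^ 4 + 4 * e * z ^ 3 + 6 * a4 * z ^ 2 - a4 ^ 2) * s ^ 4 =
      16 * mu ^ 4 * D ^ 3 * (\<beta> * v ^ 3 * (2 * u + v) - \<gamma> * u ^ 3 * (u + 2 * v))"
    by simp
  have r: "A * B * s ^ 6 = (A * s ^ 2) * (B * s ^ 4)" for A B :: 'a
    by (simp add: eval_nat_numeral)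
  have f: "(4 * mu ^ 2 * D ^ 2 * u * v) * (16 * mu ^ 4 * D ^ 3 * W) = 64 * mu ^ 6 * D ^ 5 * u * v * W" for W
    by (simp add: eval_nat_numeral)
  have "(z ^ 2 - a4) * s ^ 2 = (z * s) ^ 2 - a4 * s ^ 2"
    by (simp add: eval_nat_numeral algebra_simps)
  also have "\<dots> = mu ^ 2 * D ^ 2 * (w ^ 2 - s ^ 2)"
    unfolding z a4_def by (simp add: eval_nat_numeral algebra_simps)
  also have "w ^ 2 - s ^ 2 = 4 * u * v"
    unfolding w_def s(1) by (simp add: eval_nat_numeral algebra_simps)
  finally have 1: "(z ^ 2 - a4) * s ^ 2 = 4 * mu ^ 2 * D ^ 2 * u * v" by simp
  have "(z ^ 4 + 2 * e * z ^ 3 + 6 * a4 * z ^ 2 + 2 * e * a4 * z + a4 ^ 2) * s ^ 4 =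
      (z * s) ^ 4 + 2 * e * (z * s) ^ 3 * s + 6 * a4 * (z * s) ^ 2 * s ^ 2 + 2 * e * a4 * (z * s) * s ^ 3 + a4 ^ 2 * s ^ 4"
    by (simp add: eval_nat_numeral algebra_simps)
  also have "\<dots> = mu ^ 4 * D ^ 3 * (D * w ^ 4 - 4 * S * w ^ 3 * s + 6 * D * w ^ 2 * s ^ 2 - 4 * S * w * s ^ 3 + D * s ^ 4)"
    unfolding z e a4_def by (simp add: eval_nat_numeral algebra_simps)
  also have "D * w ^ 4 - 4 * S * w ^ 3 * s + 6 * D * w ^ 2 * s ^ 2 - 4 * S * w * s ^ 3 + D * s ^ 4 =
      16 * (\<beta> * v ^ 4 - \<gamma> * u ^ 4)"
    unfolding w_def S_def D_def s(1) by (simp add: eval_nat_numeral algebra_simps)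
  finally have 2: "(z ^ 4 + 2 * e * z ^ 3 + 6 * a4 * z ^ 2 + 2 * e * a4 * z + a4 ^ 2) * s ^ 4 =
      16 * mu ^ 4 * D ^ 3 * (\<beta> * v ^ 4 - \<gamma> * u ^ 4)" by simp
  have "(z ^ 2 - a4) * (z ^ 4 + 2 * e * z ^ 3 + 6 * a4 * z ^ 2 + 2 * e * a4 * z + a4 ^ 2) * s ^ 6 =
    ((z ^ 2 - a4) * s ^ 2) * ((z ^ 4 + 2 * e * z ^ 3 + 6 * a4 * z ^ 2 + 2 * e * a4 * z + a4 ^ 2) * s ^ 4)"
    by (rule r)
  also have "\<dots> = 64 * mu ^ 6 * D ^ 5 * u * v * (\<beta> * v ^ 4 - \<gamma> * u ^ 4)"
    unfolding 1 2 by (rule f)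
  finally show "(z ^ 2 - a4) * (z ^ 4 + 2 * e * z ^ 3 + 6 * a4 * z ^ 2 + 2 * e * a4 * z + a4 ^ 2) * s ^ 6 =
      64 * mu ^ 6 * D ^ 5 * u * v * (\<beta> * v ^ 4 - \<gamma> * u ^ 4)" .
qed

section \<open>Valuations\<close>

text \<open>The subdegree of the zero series is 0, so a statement about a valuation has to carry
  nonvanishing with it.\<close>

definition has_val :: "complex fls \<Rightarrow> int \<Rightarrow> bool" where
  "has_val f n \<longleftrightarrow> f \<noteq> 0 \<and> fls_subdegree f = n"

lemma has_val_nonzero: "has_val f n \<Longrightarrow> f \<noteq> 0"
  by (simp add: has_val_def)

lemma has_val_mult: "has_val f m \<Longrightarrow> has_val h n \<Longrightarrow> has_val (f * h) (m + n)"
  by (simp add: has_val_def)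

lemma has_val_power: "has_val f m \<Longrightarrow> has_val (f ^ n) (int n * m)"
  by (simp add: has_val_def fls_subdegree_pow)

lemma has_val_inverse: "has_val f m \<Longrightarrow> has_val (inverse f) (- m)"
  by (simp add: has_val_def fls_inverse_subdegree)

lemma has_val_divide: "has_val f m \<Longrightarrow> has_val h n \<Longrightarrow> has_val (f / h) (m - n)"
  using has_val_mult[OF _ has_val_inverse] by (simp add: divide_inverse)

lemma has_val_uminus: "has_val (- f) m \<longleftrightarrow> has_val f m"
  by (simp add: has_val_def)

lemma has_val_const: "c \<noteq> 0 \<Longrightarrow> has_val (fls_const c) 0"
  by (simp add: has_val_def)

lemma has_val_of_nat: "n \<noteq> 0 \<Longrightarrow> has_val (of_nat n) 0"
  using has_val_const[of "of_nat n"] by (simp add: fls_of_nat)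

lemma has_val_numeral: "has_val (numeral n) 0"
  using has_val_of_nat[of "numeral n"] by simp

lemma has_val_add: "has_val f m \<Longrightarrow> h = 0 \<or> fls_subdegree h > m \<Longrightarrow> has_val (f + h) m"
  unfolding has_val_def using fls_subdegree_add_eq1[of f h] fls_uminus_subdegree[of f]
  by (cases "h = 0"; cases "f + h = 0") (auto simp: add_eq_0_iff)

text \<open>After removal of the monomial a unit power series remains; it has an n-th root because
  its constant term has one in the complex numbers.\<close>

lemma has_val_root:
  assumes "has_val f (int n * m)" "n > 0"
  obtains h where "h ^ n = f" "has_val h m"
proof -
  define u where "u = fls_regpart (fls_shift (int n * m) f)"
  have f: "f = fls_shift (- (int n * m)) (fps_to_fls u)"
    using assms(1) by (simp add: u_def has_val_def)
  have u0: "u $ 0 \<noteq> 0"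
    using assms(1) nth_fls_subdegree_nonzero[of f] by (simp add: u_def has_val_def)
  obtain y where y: "y ^ n = u $ 0" using nth_root_exists[OF assms(2)] by blast
  obtain k where k: "n = Suc k" using assms(2) by (cases n) auto
  define v where "v = fps_radical (\<lambda>_ _. y) n u"
  have v: "v ^ n = u"
    using power_radical[OF u0, of "\<lambda>_ _. y" k] y by (simp add: v_def k)
  have y0: "y \<noteq> 0" using y u0 assms(2) by (auto simp: zero_power)
  have v0: "v $ 0 \<noteq> 0" using y0 assms(2) by (simp add: v_def)
  define h where "h = fls_shift (- m) (fps_to_fls v)"
  have "h ^ n = fls_shift (- (int n * m)) (fps_to_fls (v ^ n))"
  proof -
    have "(fls_X_intpow m * fps_to_fls v) ^ n = fls_X_intpow (int n * m) * fps_to_fls (v ^ n)"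
      by (simp only: power_mult_distrib fls_X_intpow_power fps_to_fls_power)
    thus ?thesis by (simp add: h_def fls_shifted_times_simps)
  qed
  moreover have "h \<noteq> 0" "fls_subdegree h = m"
  proof -
    have "v \<noteq> 0" "subdegree v = 0" using v0 by (auto simp: subdegree_eq_0_iff)
    thus "h \<noteq> 0" "fls_subdegree h = m"
      by (simp_all add: h_def fls_subdegree_fls_to_fps fls_shift_eq0_iff fls_shift_subdegree)
  qed
  ultimately show ?thesis using that[of h] f v by (simp add: has_val_def)
qed

text \<open>Integral series with residue \<open>c\<close>. Residues respect the ring operations, so
  units are recognized without expansions.\<close>

definition reg :: "complex fls \<Rightarrow> complex \<Rightarrow> bool" where
  "reg f c \<longleftrightarrow> (\<forall>k<0. f $$ k = 0) \<and> f $$ 0 = c"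

lemma reg_add: "reg f c \<Longrightarrow> reg h d \<Longrightarrow> reg (f + h) (c + d)"
  and reg_diff: "reg f c \<Longrightarrow> reg h d \<Longrightarrow> reg (f - h) (c - d)"
  and reg_uminus: "reg f c \<Longrightarrow> reg (- f) (- c)"
  by (simp_all add: reg_def)

lemma reg_mult:
  assumes "reg f c" "reg h d"
  shows "reg (f * h) (c * d)"
proof -
  have "(f * h) $$ k = (\<Sum>i=0..k - 0. f $$ i * h $$ (k - i))" for k
    by (rule fls_times_nth_bounds) (use assms in \<open>auto simp: reg_def\<close>)
  thus ?thesis using assms by (auto simp: reg_def)
qed

lemma reg_1: "reg 1 1"
  by (simp add: reg_def)

lemma reg_power: "reg f c \<Longrightarrow> reg (f ^ n) (c ^ n)"
  by (induction n) (auto intro: reg_mult reg_1)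

lemma reg_numeral: "reg (numeral n) (numeral n)"
proof -
  have "numeral n = (fls_const (numeral n) :: complex fls)"
    by (metis fls_of_nat of_nat_numeral)
  thus ?thesis by (simp add: reg_def)
qed

lemma reg_has_val: "reg f c \<Longrightarrow> c \<noteq> 0 \<Longrightarrow> has_val f 0"
  by (auto simp: reg_def has_val_def intro!: fls_subdegree_eqI)

lemma has_val_reg: "has_val f m \<Longrightarrow> m > 0 \<Longrightarrow> reg f 0"
  by (auto simp: reg_def has_val_def)

lemma msum_has_val:
  assumes "adm A d" "\<And>i. i \<in> A \<Longrightarrow> m \<le> d i" "(\<Sum>i | i \<in> A \<and> d i = m. a i) \<noteq> 0"
  shows "has_val (msum A a d) m"
proof -
  have "msum A a d $$ m \<noteq> 0" using assms by (simp add: msum_nth)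
  moreover have "msum A a d $$ k = 0" if "k < m" for k
  proof -
    have "{i. i \<in> A \<and> d i = k} = {}" using assms(2) that by force
    thus ?thesis using assms by (simp only: msum_nth sum.empty)
  qed
  ultimately show ?thesis by (auto simp: has_val_def intro!: fls_subdegree_eqI)
qed

section \<open>Zeros and valuations of theta\<close>

context theta_series
begin

text \<open>The parabola of exponents has its vertex -l/(2g) strictly between -2 and 0, so among odd
  integers r = -1 alone is minimal.\<close>

lemma theta_has_val_inner:
  assumes "0 < l" "l < 4 * g"
  shows "has_val (T (z, l)) (g - l)"
proof -
  have 1: "g - l \<le> g * r ^ 2 + l * r" "g * r ^ 2 + l * r = g - l \<longleftrightarrow> r = -1" if "odd r" for r
  proof -
    have e: "g * r ^ 2 + l * r - (g - l) = (r + 1) * (g * (r - 1) + l)"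
      by (simp add: power2_eq_square algebra_simps)
    have "r = -1 \<or> r \<ge> 1 \<or> r \<le> -3" using \<open>odd r\<close> by presburger
    then consider "r = -1" | "r \<ge> 1" | "r \<le> -3" by blast
    hence "r = -1 \<or> (r + 1) * (g * (r - 1) + l) > 0"
    proof cases
      case 2
      hence "g * (r - 1) \<ge> 0" using g_pos by simp
      hence "g * (r - 1) + l > 0" using assms by linarith
      thus ?thesis using 2 by (intro disjI2 mult_pos_pos) auto
    next
      case 3
      hence "g * (r - 1) \<le> g * (-4)" using g_pos by (intro mult_left_mono) auto
      hence "g * (r - 1) + l < 0" using assms by linarith
      thus ?thesis using 3 by (intro disjI2 mult_neg_neg) auto
    qed auto
    thus "g - l \<le> g * r ^ 2 + l * r" "g * r ^ 2 + l * r = g - l \<longleftrightarrow> r = -1"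
        using e by auto
  qed
  have "{r. r \<in> {r. odd r} \<and> g * r ^ 2 + l * r = g - l} = {-1}" using 1 by auto
  hence "(\<Sum>r | r \<in> {r. odd r} \<and> g * r ^ 2 + l * r = g - l. chi r * exp (of_int r * z)) \<noteq> 0"
    by (simp only:) (simp add: chi_def)
  thus ?thesis unfolding theta_def fst_conv snd_conv
    by (intro msum_has_val adm_quadratic g_pos 1(1)) simp_all
qed

text \<open>At height 0 the terms r = 1 and r = -1 tie. Their coefficients add up to exp(-z) -
  exp(z), which vanishes only for u = 1.\<close>

lemma theta_has_val_0:
  assumes "exp (2 * z) \<noteq> 1"
  shows "has_val (T (z, 0)) g"
proof -
  have 1: "g \<le> g * r ^ 2" "g * r ^ 2 = g \<longleftrightarrow> r = 1 \<or> r = -1" if "odd r" for r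
  proof -
    have "r \<noteq> 0" using that by auto
    hence "1 \<le> r ^ 2" using zero_less_power2[of r] by linarith
    thus "g \<le> g * r ^ 2" using g_pos by simp
    show "g * r ^ 2 = g \<longleftrightarrow> r = 1 \<or> r = -1" using g_pos by (auto simp: power2_eq_1_iff)
  qed
  have "{r. r \<in> {r. odd r} \<and> g * r ^ 2 + 0 * r = g} = {1, -1}" using 1 by auto
  moreover have "exp (- z) - exp z \<noteq> 0"
  proof
    assume "exp (- z) - exp z = 0"
    hence "exp z * exp (- z) = exp z * exp z" by simp
    moreover have "exp z * exp (- z) = 1" by (simp flip: exp_add)
    moreover have "exp (2 * z) = exp z * exp z" by (simp add: exp_double power2_eq_square)
    ultimately show False using assms by simp
  qed
  ultimately have "(\<Sum>r | r \<in> {r. odd r} \<and> g * r ^ 2 + 0 * r = g. chi r * exp (of_int r * z)) \<noteq> 0"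
    by (simp only:) (simp add: chi_def)
  moreover have "g \<le> g * r ^ 2 + 0 * r" if "r \<in> {r. odd r}" for r
    using 1(1)[of r] that by simp
  ultimately show ?thesis unfolding theta_def fst_conv snd_conv
    by (intro msum_has_val adm_quadratic g_pos)
qed

text \<open>Quasi-periodicity under u -> qu: shifting the odd index by 2 completes the square in the
  exponent and flips \<open>chi\<close>.\<close>

lemma theta_period: "T (z, l + 4 * g) = fls_shift (4 * g + 2 * l) (fls_const (- exp (- 2 * z)) * T (z, l))"
proof -
  let ?a = "\<lambda>r. chi r * exp (of_int r * z)" and ?d = "\<lambda>r. g * r ^ 2 + l * r"
  have bij: "bij_betw (\<lambda>r. r + 2) {r::int. odd r} {r. odd r}"
    by (rule bij_betw_byWitness[where f' = "\<lambda>r. r - 2"]) auto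
  have chi: "chi (r + 2) = - chi r" if "odd r" for r
  proof -
    have "r mod 4 = 1 \<and> (r + 2) mod 4 = 3 \<or> r mod 4 = 3 \<and> (r + 2) mod 4 = 1" using that by presburger
    thus ?thesis by (auto simp: chi_def)
  qed
  have "fls_shift (4 * g + 2 * l) (fls_const (- exp (- 2 * z)) * T (z, l)) =
    msum {r. odd r} (\<lambda>r. - exp (- 2 * z) * ?a r) (\<lambda>r. ?d r + - (4 * g + 2 * l))"
    unfolding theta_def fst_conv snd_conv
    by (subst msum_shift[OF adm_quadratic[OF g_pos]]) (simp only: minus_minus)
  also have "\<dots> = msum {r. odd r} (\<lambda>r. - exp (- 2 * z) * ?a (r + 2)) (\<lambda>r. ?d (r + 2) + - (4 * g + 2 * l))"
    using msum_reindex[OF bij, of "\<lambda>r. - exp (- 2 * z) * ?a r" "\<lambda>r. ?d r + - (4 * g + 2 * l)"] by simp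
  also have "\<dots> = T (z, l + 4 * g)"
    unfolding theta_def
    by (intro msum_cong refl) (simp_all add: chi power2_eq_square algebra_simps flip: exp_add)
  finally show ?thesis by (rule sym)
qed

lemma theta_has_val_4g:
  assumes "exp (2 * z) \<noteq> 1"
  shows "has_val (T (z, 4 * g)) (- 3 * g)"
  using theta_has_val_0[OF assms] theta_period[of z 0]
  by (simp add: has_val_def fls_shift_eq0_iff)

lemma theta_minus: "T (- p) = - T p"
proof -
  have bij: "bij_betw uminus {r::int. odd r} {r. odd r}"
    by (rule bij_betw_byWitness[where f' = uminus]) auto
  have chi: "chi (- r) = - chi r" if "odd r" for r
  proof -
    have "r mod 4 = 1 \<and> (- r) mod 4 = 3 \<or> r mod 4 = 3 \<and> (- r) mod 4 = 1" using that by presburger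
    thus ?thesis by (auto simp: chi_def)
  qed
  let ?a = "\<lambda>r. chi r * exp (of_int r * fst (- p))" and ?d = "\<lambda>r. g * r ^ 2 + snd (- p) * r"
  have "T (- p) = msum {r. odd r} (\<lambda>r. ?a (- r)) (\<lambda>r. ?d (- r))"
    unfolding theta_def by (rule msum_reindex[OF bij, symmetric])
  also have "\<dots> = msum {r. odd r} (\<lambda>r. - (chi r * exp (of_int r * fst p))) (\<lambda>r. g * r ^ 2 + snd p * r)"
    by (intro msum_cong refl) (simp_all add: chi)
  also have "\<dots> = - T p" unfolding theta_def by (intro msum_uminus adm_quadratic g_pos)
  finally show ?thesis .
qed

text \<open>Says that u lies in q^Z, so that the point is the origin of the Tate curve.\<close>

definition is_zero :: "point \<Rightarrow> bool" where
  "is_zero p \<longleftrightarrow> 4 * g dvd snd p \<and> exp (2 * fst p) = 1"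

text \<open>At height 0 all odd powers of exp(z) agree when exp(2z) = 1, so theta is a multiple of
  its vanishing value at the origin. Quasi-periodicity reaches the other heights.\<close>

lemma theta_zero:
  assumes "is_zero p"
  shows "T p = 0"
proof -
  obtain z k where p: "p = (z, 4 * g * k)" and z: "exp (2 * z) = 1"
    using assms by (cases p) (auto simp: is_zero_def dvd_def)
  have "T (z, 0) = 0"
  proof -
    have exp: "exp (of_int r * z) = exp z" if "odd r" for r
    proof -
      obtain m where "r = 2 * m + 1" using \<open>odd r\<close> by (rule oddE)
      hence "exp (of_int r * z) = exp (2 * z * of_int m) * exp z"
        by (simp add: algebra_simps flip: exp_add)
      also have "exp (2 * z * of_int m) = exp (2 * z) powi m" by (simp add: exp_power_int mult_ac)
      finally show ?thesis using z by simp
    qed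
    have "T (z, 0) = msum {r. odd r} (\<lambda>r. exp z * (chi r * exp (of_int r * 0))) (\<lambda>r. (g * r ^ 2 + 0 * r) + 0)"
      unfolding theta_def by (intro msum_cong refl) (simp_all add: exp)
    also have "\<dots> = fls_shift (- 0) (fls_const (exp z) * T (0, 0))"
      unfolding theta_def using adm_quadratic[OF g_pos, of _ 0] by (subst msum_shift) simp_all
    finally show ?thesis using T_0 by (simp add: zero_prod_def)
  qed
  moreover have "T (z, l + 4 * g) = 0 \<longleftrightarrow> T (z, l) = 0" for l
    by (simp add: theta_period fls_shift_eq0_iff)
  ultimately have "T (z, 4 * g * k) = 0"
  proof (induction k rule: int_induct[where k = 0])
    case (step1 i)
    thus ?case by (simp add: distrib_left)
  next
    case (step2 i)
    have "T (z, 4 * g * (i - 1) + 4 * g) = 0" using step2 by (simp add: right_diff_distrib)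
    thus ?case using step2 by blast
  qed simp
  thus ?thesis by (simp add: p)
qed

text \<open>\<open>q\<^bsup>-t/2\<^esup>\<close> is the leading monomial of theta at a point of height \<open>t = l / 4g\<close> in \<open>[0, 1]\<close>.\<close>

lemma theta_has_val:
  assumes "\<not> is_zero (z, l)" "\<bar>l\<bar> \<le> 4 * g"
  shows "has_val (T (z, l)) (g - \<bar>l\<bar>)"
proof -
  have *: "has_val (T (z, l)) (g - l)" if "\<not> is_zero (z, l)" "0 \<le> l" "l \<le> 4 * g" for z l
  proof -
    have "l = 0 \<or> l = 4 * g \<or> 0 < l \<and> l < 4 * g" using that by auto
    then consider "l = 0" | "l = 4 * g" | "0 < l" "l < 4 * g" by blast
    thus ?thesis
      using that theta_has_val_0 theta_has_val_4g theta_has_val_inner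
      by cases (auto simp: is_zero_def)
  qed
  show ?thesis
  proof (cases "l \<ge> 0")
    case False
    have "T (z, l) = - T (- z, - l)" using theta_minus[of "(z, l)"] by simp
    thus ?thesis using *[of "- z" "- l"] assms False by (simp add: has_val_uminus is_zero_def exp_minus)
  qed (use * assms in auto)
qed

end

section \<open>The Tate curve\<close>

context theta_series
begin

lemma reg_b0: "reg b0 1"
proof -
  have 1: "{r. r \<in> {r. even r} \<and> 2 * g * r ^ 2 + 2 * snd (0::point) * r = 0} = {0}"
    using g_pos by auto
  have adm: "adm {r. even r} (\<lambda>r. 2 * g * r ^ 2 + 2 * snd (0::point) * r)"
    using g_pos by (intro adm_quadratic) simp
  have 2: "{r. r \<in> {r. even r} \<and> 2 * g * r ^ 2 + 2 * snd (0::point) * r = k} = {}" if "k < 0" for k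
    using g_pos that by (auto simp: mult_less_0_iff not_less)
  show ?thesis
    unfolding reg_def b0_def B0_def lat_def msum_nth[OF adm] 1
    by (intro conjI allI impI, simp only: 2 sum.empty) simp
qed

lemma has_val_b1: "has_val b1 (2 * g)"
proof -
  have 1: "1 \<le> r ^ 2" "r ^ 2 = 1 \<longleftrightarrow> r = 1 \<or> r = -1" if "odd r" for r :: int
  proof -
    have "r \<noteq> 0" using that by auto
    thus "1 \<le> r ^ 2" using zero_less_power2[of r] by linarith
    show "r ^ 2 = 1 \<longleftrightarrow> r = 1 \<or> r = -1" by (auto simp: power2_eq_1_iff)
  qed
  have 2: "{r. r \<in> {r. odd r} \<and> 2 * g * r ^ 2 + 2 * snd (0::point) * r = 2 * g} = {1, -1}"
    using 1(2) g_pos by auto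
  have 3: "(\<Sum>r | r \<in> {r. odd r} \<and> 2 * g * r ^ 2 + 2 * snd (0::point) * r = 2 * g. exp (of_int (2 * r) * fst (0::point))) \<noteq> 0"
    unfolding 2 by simp
  have 4: "2 * g \<le> 2 * g * r ^ 2 + 2 * snd (0::point) * r" if "r \<in> {r. odd r}" for r
    using 1(1)[of r] that g_pos by simp
  have adm: "adm {r. odd r} (\<lambda>r. 2 * g * r ^ 2 + 2 * snd (0::point) * r)"
    using g_pos by (intro adm_quadratic) simp
  show ?thesis unfolding b1_def B1_def lat_def by (rule msum_has_val[OF adm 4 3])
qed

text \<open>The Eisenstein series E_4 and E_6 of q in terms of theta constants. The factor
  \<open>mu\<close> scales x so that the coefficients become -3 j_0 and -2 j_0 with j_0 = E4^3/E6^2,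
  and \<open>s_series\<close> is 1/j = Delta/E4^3.\<close>

definition "E4 = b0 ^ 8 + 14 * b0 ^ 4 * b1 ^ 4 + b1 ^ 8"
definition "E6 = (b0 ^ 4 + b1 ^ 4) * (b0 ^ 8 - 34 * b0 ^ 4 * b1 ^ 4 + b1 ^ 8)"
definition "mu = - 3 * E4 / E6"
definition "s_series = b0 ^ 4 * b1 ^ 4 * disc ^ 4 / (16 * E4 ^ 3)"

lemma reg_b1: "reg b1 0"
  using has_val_reg[OF has_val_b1] g_pos by simp

lemma has_val_b0: "has_val b0 0"
  using reg_has_val[OF reg_b0] by simp

lemma has_val_disc: "has_val disc 0"
  using reg_has_val[OF reg_diff[OF reg_power[OF reg_b0, of 4] reg_power[OF reg_b1, of 4]]]
  by (simp add: disc_def)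

lemma has_val_E4: "has_val E4 0"
proof -
  have "reg E4 (1 ^ 8 + 14 * 1 ^ 4 * 0 ^ 4 + 0 ^ 8)"
    unfolding E4_def by (intro reg_add reg_mult reg_power reg_b0 reg_b1 reg_numeral)
  from reg_has_val[OF this] show ?thesis by simp
qed

lemma has_val_E6: "has_val E6 0"
proof -
  have "reg E6 ((1 ^ 4 + 0 ^ 4) * (1 ^ 8 - 34 * 1 ^ 4 * 0 ^ 4 + 0 ^ 8))"
    unfolding E6_def by (intro reg_add reg_diff reg_mult reg_power reg_b0 reg_b1 reg_numeral)
  from reg_has_val[OF this] show ?thesis by simp
qed

lemma has_val_mu: "has_val mu 0"
  using has_val_divide[OF has_val_mult[OF has_val_numeral[of "num.Bit1 num.One"] has_val_E4] has_val_E6]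
  by (simp add: mu_def has_val_uminus)

lemma has_val_s_series: "has_val s_series (8 * g)"
proof -
  have "has_val s_series (int 4 * 0 + int 4 * (2 * g) + int 4 * 0 - (0 + int 3 * 0))"
    unfolding s_series_def
    by (intro has_val_divide has_val_mult has_val_power has_val_b0 has_val_b1 has_val_disc has_val_E4 has_val_numeral)
  thus ?thesis by simp
qed

text \<open>In x = b0^4 and y = b1^4 the difference is 108 x y (x - y)^4; the quotient 108/1728 is
  the 1/16 in \<open>s_series\<close>.\<close>

lemma E4_E6: "E4 ^ 3 - E6 ^ 2 = 1728 * E4 ^ 3 * s_series"
proof -
  have *: "(x ^ 2 + 14 * x * y + y ^ 2) ^ 3 - ((x + y) * (x ^ 2 - 34 * x * y + y ^ 2)) ^ 2 =
      108 * x * y * (x - y) ^ 4" for x y :: "complex fls"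
    by (simp add: eval_nat_numeral algebra_simps)
  have "E4 ^ 3 - E6 ^ 2 = 108 * b0 ^ 4 * b1 ^ 4 * disc ^ 4"
    using *[of "b0 ^ 4" "b1 ^ 4"] unfolding E4_def E6_def disc_def by (simp flip: power_mult)
  thus ?thesis using has_val_nonzero[OF has_val_E4] by (simp add: s_series_def)
qed

lemma has_val_kappa_sq: "has_val (2 * mu * b0 * b1 * disc) (int 2 * g)"
proof -
  have "has_val (2 * mu * b0 * b1 * disc) (0 + 0 + 0 + 2 * g + 0)"
    by (intro has_val_mult has_val_numeral has_val_mu has_val_b0 has_val_b1 has_val_disc)
  thus ?thesis by simp
qed

text \<open>The quotient of theta by \<open>kappa\<close> plays the role of the Weierstrass sigma
  function: \<open>x_diff\<close> becomes x(p) - x(p') = -sigma(p+p') sigma(p-p') / (sigma(p)^2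
  sigma(p')^2). The square root exists because the valuation 2g is even.\<close>

definition "kappa = (SOME k. k ^ 2 = 2 * mu * b0 * b1 * disc)"

lemma kappa_sq: "kappa ^ 2 = 2 * mu * b0 * b1 * disc"
  unfolding kappa_def using has_val_root[OF has_val_kappa_sq] by (metis (mono_tags, lifting) pos2 someI_ex)

lemma kappa_nonzero: "kappa \<noteq> 0"
  using has_val_nonzero[OF has_val_kappa_sq] kappa_sq by (metis zero_power2)

text \<open>Without the subtracted constant the 2-torsion point u = -1 would have coordinate 0; the
  constant makes the three 2-torsion coordinates add up to 0.\<close>

definition x_pt :: "point \<Rightarrow> complex fls" where
  "x_pt p = mu * disc * (b0 * B1 p + b1 * B0 p) / T p ^ 2 - 2 * mu * (b0 ^ 4 + b1 ^ 4) / 3"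

lemma x_diff:
  assumes "T p \<noteq> 0" "T p' \<noteq> 0"
  shows "x_pt p - x_pt p' = - (kappa ^ 2) * T (p + p') * T (p - p') / (T p ^ 2 * T p' ^ 2)"
proof -
  have "(b0 * B1 p + b1 * B0 p) * T p' ^ 2 - (b0 * B1 p' + b1 * B0 p') * T p ^ 2 =
      - (2 * b0 * b1) * (B1 p * B0 p' - B0 p * B1 p')"
    unfolding T_sq by (simp add: algebra_simps)
  hence "(b0 * B1 p + b1 * B0 p) / T p ^ 2 - (b0 * B1 p' + b1 * B0 p') / T p' ^ 2 =
      - (2 * b0 * b1) * (B1 p * B0 p' - B0 p * B1 p') / (T p ^ 2 * T p' ^ 2)"
    using assms by (simp add: diff_frac_eq)
  hence "mu * disc * ((b0 * B1 p + b1 * B0 p) / T p ^ 2 - (b0 * B1 p' + b1 * B0 p') / T p' ^ 2) =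
      mu * disc * (- (2 * b0 * b1) * (B1 p * B0 p' - B0 p * B1 p') / (T p ^ 2 * T p' ^ 2))"
    by simp
  thus ?thesis
    by (simp add: x_pt_def kappa_sq mult.assoc T_add_minus right_diff_distrib)
qed

text \<open>For heights at most 1/2 sums and differences stay in the range of
  \<open>theta_has_val\<close>. The minimum comes from |l + l'| + |l - l'| = 2 max l l'.\<close>

lemma x_diff_has_val:
  assumes "0 \<le> l" "l \<le> 2 * g" "0 \<le> l'" "l' \<le> 2 * g"
    and "\<not> is_zero (z, l)" "\<not> is_zero (z', l')" "\<not> is_zero (z + z', l + l')" "\<not> is_zero (z - z', l - l')"
  shows "has_val (x_pt (z, l) - x_pt (z', l')) (2 * min l l')"
proof -
  have v: "has_val (T (z, l)) (g - \<bar>l\<bar>)" "has_val (T (z', l')) (g - \<bar>l'\<bar>)"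
    "has_val (T (z + z', l + l')) (g - \<bar>l + l'\<bar>)" "has_val (T (z - z', l - l')) (g - \<bar>l - l'\<bar>)"
    by (rule theta_has_val; use assms in simp)+
  have "has_val (- (kappa ^ 2) * T ((z, l) + (z', l')) * T ((z, l) - (z', l')) / (T (z, l) ^ 2 * T (z', l') ^ 2))
    (int 2 * g + (g - \<bar>l + l'\<bar>) + (g - \<bar>l - l'\<bar>) - (int 2 * (g - \<bar>l\<bar>) + int 2 * (g - \<bar>l'\<bar>)))"
    unfolding kappa_sq by (intro has_val_divide has_val_mult has_val_power has_val_uminus[THEN iffD2] has_val_kappa_sq)
      (use v in simp_all)
  moreover have "int 2 * g + (g - \<bar>l + l'\<bar>) + (g - \<bar>l - l'\<bar>) - (int 2 * (g - \<bar>l\<bar>) + int 2 * (g - \<bar>l'\<bar>)) = 2 * min l l'"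
    using assms(1-4) by (cases "l \<le> l'") simp_all
  ultimately show ?thesis
    using v by (subst x_diff) (auto simp: has_val_def)
qed

text \<open>The two-torsion point \<open>q\<^bsup>1/2\<^esup>\<close>, one of the two points reducing to the node.\<close>

lemma lat_half_period:
  "B0 (0, 2 * g) = fls_shift (2 * g) b1" "B1 (0, 2 * g) = fls_shift (2 * g) b0"
proof -
  have bij: "bij_betw (\<lambda>r. r + 1) {r::int. even r} {r. odd r}" "bij_betw (\<lambda>r. r + 1) {r::int. odd r} {r. even r}"
    by (rule bij_betw_byWitness[where f' = "\<lambda>r. r - 1"]; auto)+
  have *: "lat A (2 * g) 2 (0, 2 * g) = fls_shift (2 * g) (lat A' (2 * g) 2 0)"
    if bij: "bij_betw (\<lambda>r. r + 1) A A'" for A A'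
  proof -
    let ?d = "\<lambda>r. 2 * g * r ^ 2 + 2 * snd (0::point) * r"
    have adm: "adm A' ?d" using g_pos by (intro adm_quadratic) simp
    have "fls_shift (2 * g) (lat A' (2 * g) 2 0) = msum A' (\<lambda>r. 1 * exp (of_int (2 * r) * fst (0::point))) (\<lambda>r. ?d r + - (2 * g))"
      unfolding lat_def msum_shift[OF adm] by simp
    also have "\<dots> = msum A (\<lambda>r. 1 * exp (of_int (2 * (r + 1)) * fst (0::point))) (\<lambda>r. ?d (r + 1) + - (2 * g))"
      using msum_reindex[OF bij, of "\<lambda>r. 1 * exp (of_int (2 * r) * fst (0::point))" "\<lambda>r. ?d r + - (2 * g)"] by simp
    also have "\<dots> = lat A (2 * g) 2 (0, 2 * g)"
      unfolding lat_def by (intro msum_cong refl) (simp_all add: power2_eq_square algebra_simps)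
    finally show ?thesis by simp
  qed
  show "B0 (0, 2 * g) = fls_shift (2 * g) b1" "B1 (0, 2 * g) = fls_shift (2 * g) b0"
    using *[OF bij(1)] *[OF bij(2)] by (simp_all add: B0_def B1_def b0_def b1_def)
qed

lemma x_half_period: "x_pt (0, 2 * g) = mu * (b0 ^ 4 + 6 * b0 ^ 2 * b1 ^ 2 + b1 ^ 4) / 3"
proof -
  let ?m = "fls_X_intpow (- 2 * g) :: complex fls"
  have m: "fls_shift (2 * g) f = ?m * f" for f
    by (simp add: fls_shifted_times_simps)
  have m0: "?m \<noteq> 0" by (simp add: fls_shift_eq0_iff)
  have d: "b0 ^ 2 - b1 ^ 2 \<noteq> 0"
  proof
    assume "b0 ^ 2 - b1 ^ 2 = 0"
    hence "disc = 0" by (simp add: disc_def power4_eq_xxxx power2_eq_square algebra_simps)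
    thus False using has_val_disc by (simp add: has_val_def)
  qed
  have disc: "disc = (b0 ^ 2 - b1 ^ 2) * (b0 ^ 2 + b1 ^ 2)"
    by (simp add: disc_def power4_eq_xxxx power2_eq_square algebra_simps)
  have "x_pt (0, 2 * g) = mu * disc * (?m * (b0 ^ 2 + b1 ^ 2)) / (?m * (b0 ^ 2 - b1 ^ 2)) - 2 * mu * (b0 ^ 4 + b1 ^ 4) / 3"
    unfolding x_pt_def T_sq lat_half_period m by (simp add: power2_eq_square algebra_simps del: fls_X_intpow_times_conv_shift)
  also have "mu * disc * (?m * (b0 ^ 2 + b1 ^ 2)) / (?m * (b0 ^ 2 - b1 ^ 2)) = mu * (b0 ^ 2 + b1 ^ 2) ^ 2"
    using m0 d unfolding disc by (simp add: field_simps power2_eq_square)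
  finally show ?thesis by (simp add: field_simps power2_eq_square power4_eq_xxxx)
qed

text \<open>With \<open>mu\<close> inserted, the numerator E6 - E4 P is b1^2 times a unit, and b1^2
  has valuation 4g, which is 1/2 in units of q.\<close>

lemma x_half_period_plus_1: "x_pt (0, 2 * g) + 1 \<noteq> 0" "has_val (x_pt (0, 2 * g) + 1) (4 * g)"
proof -
  \<comment> \<open>To be used with x = b0^4, y = b1^4 and z = b0^2 b1^2, whence the side
    condition.\<close>
  have *: "(x + y) * (x ^ 2 - 34 * x * y + y ^ 2) - (x ^ 2 + 14 * x * y + y ^ 2) * (x + y + 6 * z) =
      - 6 * z * (x + y + 6 * z) * (x + y + 2 * z)" if "z ^ 2 = x * y" for x y z :: "complex fls"
  proof -
    have "(x + y) * (x ^ 2 - 34 * z ^ 2 + y ^ 2) - (x ^ 2 + 14 * z ^ 2 + y ^ 2) * (x + y + 6 * z) + 6 * z * (x + y + 6 * z) * (x + y + 2 * z)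
      = (x * y - z ^ 2) * (12 * z)"
      by (simp add: eval_nat_numeral algebra_simps)
    thus ?thesis using that by (simp add: mult.assoc eq_neg_iff_add_eq_0)
  qed
  define P where "P = b0 ^ 4 + 6 * b0 ^ 2 * b1 ^ 2 + b1 ^ 4"
  define R where "R = b0 ^ 4 + 2 * (b0 ^ 2 * b1 ^ 2) + b1 ^ 4"
  have E: "E6 - E4 * P = - 6 * (b0 ^ 2 * b1 ^ 2) * P * R"
    using *[of "b0 ^ 2 * b1 ^ 2" "b0 ^ 4" "b1 ^ 4"]
    unfolding E4_def E6_def P_def R_def by (simp add: power_mult_distrib mult_ac add_ac flip: power_mult)
  have "x_pt (0, 2 * g) + 1 = (E6 - E4 * P) / E6"
    using has_val_nonzero[OF has_val_E6] unfolding x_half_period mu_def P_def by (simp add: field_simps)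
  hence eq: "x_pt (0, 2 * g) + 1 = - (6 * (b0 ^ 2 * b1 ^ 2) * P * R / E6)"
    unfolding E by simp
  have "reg P (1 ^ 4 + 6 * 1 ^ 2 * 0 ^ 2 + 0 ^ 4)"
    unfolding P_def by (intro reg_add reg_mult reg_power reg_b0 reg_b1 reg_numeral)
  hence P: "has_val P 0" using reg_has_val by fastforce
  have "reg R (1 ^ 4 + 2 * (1 ^ 2 * 0 ^ 2) + 0 ^ 4)"
    unfolding R_def by (intro reg_add reg_mult reg_power reg_b0 reg_b1 reg_numeral)
  hence R: "has_val R 0" using reg_has_val by fastforce
  have "has_val (6 * (b0 ^ 2 * b1 ^ 2) * P * R / E6) (0 + (int 2 * 0 + int 2 * (2 * g)) + 0 + 0 - 0)"
    by (intro has_val_divide has_val_mult has_val_power has_val_b0 has_val_b1 P R has_val_E6 has_val_numeral)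
  thus "has_val (x_pt (0, 2 * g) + 1) (4 * g)" unfolding eq has_val_uminus by simp
  thus "x_pt (0, 2 * g) + 1 \<noteq> 0" by (rule has_val_nonzero)
qed

end

section \<open>The division polynomial recursion and its theta solution\<close>

section \<open>Division polynomials without the factor \<open>y\<close>\<close>

text \<open>Q_n with its factor y removed for even n; \<open>w\<close>, \<open>c\<close>,
  \<open>d\<close> stand for y^2, Q_3 and Q_4 / (4y). One half is passed as the parameter
  \<open>h\<close> because the recursion has to make sense in polynomial rings, where ring
  homomorphisms then specialize it.\<close>

function dseq :: "'a::comm_ring_1 \<Rightarrow> 'a \<Rightarrow> 'a \<Rightarrow> 'a \<Rightarrow> nat \<Rightarrow> 'a" where
  "dseq h w c d n =
    (if n = 0 then 0 else if n = 1 then 1 else if n = 2 then 2 else if n = 3 then c else if n = 4 then 4 * d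
     else let m = n div 2 in
       if odd n then (if even m then w ^ 2 else 1) * (dseq h w c d (m + 2) * dseq h w c d m ^ 3) -
         (if even m then 1 else w ^ 2) * (dseq h w c d (m - 1) * dseq h w c d (m + 1) ^ 3)
       else h * (dseq h w c d (m + 2) * dseq h w c d (m - 1) ^ 2 - dseq h w c d (m - 2) * dseq h w c d (m + 1) ^ 2) *
         dseq h w c d m)"
  by pat_completeness auto
termination
  by (relation "measure (\<lambda>(h, w, c, d, n). n)") (auto elim!: oddE evenE)

declare dseq.simps [simp del]

lemma dseq_initial [simp]:
  "dseq h w c d 0 = 0" "dseq h w c d 1 = 1" "dseq h w c d (Suc 0) = 1"
  "dseq h w c d 2 = 2" "dseq h w c d 3 = c" "dseq h w c d 4 = 4 * d"
  by (subst dseq.simps, simp)+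

lemma dseq_odd:
  assumes "m \<ge> 2"
  shows "dseq h w c d (2 * m + 1) =
    (if even m then w ^ 2 else 1) * (dseq h w c d (m + 2) * dseq h w c d m ^ 3) -
    (if even m then 1 else w ^ 2) * (dseq h w c d (m - 1) * dseq h w c d (m + 1) ^ 3)"
  using assms by (subst dseq.simps) (simp add: Let_def)

lemma dseq_even:
  assumes "m \<ge> 3"
  shows "dseq h w c d (2 * m) =
    h * (dseq h w c d (m + 2) * dseq h w c d (m - 1) ^ 2 - dseq h w c d (m - 2) * dseq h w c d (m + 1) ^ 2) *
    dseq h w c d m"
  using assms by (subst dseq.simps) (simp add: Let_def)

lemma dseq_induct [case_names 0 1 2 3 4 odd even]:
  fixes P :: "nat \<Rightarrow> bool"
  assumes "P 0" "P 1" "P 2" "P 3" "P 4"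
    and "\<And>m. m \<ge> 2 \<Longrightarrow> (\<And>k. k < 2 * m + 1 \<Longrightarrow> P k) \<Longrightarrow> P (2 * m + 1)"
    and "\<And>m. m \<ge> 3 \<Longrightarrow> (\<And>k. k < 2 * m \<Longrightarrow> P k) \<Longrightarrow> P (2 * m)"
  shows "P n"
proof (induction n rule: less_induct)
  case (less n)
  consider "n = 0" | "n = 1" | "n = 2" | "n = 3" | "n = 4" | m where "n = 2 * m + 1" "m \<ge> 2" | m where "n = 2 * m" "m \<ge> 3"
  proof (cases "n \<le> 4")
    case True
    hence "n = 0 \<or> n = 1 \<or> n = 2 \<or> n = 3 \<or> n = 4" by auto
    thus ?thesis using that(1-5) by blast
  next
    case False
    show ?thesis
    proof (cases "even n")
      case True
      thus ?thesis using False that(7)[of "n div 2"] by auto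
    next
      case odd: False
      thus ?thesis using False that(6)[of "n div 2"] by auto
    qed
  qed
  thus ?case
  proof cases
    case (6 m)
    have "P (2 * m + 1)" by (rule assms(6)) (use 6 less in auto)
    thus ?thesis by (simp only: 6)
  next
    case (7 m)
    have "P (2 * m)" by (rule assms(7)) (use 7 less in auto)
    thus ?thesis by (simp only: 7)
  qed (use assms(1-5) in simp_all)
qed

lemma dseq_hom:
  fixes \<phi> :: "'a::comm_ring_1 \<Rightarrow> 'b::comm_ring_1"
  assumes [simp]: "\<phi> 0 = 0" "\<phi> 1 = 1" "\<And>x y. \<phi> (x + y) = \<phi> x + \<phi> y" "\<And>x y. \<phi> (x - y) = \<phi> x - \<phi> y"
    "\<And>x y. \<phi> (x * y) = \<phi> x * \<phi> y"
  shows "\<phi> (dseq h w c d n) = dseq (\<phi> h) (\<phi> w) (\<phi> c) (\<phi> d) n"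
proof -
  have p: "\<phi> (x ^ k) = \<phi> x ^ k" for x k by (induction k) auto
  have 2: "\<phi> 2 = 2" using assms(3)[of 1 1] by simp
  have 4: "\<phi> 4 = 4" using assms(3)[of 2 2] by (simp add: 2)
  show ?thesis
  proof (induction n rule: dseq_induct)
    case (odd m)
    have "\<phi> (dseq h w c d k) = dseq (\<phi> h) (\<phi> w) (\<phi> c) (\<phi> d) k" if "k \<in> {m + 2, m, m - 1, m + 1}" for k
      by (rule odd(2)) (use odd(1) that in auto)
    thus ?case unfolding dseq_odd[OF odd(1)] by (simp add: p del: add_2_eq_Suc' One_nat_def Nat.add_0_right add_Suc_right)
  next
    case (even m)
    have "\<phi> (dseq h w c d k) = dseq (\<phi> h) (\<phi> w) (\<phi> c) (\<phi> d) k" if "k \<in> {m + 2, m, m - 1, m - 2, m + 1}" for k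
      by (rule even(2)) (use even(1) that in auto)
    thus ?case unfolding dseq_even[OF even(1)] by (simp add: p del: add_2_eq_Suc' One_nat_def Nat.add_0_right add_Suc_right)
  qed (simp_all add: 2 4 del: One_nat_def)
qed

text \<open>In the odd recursion one of the two products carries y^4 = w^2 and the other no y. In
  the even one, after division by 2y, a single y remains.\<close>

lemma dseq_unique:
  fixes W :: "nat \<Rightarrow> 'a::field" and y :: 'a
  assumes 1: "W 1 = 1" "W 2 = 2 * y" "W 3 = c" "W 4 = 4 * y * d" and y: "2 * y \<noteq> 0" "y ^ 2 = w"
    and odd: "\<And>m. m \<ge> 2 \<Longrightarrow> W (2 * m + 1) = W (m + 2) * W m ^ 3 - W (m - 1) * W (m + 1) ^ 3"
    and even: "\<And>m. m \<ge> 3 \<Longrightarrow> W (2 * m) = (W (m + 2) * W (m - 1) ^ 2 - W (m - 2) * W (m + 1) ^ 2) * W m / W 2"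
  shows "n > 0 \<Longrightarrow> W n = dseq (1 / 2) w c d n * (if even n then y else 1)"
proof (induction n rule: dseq_induct)
  case (odd m)
  have *: "W (m + 2) = dseq (1 / 2) w c d (m + 2) * (if even m then y else 1)"
    "W m = dseq (1 / 2) w c d m * (if even m then y else 1)"
    "W (m + 1) = dseq (1 / 2) w c d (m + 1) * (if even m then 1 else y)"
    "W (m - 1) = dseq (1 / 2) w c d (m - 1) * (if even m then 1 else y)"
    using odd by auto
  have h: "(f * y) * (g * y) ^ 3 = (y ^ 2) ^ 2 * (f * g ^ 3)" for f g
    by (simp add: eval_nat_numeral)
  have "odd (2 * m + 1)" by simp
  thus ?case
    unfolding assms(7)[OF odd(1)] dseq_odd[OF odd(1)] * y(2)[symmetric]
    by (cases "even m") (simp_all only: if_True if_False h mult_1_right mult_1_left)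
next
  case (even m)
  have *: "W (m + 2) = dseq (1 / 2) w c d (m + 2) * (if even m then y else 1)"
    "W m = dseq (1 / 2) w c d m * (if even m then y else 1)"
    "W (m + 1) = dseq (1 / 2) w c d (m + 1) * (if even m then 1 else y)"
    "W (m - 1) = dseq (1 / 2) w c d (m - 1) * (if even m then 1 else y)"
    "W (m - 2) = dseq (1 / 2) w c d (m - 2) * (if even m then y else 1)"
    using even by auto
  have h: "(f1 * y * g1 ^ 2 - f2 * y * g2 ^ 2) * (f * y) / (2 * y) = 1 / 2 * (f1 * g1 ^ 2 - f2 * g2 ^ 2) * f * y"
    "(f1 * (g1 * y) ^ 2 - f2 * (g2 * y) ^ 2) * f / (2 * y) = 1 / 2 * (f1 * g1 ^ 2 - f2 * g2 ^ 2) * f * y" for f1 f2 g1 g2 f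
  proof -
    have half: "1 / 2 * A * f * y * (2 * y) = A * f * y * y" for A
    proof -
      have "1 / 2 * A * f * y * (2 * y) = (1 / 2 * 2) * (A * f * y * y)" by (simp only: mult_ac)
      also have "1 / 2 * 2 = (1 :: 'a)" using y(1) by auto
      finally show ?thesis by simp
    qed
    show "(f1 * y * g1 ^ 2 - f2 * y * g2 ^ 2) * (f * y) / (2 * y) = 1 / 2 * (f1 * g1 ^ 2 - f2 * g2 ^ 2) * f * y"
      "(f1 * (g1 * y) ^ 2 - f2 * (g2 * y) ^ 2) * f / (2 * y) = 1 / 2 * (f1 * g1 ^ 2 - f2 * g2 ^ 2) * f * y"
      unfolding nonzero_divide_eq_eq[OF y(1)] half by (simp_all add: power2_eq_square algebra_simps)
  qed
  have "even (2 * m)" by simp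
  thus ?case
    unfolding assms(8)[OF even(1)] dseq_even[OF even(1)] * 1(2)
    by (cases "even m") (simp_all only: if_True if_False h mult_1_right)
qed (use 1 in \<open>simp_all add: mult_ac\<close>)

text \<open>The recorded coefficient may be 0: unlike the exact degree, this notion survives
  subtraction, where leading terms could cancel.\<close>

definition deg_lc :: "'a::comm_ring_1 poly \<Rightarrow> nat \<Rightarrow> 'a \<Rightarrow> bool" where
  "deg_lc p n c \<longleftrightarrow> degree p \<le> n \<and> coeff p n = c"

lemma deg_lc_mult:
  assumes "deg_lc p m c" "deg_lc q n d"
  shows "deg_lc (p * q) (m + n) (c * d)"
proof -
  have deg: "degree p \<le> m" "degree q \<le> n" and cf: "coeff p m = c" "coeff q n = d"
    using assms by (auto simp: deg_lc_def)
  have "coeff (p * q) (m + n) = (\<Sum>i\<le>m + n. coeff p i * coeff q (m + n - i))" by (rule coeff_mult)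
  also have "\<dots> = (\<Sum>i\<in>{m}. coeff p i * coeff q (m + n - i))"
  proof (rule sum.mono_neutral_right)
    show "\<forall>i\<in>{..m + n} - {m}. coeff p i * coeff q (m + n - i) = 0"
    proof
      fix i assume i: "i \<in> {..m + n} - {m}"
      show "coeff p i * coeff q (m + n - i) = 0"
      proof (cases "i < m")
        case True
        hence "degree q < m + n - i" using deg by auto
        thus ?thesis by (simp add: coeff_eq_0)
      next
        case False
        hence "degree p < i" using i deg by auto
        thus ?thesis by (simp add: coeff_eq_0)
      qed
    qed
  qed auto
  finally have "coeff (p * q) (m + n) = c * d" using cf by simp
  moreover have "degree (p * q) \<le> m + n" using degree_mult_le[of p q] deg by linarith
  ultimately show ?thesis by (simp add: deg_lc_def)
qed

lemma deg_lc_diff: "deg_lc p n c \<Longrightarrow> deg_lc q n d \<Longrightarrow> deg_lc (p - q) n (c - d)"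
  by (auto simp: deg_lc_def intro: degree_diff_le)

lemma deg_lc_1: "deg_lc 1 0 1"
  by (simp add: deg_lc_def)

lemma deg_lc_power: "deg_lc p n c \<Longrightarrow> deg_lc (p ^ k) (k * n) (c ^ k)"
  by (induction k) (auto intro: deg_lc_mult deg_lc_1)

text \<open>(n^2 - 1)/2 for odd n and (n^2 - 4)/2 for even n > 0, which is half the number of
  n-torsion points that are not 2-torsion.\<close>

definition ddeg :: "nat \<Rightarrow> nat" where
  "ddeg n = (if even n then 2 * (n div 2) ^ 2 - 2 else 2 * (n div 2) ^ 2 + 2 * (n div 2))"

lemma dseq_deg_lc:
  fixes w c d :: "'a::field_char_0 poly"
  assumes w: "deg_lc w 3 1" and c: "deg_lc c 4 3" and d: "deg_lc d 6 1"
  shows "n > 0 \<Longrightarrow> deg_lc (dseq [:1 / 2:] w c d n) (ddeg n) (of_nat n)"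
proof (induction n rule: dseq_induct)
  case 1
  have "ddeg 1 = 0" by (simp add: ddeg_def)
  thus ?case by (simp only: dseq_initial of_nat_1 deg_lc_1)
next
  case 2
  show ?case by (simp add: ddeg_def deg_lc_def numeral_poly)
next
  case 3
  show ?case using c by (simp add: ddeg_def)
next
  case 4
  have "deg_lc (4 :: 'a poly) 0 4" by (simp add: deg_lc_def numeral_poly)
  from deg_lc_mult[OF this d] show ?case by (simp add: ddeg_def)
next
  case (odd m)
  note IH = odd(2)
  let ?f = "dseq [:1 / 2:] w c d"
  have a: "deg_lc (?f (m + 2) * ?f m ^ 3) (ddeg (m + 2) + 3 * ddeg m) (of_nat (m + 2) * of_nat m ^ 3)"
    using odd(1) by (intro deg_lc_mult deg_lc_power IH) auto
  have b: "deg_lc (?f (m - 1) * ?f (m + 1) ^ 3) (ddeg (m - 1) + 3 * ddeg (m + 1)) (of_nat (m - 1) * of_nat (m + 1) ^ 3)"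
    using odd(1) by (intro deg_lc_mult deg_lc_power IH) auto
  have w2: "deg_lc (w ^ 2) 6 1" using deg_lc_power[OF w, of 2] by simp
  \<comment> \<open>The sequence n satisfies the recursion itself, hence the leading coefficient is
    n.\<close>
  have lc: "of_nat (m + 2) * of_nat m ^ 3 - of_nat (m - 1) * of_nat (m + 1) ^ 3 = (of_nat (2 * m + 1) :: 'a)"
    using odd(1) by (simp add: of_nat_diff eval_nat_numeral algebra_simps)
  show ?case
  proof (cases "even m")
    case True
    hence "m = 2 * Suc (m div 2 - 1)" using odd(1) by (auto elim!: evenE)
    then obtain i where i: "m = 2 * Suc i" by blast
    \<comment> \<open>The two products have equal degree only after the factor w^2, of degree 6, is
      added to one of them.\<close>
    have "ddeg (m + 2) + 3 * ddeg m + 6 = ddeg (2 * m + 1)" "ddeg (m - 1) + 3 * ddeg (m + 1) = ddeg (2 * m + 1)"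
      by (simp_all add: i ddeg_def power2_eq_square algebra_simps)
    hence "deg_lc (w ^ 2 * (?f (m + 2) * ?f m ^ 3) - ?f (m - 1) * ?f (m + 1) ^ 3) (ddeg (2 * m + 1))
       (of_nat (m + 2) * of_nat m ^ 3 - of_nat (m - 1) * of_nat (m + 1) ^ 3)"
      using deg_lc_mult[OF w2 a] b by (intro deg_lc_diff) (simp_all add: add.commute)
    thus ?thesis unfolding dseq_odd[OF odd(1)] lc using True by simp
  next
    case False
    hence "m = 2 * Suc (m div 2 - 1) + 1" using odd(1) by (auto elim!: oddE)
    then obtain i where i: "m = 2 * Suc i + 1" by blast
    have "ddeg (m + 2) + 3 * ddeg m = ddeg (2 * m + 1)" "ddeg (m - 1) + 3 * ddeg (m + 1) + 6 = ddeg (2 * m + 1)"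
      by (simp_all add: i ddeg_def power2_eq_square algebra_simps)
    hence "deg_lc (?f (m + 2) * ?f m ^ 3 - w ^ 2 * (?f (m - 1) * ?f (m + 1) ^ 3)) (ddeg (2 * m + 1))
       (of_nat (m + 2) * of_nat m ^ 3 - of_nat (m - 1) * of_nat (m + 1) ^ 3)"
      using deg_lc_mult[OF w2 b] a by (intro deg_lc_diff) (simp_all add: add.commute)
    thus ?thesis unfolding dseq_odd[OF odd(1)] lc using False by simp
  qed
next
  case (even m)
  note IH = even(2)
  let ?f = "dseq [:1 / 2:] w c d"
  have a: "deg_lc (?f (m + 2) * ?f (m - 1) ^ 2) (ddeg (m + 2) + 2 * ddeg (m - 1)) (of_nat (m + 2) * of_nat (m - 1) ^ 2)"
    using even(1) by (intro deg_lc_mult deg_lc_power IH) auto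
  have b: "deg_lc (?f (m - 2) * ?f (m + 1) ^ 2) (ddeg (m - 2) + 2 * ddeg (m + 1)) (of_nat (m - 2) * of_nat (m + 1) ^ 2)"
    using even(1) by (intro deg_lc_mult deg_lc_power IH) auto
  have m: "deg_lc (?f m) (ddeg m) (of_nat m)" using even(1) by (intro IH) auto
  have h: "deg_lc [:1 / 2 :: 'a:] 0 (1 / 2)" by (simp add: deg_lc_def)
  have deg: "ddeg (m - 2) + 2 * ddeg (m + 1) = ddeg (m + 2) + 2 * ddeg (m - 1)"
    "0 + (ddeg (m + 2) + 2 * ddeg (m - 1)) + ddeg m = ddeg (2 * m)"
  proof -
    obtain j where j: "m = j + 3" using even(1) by (metis le_add_diff_inverse2)
    have "m = 2 * (j div 2) + 3 \<or> m = 2 * (j div 2) + 4" unfolding j by presburger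
    then obtain i where "m = 2 * i + 3 \<or> m = 2 * i + 4" by blast
    thus "ddeg (m - 2) + 2 * ddeg (m + 1) = ddeg (m + 2) + 2 * ddeg (m - 1)"
      "0 + (ddeg (m + 2) + 2 * ddeg (m - 1)) + ddeg m = ddeg (2 * m)"
      by (auto simp: ddeg_def power2_eq_square algebra_simps)
  qed
  have lc: "1 / 2 * (of_nat (m + 2) * of_nat (m - 1) ^ 2 - of_nat (m - 2) * of_nat (m + 1) ^ 2) * of_nat m = (of_nat (2 * m) :: 'a)"
    using even(1) by (simp add: of_nat_diff power2_eq_square field_simps)
  have "deg_lc (dseq [:1 / 2:] w c d (2 * m)) (0 + (ddeg (m + 2) + 2 * ddeg (m - 1)) + ddeg m)
    (1 / 2 * (of_nat (m + 2) * of_nat (m - 1) ^ 2 - of_nat (m - 2) * of_nat (m + 1) ^ 2) * of_nat m)"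
    unfolding dseq_even[OF even(1)] by (intro deg_lc_mult deg_lc_diff h a m b[unfolded deg])
  thus ?case unfolding lc deg(2) .
qed simp

section \<open>Theta functions and division polynomials\<close>

context theta_series
begin

text \<open>With sigma = T / kappa this is sigma(np) / sigma(p)^(n^2), the classical form of the
  n-th division polynomial.\<close>

definition W :: "int \<Rightarrow> point \<Rightarrow> complex fls" where
  "W n p = (kappa / T p) powi (n ^ 2) * T (smul n p) / kappa"

definition "a_ser = - 3 * E4 ^ 3 / E6 ^ 2"
definition "b_ser = - 2 * E4 ^ 3 / E6 ^ 2"

text \<open>\<open>T_pluecker\<close> is homogeneous for the quadratic weight n^2: both products on
  the right carry the same power of kappa / T, and the factor T p ^ 2 on its left accounts for the
  difference of 2.\<close>

lemma W_eds:
  assumes "T p \<noteq> 0"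
  shows "W (m + n) p * W (m - n) p = W (m + 1) p * W (m - 1) p * W n p ^ 2 - W (n + 1) p * W (n - 1) p * W m p ^ 2"
proof -
  define c where "c = kappa / T p"
  have c: "c \<noteq> 0" using assms kappa_nonzero by (simp add: c_def)
  have pw: "c powi i * c powi j = c powi (i + j)" for i j using c by (simp add: power_int_add)
  have 1: "W i p * W j p = c powi (i ^ 2 + j ^ 2) * (T (smul i p) * T (smul j p)) / kappa ^ 2" for i j
    by (simp add: W_def power2_eq_square flip: c_def pw)
  have "W (m + n) p * W (m - n) p = c powi (2 * m ^ 2 + 2 * n ^ 2) * (T (smul (m + n) p) * T (smul (m - n) p)) / kappa ^ 2"
    unfolding 1 by (rule arg_cong[of _ _ "\<lambda>e. c powi e * _ / _"]) (simp add: power2_eq_square algebra_simps)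
  also have "T (smul (m + n) p) * T (smul (m - n) p) =
      (T (smul (m + 1) p) * T (smul (m - 1) p) * T (smul n p) ^ 2 -
       T (smul (n + 1) p) * T (smul (n - 1) p) * T (smul m p) ^ 2) / T p ^ 2"
    using T_pluecker[of m n p] assms by (simp add: nonzero_eq_divide_eq)
  also have "c powi (2 * m ^ 2 + 2 * n ^ 2) * \<dots> / kappa ^ 2 =
      c powi (2 * m ^ 2 + 2 * n ^ 2) * c powi 2 *
      (T (smul (m + 1) p) * T (smul (m - 1) p) * T (smul n p) ^ 2 -
       T (smul (n + 1) p) * T (smul (n - 1) p) * T (smul m p) ^ 2) / kappa ^ 4"
    using assms kappa_nonzero by (simp add: c_def field_simps power2_eq_square power4_eq_xxxx)
  also have "\<dots> = W (m + 1) p * W (m - 1) p * W n p ^ 2 - W (n + 1) p * W (n - 1) p * W m p ^ 2"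
  proof -
    have e: "(m + 1) ^ 2 + (m - 1) ^ 2 + (n ^ 2 + n ^ 2) = 2 * m ^ 2 + 2 * n ^ 2 + 2"
      "(n + 1) ^ 2 + (n - 1) ^ 2 + (m ^ 2 + m ^ 2) = 2 * m ^ 2 + 2 * n ^ 2 + 2"
      by (simp_all add: power2_eq_square algebra_simps)
    have "W (m + 1) p * W (m - 1) p * W n p ^ 2 =
       c powi (2 * m ^ 2 + 2 * n ^ 2 + 2) * (T (smul (m + 1) p) * T (smul (m - 1) p) * T (smul n p) ^ 2) / kappa ^ 4"
      unfolding power2_eq_square[of "W n p"] 1 unfolding e(1)[symmetric] pw[symmetric]
      by (simp add: power2_eq_square power4_eq_xxxx mult_ac)
    moreover have "W (n + 1) p * W (n - 1) p * W m p ^ 2 =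
       c powi (2 * m ^ 2 + 2 * n ^ 2 + 2) * (T (smul (n + 1) p) * T (smul (n - 1) p) * T (smul m p) ^ 2) / kappa ^ 4"
      unfolding power2_eq_square[of "W m p"] 1 unfolding e(2)[symmetric] pw[symmetric]
      by (simp add: power2_eq_square power4_eq_xxxx mult_ac)
    ultimately show ?thesis unfolding pw by (simp add: right_diff_distrib diff_divide_distrib)
  qed
  finally show ?thesis .
qed

lemma W_0 [simp]: "W 0 p = 0"
  by (simp add: W_def)

lemma W_1: "T p \<noteq> 0 \<Longrightarrow> W 1 p = 1"
  using kappa_nonzero by (simp add: W_def)

text \<open>In S = b0^4 + b1^4 and \<open>disc\<close> one has E4 = 4 S^2 - 3 disc^2 and E6 = S (9
  disc^2 - 8 S^2), so the equation with 2-torsion point e acquires Eisenstein coefficients.\<close>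

lemma curve_coeffs:
  defines "e \<equiv> - 2 * mu * (b0 ^ 4 + b1 ^ 4) / 3" and "a4 \<equiv> mu ^ 2 * disc ^ 2"
  shows "a_ser = a4 - 3 * e ^ 2" "b_ser = 2 * e ^ 3 - e * a4"
proof -
  define S where "S = b0 ^ 4 + b1 ^ 4"
  have E6: "E6 \<noteq> 0" by (rule has_val_nonzero[OF has_val_E6])
  have id: "x ^ 2 + 14 * x * y + y ^ 2 = 4 * (x + y) ^ 2 - 3 * (x - y) ^ 2"
    "(x + y) * (x ^ 2 - 34 * x * y + y ^ 2) = (x + y) * (9 * (x - y) ^ 2 - 8 * (x + y) ^ 2)" for x y :: "complex fls"
    by (simp_all add: power2_eq_square algebra_simps)
  have E4: "E4 = 4 * S ^ 2 - 3 * disc ^ 2" and E6': "E6 = S * (9 * disc ^ 2 - 8 * S ^ 2)"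
    using id[of "b0 ^ 4" "b1 ^ 4"] by (simp_all add: E4_def E6_def S_def disc_def flip: power_mult)
  have mu: "mu * E6 = - 3 * E4" using E6 by (simp add: mu_def)
  have e: "e = - 2 * mu * S / 3" by (simp add: e_def S_def)
  have "a4 - 3 * e ^ 2 = - (mu ^ 2 * E4) / 3"
    unfolding e a4_def E4 by (simp add: field_simps power2_eq_square)
  also have "mu ^ 2 * E4 = 9 * E4 ^ 3 / E6 ^ 2"
    unfolding mu_def by (simp add: power_divide power2_eq_square power3_eq_cube)
  finally show "a_ser = a4 - 3 * e ^ 2" by (simp add: a_ser_def)
  have "2 * e ^ 3 - e * a4 = 2 * (mu ^ 3 * E6) / 27"
    unfolding e a4_def E6' by (simp add: field_simps power2_eq_square power3_eq_cube)
  also have "mu ^ 3 * E6 = - 27 * E4 ^ 3 / E6 ^ 2"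
    using E6 unfolding mu_def by (simp add: field_simps power2_eq_square power3_eq_cube)
  finally show "b_ser = 2 * e ^ 3 - e * a4" by (simp add: b_ser_def mult.assoc)
qed

text \<open>T(4p) T(2p) is the determinant of the vectors at 3p and p. The vector at 3p is not
  computed; it enters through the two combinations that are known, the one in
  \<open>B_triple\<close> and T(3p)^2, the latter through T(3p) T(p).\<close>

lemma theta_quad:
  assumes "T (p + p) \<noteq> 0"
  shows "T (smul 4 p) * (b0 * b1 * disc) = 2 * B0 p * B1 p * (B0 p ^ 4 - B1 p ^ 4) * T (p + p)"
proof -
  define A B A2 B2 A3 B3 where "A = B0 p" "B = B1 p" "A2 = B0 (p + p)" "B2 = B1 (p + p)"
    "A3 = B0 (p + p + p)" "B3 = B1 (p + p + p)"
  note defs = this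
  define P0 P1 where "P0 = b0\<^sup>2 * (A ^ 4 + B ^ 4) - 2 * b1\<^sup>2 * A ^ 2 * B ^ 2"
    and "P1 = 2 * b0\<^sup>2 * A ^ 2 * B ^ 2 - b1\<^sup>2 * (A ^ 4 + B ^ 4)"
  have nz: "b0 \<noteq> 0" "b1 \<noteq> 0" "disc \<noteq> 0"
    using has_val_b0 has_val_b1 has_val_disc by (auto simp: has_val_def)
  have dbl: "A2 * b0 * disc = P0" "B2 * b1 * disc = P1"
    using B_double[of p] by (simp_all add: defs P0_def P1_def)
  have T2: "T (p + p) ^ 2 * (b0 * b1 * disc) = b0\<^sup>2 * P1 - b1\<^sup>2 * P0"
    unfolding T_sq dbl[symmetric] by (simp add: defs power2_eq_square algebra_simps)
  have T3: "T (p + p + p) * T p = B2 * A - A2 * B"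
    using T_add_minus[of "p + p" p] by (simp add: defs)
  have T3': "T (p + p + p) ^ 2 = B3 * b0 - A3 * b1"
    using T_sq[of "p + p + p"] by (simp add: defs)
  have s: "T p ^ 2 = B * b0 - A * b1" using T_sq[of p] by (simp add: defs)
  have T4: "T (smul 4 p) * T (p + p) = B3 * A - A3 * B"
  proof -
    have "smul 4 p = (p + p + p) + p" "p + p = (p + p + p) - p"
      by (simp_all add: smul_def prod_eq_iff)
    thus ?thesis using T_add_minus[of "p + p + p" p] by (simp add: defs)
  qed
  have M: "(A3 * B + B3 * A) * (b0 * b1) = 2 * A2 * B2 * A * B"
    using B_triple[of p] by (simp add: defs)
  \<comment> \<open>Expresses the wanted determinant through the two known linear forms in A3 and
    B3.\<close>
  have "(B3 * A - A3 * B) * (b0 * B + b1 * A) * (B * b0 - A * b1) =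
      - (A3 * B + B3 * A) * (B * b0 - A * b1) ^ 2 + 2 * A * B * (B3 * b0 - A3 * b1) * (B * b0 - A * b1)"
    by (simp add: power2_eq_square algebra_simps)
  also have "(B3 * b0 - A3 * b1) * (B * b0 - A * b1) = (B2 * A - A2 * B) ^ 2"
    unfolding T3[symmetric] T3'[symmetric] s[symmetric] by (simp add: power_mult_distrib)
  hence "2 * A * B * (B3 * b0 - A3 * b1) * (B * b0 - A * b1) = 2 * A * B * (B2 * A - A2 * B) ^ 2"
    by (simp only: mult.assoc)
  finally have eq: "(B3 * A - A3 * B) * (b0 * B + b1 * A) * (B * b0 - A * b1) =
      - (A3 * B + B3 * A) * (B * b0 - A * b1) ^ 2 + 2 * A * B * (B2 * A - A2 * B) ^ 2" .
  have "(B3 * A - A3 * B) * (b0 * B + b1 * A) * (B * b0 - A * b1) * (b0 * b1 * disc) ^ 2 =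
      - ((A3 * B + B3 * A) * (b0 * b1)) * (B * b0 - A * b1) ^ 2 * (b0 * b1 * disc ^ 2) + 2 * A * B * ((B2 * A - A2 * B) * (b0 * b1 * disc)) ^ 2"
    unfolding eq by (simp add: power2_eq_square algebra_simps)
  also have "\<dots> = - (2 * (A2 * b0 * disc) * (B2 * b1 * disc) * A * B) * (B * b0 - A * b1) ^ 2 +
       2 * A * B * (b0 * A * (B2 * b1 * disc) - b1 * B * (A2 * b0 * disc)) ^ 2"
    unfolding M by (simp add: power2_eq_square algebra_simps)
  also have "\<dots> = 2 * A * B * ((b0\<^sup>2 * P1 - b1\<^sup>2 * P0) * (A\<^sup>2 * P1 - B\<^sup>2 * P0))"
    unfolding dbl by (simp add: power2_eq_square algebra_simps)
  also have "A\<^sup>2 * P1 - B\<^sup>2 * P0 = (A ^ 4 - B ^ 4) * ((b0 * B + b1 * A) * (B * b0 - A * b1))"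
    unfolding P0_def P1_def by (simp add: eval_nat_numeral algebra_simps)
  finally have *: "((b0 * B + b1 * A) * (B * b0 - A * b1)) * ((B3 * A - A3 * B) * (b0 * b1 * disc) ^ 2) =
      ((b0 * B + b1 * A) * (B * b0 - A * b1)) * (2 * A * B * (A ^ 4 - B ^ 4) * (T (p + p) ^ 2 * (b0 * b1 * disc)))"
    unfolding T2 by (simp only: mult_ac)
  \<comment> \<open>This factor divides a nonzero multiple of T(2p)^2, so T(2p) being nonzero allows
    its cancellation.\<close>
  have "(b0 * B + b1 * A) * (B * b0 - A * b1) \<noteq> 0"
  proof
    assume "(b0 * B + b1 * A) * (B * b0 - A * b1) = 0"
    moreover have "b0\<^sup>2 * P1 - b1\<^sup>2 * P0 = - 2 * (b0\<^sup>2 * A\<^sup>2 - b1\<^sup>2 * B\<^sup>2) * (b1\<^sup>2 * A\<^sup>2 - b0\<^sup>2 * B\<^sup>2)"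
      unfolding P0_def P1_def by (simp add: eval_nat_numeral algebra_simps)
    moreover have "b1\<^sup>2 * A\<^sup>2 - b0\<^sup>2 * B\<^sup>2 = - ((b0 * B + b1 * A) * (B * b0 - A * b1))"
      by (simp add: power2_eq_square algebra_simps)
    ultimately have "b0\<^sup>2 * P1 - b1\<^sup>2 * P0 = 0" by simp
    thus False using T2 assms nz by simp
  qed
  hence "(B3 * A - A3 * B) * (b0 * b1 * disc) ^ 2 = 2 * A * B * (A ^ 4 - B ^ 4) * (T (p + p) ^ 2 * (b0 * b1 * disc))"
    using * by (simp only: mult_cancel_left) simp
  hence "(T (p + p) * (b0 * b1 * disc)) * (T (smul 4 p) * (b0 * b1 * disc)) = (T (p + p) * (b0 * b1 * disc)) * (2 * A * B * (A ^ 4 - B ^ 4) * T (p + p))"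
    unfolding T4[symmetric] by (simp add: power2_eq_square mult_ac)
  thus ?thesis using nz assms by (simp add: defs)
qed

text \<open>Multiplication by powers of s = T p ^ 2 turns both sides into forms in u and v, which
  \<open>QQ_theta\<close> matches. Apart from the factor \<open>W 2 p\<close>, only the square of
  \<open>kappa\<close> occurs.\<close>

lemma W_initial:
  assumes t: "T p \<noteq> 0" and t2: "T (p + p) \<noteq> 0"
  shows "(W 2 p / 2) ^ 2 = QQ2 a_ser b_ser (x_pt p)" (is ?A)
    and "W 3 p = QQ3 a_ser b_ser (x_pt p)" (is ?B)
    and "W 4 p = 2 * W 2 p * QQ4 a_ser b_ser (x_pt p)" (is ?C)
    and "W 2 p \<noteq> 0" (is ?D)
proof -
  define A B A2 B2 where "A = B0 p" "B = B1 p" "A2 = B0 (p + p)" "B2 = B1 (p + p)"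
  note defs = this
  define P0 P1 where "P0 = b0\<^sup>2 * (A ^ 4 + B ^ 4) - 2 * b1\<^sup>2 * A ^ 2 * B ^ 2"
    and "P1 = 2 * b0\<^sup>2 * A ^ 2 * B ^ 2 - b1\<^sup>2 * (A ^ 4 + B ^ 4)"
  define u v s where "u = b0 * B" "v = b1 * A" "s = T p ^ 2"
  note uvs = this
  define k where "k = b0 * b1 * disc"
  have nz: "b0 \<noteq> 0" "b1 \<noteq> 0" "disc \<noteq> 0" "kappa \<noteq> 0"
    using has_val_b0 has_val_b1 has_val_disc kappa_nonzero by (auto simp: has_val_def)
  hence k0: "k \<noteq> 0" by (simp add: k_def)
  have kap: "kappa ^ 2 = 2 * mu * k" by (simp add: kappa_sq k_def)
  have s: "s = u - v" "s \<noteq> 0"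
    using T_sq[of p] t by (auto simp: uvs defs)
  have dbl: "A2 * b0 * disc = P0" "B2 * b1 * disc = P1"
    using B_double[of p] by (simp_all add: defs P0_def P1_def)
  define e where "e = - 2 * mu * (b0 ^ 4 + b1 ^ 4) / 3"
  define a4 where "a4 = mu ^ 2 * disc ^ 2"
  define x where "x = mu * disc * (u + v) / s"
  have e3: "- 2 * mu * (b0 ^ 4 + b1 ^ 4) = 3 * e" by (simp add: e_def)
  note cc = curve_coeffs[folded e_def a4_def]
  have x: "x_pt p = x + e"
    by (simp add: x_pt_def x_def e_def uvs defs)
  note th = QQ_theta[of s u v mu "b0 ^ 4" "b1 ^ 4", folded disc_def, OF s, unfolded e3, folded x_def a4_def]
  have W2: "W 2 p = kappa ^ 3 * T (p + p) / s ^ 2"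
  proof -
    have "smul 2 p = p + p" by (simp add: smul_def prod_eq_iff)
    thus ?thesis using nz t
      by (simp add: W_def uvs power_divide field_simps flip: power_mult) (simp add: eval_nat_numeral)
  qed
  show ?D using W2 nz s t2 by simp
  have T2: "T (p + p) ^ 2 * k = b0\<^sup>2 * P1 - b1\<^sup>2 * P0"
    unfolding T_sq dbl[symmetric] k_def by (simp add: defs power2_eq_square algebra_simps)
  have "(W 2 p / 2) ^ 2 * s ^ 4 = 2 * mu ^ 3 * k ^ 2 * (T (p + p) ^ 2 * k)"
  proof -
    have "(W 2 p / 2) ^ 2 * s ^ 4 = (kappa ^ 2) ^ 3 * T (p + p) ^ 2 / 4"
      using s unfolding W2 by (simp add: power_divide field_simps flip: power_mult)
    thus ?thesis unfolding kap by (simp add: eval_nat_numeral)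
  qed
  also have "\<dots> = 2 * mu ^ 3 * disc ^ 2 * (2 * b1 ^ 4 * u ^ 2 * v ^ 2 + 2 * b0 ^ 4 * u ^ 2 * v ^ 2 - 2 * b1 ^ 4 * u ^ 4 - 2 * b0 ^ 4 * v ^ 4)"
    unfolding T2 unfolding P0_def P1_def k_def uvs(1,2) by (simp add: eval_nat_numeral algebra_simps)
  also have "\<dots> = QQ2 a_ser b_ser (x_pt p) * s ^ 4"
    unfolding x QQ_shift(1)[OF cc] using th(1) by simp
  finally show ?A using s(2) by simp
  have T3: "T (smul 3 p) * T p * k = b0 * A * P1 - b1 * B * P0"
  proof -
    have "smul 3 p = p + p + p" by (simp add: smul_def prod_eq_iff)
    hence eq: "T (smul 3 p) * T p = B2 * A - A2 * B"
      using T_add_minus[of "p + p" p] by (simp add: defs)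
    show ?thesis unfolding eq dbl[symmetric] k_def by (simp add: algebra_simps)
  qed
  have "W 3 p * s ^ 5 = (kappa ^ 2) ^ 4 * (T (smul 3 p) * T p)"
    using nz t by (simp add: W_def uvs power_divide field_simps flip: power_mult) (simp add: eval_nat_numeral)
  hence "W 3 p * s ^ 5 = 16 * mu ^ 4 * k ^ 3 * (T (smul 3 p) * T p * k)"
    unfolding kap by (simp add: eval_nat_numeral)
  also have "\<dots> = 16 * mu ^ 4 * disc ^ 3 * (b0 ^ 4 * v ^ 3 * (2 * u + v) - b1 ^ 4 * u ^ 3 * (u + 2 * v)) * s"
    unfolding T3 unfolding P0_def P1_def k_def s(1) uvs(1,2) by (simp add: eval_nat_numeral algebra_simps)
  also have "\<dots> = QQ3 a_ser b_ser (x_pt p) * s ^ 5"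
    unfolding x QQ_shift(2)[OF cc] using th(2) by (simp add: eval_nat_numeral)
  finally show ?B using s(2) by simp
  have "W 4 p * s ^ 8 = kappa ^ 15 * T (smul 4 p)"
    using nz t by (simp add: W_def uvs power_divide field_simps flip: power_mult) (simp add: eval_nat_numeral)
  hence "W 4 p * s ^ 8 * k = kappa ^ 15 * (2 * A * B * (A ^ 4 - B ^ 4) * T (p + p))"
    using theta_quad[OF t2] by (simp add: k_def defs mult.assoc)
  also have "\<dots> = 2 * (kappa ^ 3 * T (p + p)) * ((kappa ^ 2) ^ 6 * (A * B * (A ^ 4 - B ^ 4)))"
    by (simp add: eval_nat_numeral)
  also have "kappa ^ 3 * T (p + p) = W 2 p * s ^ 2" using W2 s by simp
  also have "(kappa ^ 2) ^ 6 * (A * B * (A ^ 4 - B ^ 4)) = k * (64 * mu ^ 6 * disc ^ 5 * u * v * (b0 ^ 4 * v ^ 4 - b1 ^ 4 * u ^ 4))"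
    unfolding kap k_def uvs(1,2) by (simp add: eval_nat_numeral algebra_simps)
  also have "64 * mu ^ 6 * disc ^ 5 * u * v * (b0 ^ 4 * v ^ 4 - b1 ^ 4 * u ^ 4) = QQ4 a_ser b_ser (x_pt p) * s ^ 6"
    unfolding x QQ_shift(3)[OF cc] using th(3) by simp
  finally have "(s ^ 8 * k) * W 4 p = (s ^ 8 * k) * (2 * W 2 p * QQ4 a_ser b_ser (x_pt p))"
    by (simp add: eval_nat_numeral mult.assoc)
  thus ?C using s(2) k0 by (simp add: mult.assoc)
qed

end

section \<open>Embeddings of Q(j) and specialization of polynomials\<close>

section \<open>Field homomorphisms\<close>

locale fhom =
  fixes \<phi> :: "'a::field \<Rightarrow> 'b::field"
  assumes add: "\<phi> (x + y) = \<phi> x + \<phi> y" and mult: "\<phi> (x * y) = \<phi> x * \<phi> y" and one [simp]: "\<phi> 1 = 1"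
begin

lemma zero [simp]: "\<phi> 0 = 0"
proof -
  have "\<phi> 0 + \<phi> 0 = \<phi> 0 + 0" using add[of 0 0] by (simp only: add_0_right)
  thus ?thesis by (simp only: add_left_cancel)
qed

lemma uminus: "\<phi> (- x) = - \<phi> x"
  using add[of x "- x"] by (simp add: eq_neg_iff_add_eq_0 add.commute)

lemma diff: "\<phi> (x - y) = \<phi> x - \<phi> y"
  using add[of x "- y"] by (simp add: uminus)

lemma power: "\<phi> (x ^ n) = \<phi> x ^ n"
  by (induction n) (simp_all add: mult)

lemma eq_0_iff [simp]: "\<phi> x = 0 \<longleftrightarrow> x = 0"
proof
  assume "\<phi> x = 0"
  hence "\<phi> (x * inverse x) = 0" by (simp add: mult)
  thus "x = 0" by (metis one right_inverse zero_neq_one)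
qed simp

lemma eq_iff: "\<phi> x = \<phi> y \<longleftrightarrow> x = y"
  using eq_0_iff[of "x - y"] by (simp add: diff)

lemma inverse: "\<phi> (inverse x) = inverse (\<phi> x)"
proof (cases "x = 0")
  case False
  hence "\<phi> x * \<phi> (inverse x) = 1" by (simp flip: mult)
  thus ?thesis by (metis inverse_unique)
qed simp

lemma divide: "\<phi> (x / y) = \<phi> x / \<phi> y"
  by (simp add: divide_inverse mult inverse)

lemma of_nat: "\<phi> (of_nat n) = of_nat n"
  by (induction n) (simp_all add: add)

lemma numeral: "\<phi> (numeral n) = numeral n"
  using of_nat[of "numeral n"] by simp

lemma sum: "\<phi> (sum f A) = (\<Sum>x\<in>A. \<phi> (f x))"
  by (induction A rule: infinite_finite_induct) (simp_all add: add)

abbreviation "mp \<equiv> map_poly \<phi>"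

lemma coeff_mp [simp]: "coeff (mp p) n = \<phi> (coeff p n)"
  by (rule coeff_map_poly) simp

lemma mp_0 [simp]: "mp 0 = 0" and mp_1 [simp]: "mp 1 = 1"
  by (simp_all add: poly_eq_iff coeff_1)

lemma mp_add: "mp (p + q) = mp p + mp q"
  and mp_diff: "mp (p - q) = mp p - mp q"
  by (simp_all add: poly_eq_iff add diff)

lemma mp_mult: "mp (p * q) = mp p * mp q"
  by (simp add: poly_eq_iff coeff_mult sum mult)

lemma mp_power: "mp (p ^ n) = mp p ^ n"
  by (induction n) (simp_all add: mp_mult)

lemma mp_prod: "mp (prod f A) = (\<Prod>x\<in>A. mp (f x))"
  by (induction A rule: infinite_finite_induct) (simp_all add: mp_mult)

lemma mp_eq_iff: "mp p = mp q \<longleftrightarrow> p = q"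
  by (simp add: poly_eq_iff eq_iff)

lemma mp_eq_0_iff [simp]: "mp p = 0 \<longleftrightarrow> p = 0"
  using mp_eq_iff[of p 0] by simp

lemma degree_mp [simp]: "degree (mp p) = degree p"
  by (rule degree_map_poly) simp

lemma mp_pCons: "mp (pCons c p) = pCons (\<phi> c) (mp p)"
  by (rule map_poly_pCons) simp

lemma poly_mp: "poly (mp p) (\<phi> x) = \<phi> (poly p x)"
  by (induction p) (simp_all add: mp_pCons add mult)

text \<open>Division with remainder commutes with a field embedding, so divisibility seen over the
  larger field descends.\<close>

lemma mp_dvd_iff: "mp p dvd mp q \<longleftrightarrow> p dvd q"
proof
  assume dvd: "mp p dvd mp q"
  show "p dvd q"
  proof (cases "p = 0")
    case False
    have "mp q = mp p * mp (q div p) + mp (q mod p)"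
      by (simp flip: mp_mult mp_add)
    hence "mp p dvd mp (q mod p)" using dvd by (metis dvd_add_triv_right_iff dvd_triv_left dvd_add_right_iff)
    moreover have "q mod p = 0 \<or> degree (q mod p) < degree p" using False by (rule degree_mod_less)
    ultimately have "q mod p = 0" using divides_degree[of "mp p" "mp (q mod p)"] by auto
    thus ?thesis by auto
  qed (use dvd in simp)
qed (auto simp: mp_mult)

lemma mp_pderiv: "mp (pderiv p) = pderiv (mp p)"
  by (simp add: poly_eq_iff coeff_pderiv mult of_nat add)

end

lemma fhom_comp: "fhom \<phi> \<Longrightarrow> fhom \<psi> \<Longrightarrow> fhom (\<lambda>x. \<psi> (\<phi> x))"
  by (simp add: fhom_def)

lemma map_poly_comp:
  assumes "fhom \<phi>" "fhom \<psi>"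
  shows "map_poly \<psi> (map_poly \<phi> p) = map_poly (\<lambda>x. \<psi> (\<phi> x)) p"
proof -
  interpret p: fhom \<phi> by fact
  interpret s: fhom \<psi> by fact
  interpret c: fhom "\<lambda>x. \<psi> (\<phi> x)" by (rule fhom_comp) fact+
  show ?thesis by (simp add: poly_eq_iff)
qed

section \<open>Evaluation of rational functions\<close>

lemma ratfun_eval_Fract:
  assumes "fhom h" "poly (map_poly h d) x \<noteq> 0"
  shows "ratfun_eval h x (Fraction_Field.Fract n d) = poly (map_poly h n) x / poly (map_poly h d) x"
proof -
  interpret h: fhom h by fact
  show ?thesis unfolding ratfun_eval_def
  proof (rule the_equality)
    fix v assume "\<exists>n' d'. Fraction_Field.Fract n d = Fraction_Field.Fract n' d' \<and>
      poly (h.mp d') x \<noteq> 0 \<and> v = poly (h.mp n') x / poly (h.mp d') x"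
    then obtain n' d' where *: "Fraction_Field.Fract n d = Fraction_Field.Fract n' d'"
      "poly (h.mp d') x \<noteq> 0" "v = poly (h.mp n') x / poly (h.mp d') x" by blast
    have "d \<noteq> 0" "d' \<noteq> 0" using assms * by auto
    hence "n * d' = n' * d" using * by (simp add: eq_fract)
    hence "poly (h.mp n) x * poly (h.mp d') x = poly (h.mp n') x * poly (h.mp d) x"
      by (metis h.mp_mult poly_mult)
    thus "v = poly (h.mp n) x / poly (h.mp d) x"
      using assms(2) *(2) unfolding *(3) by (simp add: frac_eq_eq)
  qed (use assms in blast)
qed

definition transc :: "'b::field_char_0 \<Rightarrow> bool" where
  "transc \<sigma> \<longleftrightarrow> (\<forall>p::rat poly. p \<noteq> 0 \<longrightarrow> poly (map_poly of_rat p) \<sigma> \<noteq> 0)"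

definition ev :: "'b::field_char_0 \<Rightarrow> Qj \<Rightarrow> 'b" where
  "ev = ratfun_eval of_rat"

lemma fhom_of_rat: "fhom (of_rat :: rat \<Rightarrow> 'b::field_char_0)"
  by unfold_locales (simp_all add: of_rat_add of_rat_mult)

lemma ev_Fract: "transc \<sigma> \<Longrightarrow> d \<noteq> 0 \<Longrightarrow>
  ev \<sigma> (Fraction_Field.Fract n d) = poly (map_poly of_rat n) \<sigma> / poly (map_poly of_rat d) \<sigma>"
  unfolding ev_def by (rule ratfun_eval_Fract[OF fhom_of_rat]) (simp add: transc_def)

lemma fhom_ev:
  fixes \<sigma> :: "'b::field_char_0"
  assumes "transc \<sigma>"
  shows "fhom (ev \<sigma>)"
proof
  interpret r: fhom "of_rat :: rat \<Rightarrow> 'b" by (rule fhom_of_rat)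
  have nz: "poly (r.mp d) \<sigma> \<noteq> 0" if "d \<noteq> 0" for d using assms that by (simp add: transc_def)
  fix x y :: Qj
  obtain n d where x: "x = Fraction_Field.Fract n d" "d \<noteq> 0" by (cases x) auto
  obtain n' d' where y: "y = Fraction_Field.Fract n' d'" "d' \<noteq> 0" by (cases y) auto
  show "ev \<sigma> (x + y) = ev \<sigma> x + ev \<sigma> y"
    using x y nz[OF x(2)] nz[OF y(2)] assms
    by (simp add: ev_Fract r.mp_add r.mp_mult field_simps)
  show "ev \<sigma> (x * y) = ev \<sigma> x * ev \<sigma> y"
    using x y nz[OF x(2)] nz[OF y(2)] assms
    by (simp add: ev_Fract r.mp_mult field_simps)
  show "ev \<sigma> 1 = 1"
    using assms ev_Fract[of \<sigma> 1 1] by (simp add: One_fract_def)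
qed

lemma ev_s_var: "transc \<sigma> \<Longrightarrow> ev \<sigma> s_var = \<sigma>"
  using ev_Fract[of \<sigma> 1 "[:0, 1:]"] by (simp add: s_var_def to_fract_def map_poly_pCons)

lemma fhom_of_rat_comm:
  assumes "fhom \<psi>"
  shows "\<psi> (of_rat q) = (of_rat q :: 'b::field_char_0)"
proof -
  interpret fhom \<psi> by fact
  have i: "\<psi> (of_int n) = of_int n" for n
    by (cases n rule: int_cases2) (simp_all add: of_nat uminus)
  obtain m n where "q = of_int m / of_int n" by (metis Fract_of_int_quotient Rat_cases)
  thus ?thesis by (simp add: of_rat_divide divide i)
qed

text \<open>An embedding of Q(j) obtained by evaluation is determined by the image of s, so changing
  the series field amounts to following s.\<close>

lemma fhom_ev_comp:
  fixes \<psi> :: "'b::field_char_0 \<Rightarrow> 'c::field_char_0"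
  assumes \<psi>: "fhom \<psi>" and \<sigma>: "transc \<sigma>"
  shows "transc (\<psi> \<sigma>)" "\<psi> (ev \<sigma> r) = ev (\<psi> \<sigma>) r"
proof -
  interpret p: fhom \<psi> by fact
  interpret r: fhom "of_rat :: rat \<Rightarrow> 'b" by (rule fhom_of_rat)
  interpret r': fhom "of_rat :: rat \<Rightarrow> 'c" by (rule fhom_of_rat)
  have *: "poly (r'.mp p) (\<psi> \<sigma>) = \<psi> (poly (r.mp p) \<sigma>)" for p
    using fhom_of_rat_comm[OF \<psi>] by (induction p) (simp_all add: r.mp_pCons r'.mp_pCons p.add p.mult)
  show t: "transc (\<psi> \<sigma>)" using \<sigma> by (simp add: transc_def *)
  obtain n d where "r = Fraction_Field.Fract n d" "d \<noteq> 0" by (cases r) auto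
  thus "\<psi> (ev \<sigma> r) = ev (\<psi> \<sigma>) r" by (simp add: ev_Fract \<sigma> t * p.divide)
qed

text \<open>Nonzero rational constants have valuation 0 and the series has positive valuation, so in
  Horner form a nonzero constant term cannot be cancelled.\<close>

lemma transc_fls:
  fixes \<sigma> :: "'a::field_char_0 fls"
  assumes "\<sigma> \<noteq> 0" "fls_subdegree \<sigma> > 0"
  shows "transc \<sigma>"
  unfolding transc_def
proof (intro allI impI)
  interpret r: fhom "of_rat :: rat \<Rightarrow> 'a fls" by (rule fhom_of_rat)
  have c: "of_rat q \<noteq> (0 :: 'a fls) \<and> fls_subdegree (of_rat q :: 'a fls) = 0" if "q \<noteq> 0" for q
  proof -
    obtain m n where mn: "q = of_int m / of_int n" by (metis Fract_of_int_quotient Rat_cases)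
    have i: "fls_subdegree (of_int k :: 'a fls) = 0" for k by (simp add: fls_of_int)
    show ?thesis using that i by (auto simp: mn of_rat_divide divide_inverse of_rat_mult of_rat_inverse fls_inverse_subdegree)
  qed
  have "p \<noteq> 0 \<Longrightarrow> poly (r.mp p) \<sigma> \<noteq> 0 \<and> 0 \<le> fls_subdegree (poly (r.mp p) \<sigma>)" for p
  proof (induction p)
    case (pCons a p)
    show ?case
    proof (cases "a = 0")
      case True
      thus ?thesis using pCons assms by (simp add: r.mp_pCons)
    next
      case False
      have "\<sigma> * poly (r.mp p) \<sigma> = 0 \<or> fls_subdegree (\<sigma> * poly (r.mp p) \<sigma>) > 0"
        using pCons assms by (cases "p = 0") auto
      hence "fls_subdegree (of_rat a + \<sigma> * poly (r.mp p) \<sigma>) = 0 \<and> of_rat a + \<sigma> * poly (r.mp p) \<sigma> \<noteq> 0"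
        using c[OF False] by (metis add.right_neutral add_eq_0_iff fls_subdegree_add_eq1 fls_uminus_subdegree less_irrefl)
      thus ?thesis by (simp add: r.mp_pCons)
    qed
  qed simp
  thus "poly (r.mp p) \<sigma> \<noteq> 0" if "p \<noteq> 0" for p using that by blast
qed

section \<open>Division polynomials as polynomials over the rational function field\<close>

definition c3_poly :: "Qj poly" where
  "c3_poly = 3 * [:0, 1:] ^ 4 + 6 * [:curve_a:] * [:0, 1:] ^ 2 + 12 * [:curve_b:] * [:0, 1:] - [:curve_a:] ^ 2"

definition c4_poly :: "Qj poly" where
  "c4_poly = [:0, 1:] ^ 6 + 5 * [:curve_a:] * [:0, 1:] ^ 4 + 20 * [:curve_b:] * [:0, 1:] ^ 3 -
    5 * [:curve_a:] ^ 2 * [:0, 1:] ^ 2 - 4 * [:curve_a:] * [:curve_b:] * [:0, 1:] - 8 * [:curve_b:] ^ 2 - [:curve_a:] ^ 3"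

definition fpol :: "nat \<Rightarrow> Qj poly" where
  "fpol = dseq [:1 / 2:] weierstrass_rhs c3_poly c4_poly"

lemma weierstrass_rhs_alt: "weierstrass_rhs = [:0, 1:] ^ 3 + [:curve_a:] * [:0, 1:] + [:curve_b:]"
  by (simp add: weierstrass_rhs_def power3_eq_cube)

lemma fpol_deg_lc:
  assumes "n > 0"
  shows "deg_lc (fpol n) (ddeg n) (of_nat n)"
  unfolding fpol_def
proof (rule dseq_deg_lc[OF _ _ _ assms])
  show "deg_lc weierstrass_rhs 3 1"
    by (simp add: deg_lc_def weierstrass_rhs_def eval_nat_numeral)
  have c3: "c3_poly = [:- (curve_a ^ 2), 12 * curve_b, 6 * curve_a, 0, 3:]"
    by (simp add: c3_poly_def eval_nat_numeral numeral_poly)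
  show "deg_lc c3_poly 4 3"
    unfolding deg_lc_def c3 by (simp add: eval_nat_numeral)
  have c4: "c4_poly = [:- 8 * curve_b ^ 2 - curve_a ^ 3, - 4 * curve_a * curve_b, - 5 * curve_a ^ 2, 20 * curve_b, 5 * curve_a, 0, 1:]"
    by (simp add: c4_poly_def eval_nat_numeral numeral_poly)
  show "deg_lc c4_poly 6 1"
    unfolding deg_lc_def c4 by (simp add: eval_nat_numeral)
qed

lemma degree_fpol: "n > 0 \<Longrightarrow> degree (fpol n) = ddeg n"
  and lead_coeff_fpol: "n > 0 \<Longrightarrow> lead_coeff (fpol n) = of_nat n"
proof -
  assume n: "n > 0"
  have "coeff (fpol n) (ddeg n) \<noteq> 0" "degree (fpol n) \<le> ddeg n" "coeff (fpol n) (ddeg n) = of_nat n"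
    using fpol_deg_lc[OF n] n by (auto simp: deg_lc_def)
  thus "degree (fpol n) = ddeg n" "lead_coeff (fpol n) = of_nat n"
    using le_degree[of "fpol n" "ddeg n"] by auto
qed

context fhom
begin

lemma poly_mp_hom:
  "poly (mp (p + q)) x = poly (mp p) x + poly (mp q) x" "poly (mp (p - q)) x = poly (mp p) x - poly (mp q) x"
  "poly (mp (p * q)) x = poly (mp p) x * poly (mp q) x" "poly (mp (p ^ n)) x = poly (mp p) x ^ n"
  "poly (mp [:c:]) x = \<phi> c" "poly (mp [:0, 1:]) x = x" "poly (mp (numeral k)) x = numeral k"
  by (simp_all add: mp_add mp_diff mp_mult mp_power mp_pCons numeral_poly numeral)

end

lemma poly_fpol:
  assumes "fhom \<phi>"
  shows "poly (map_poly \<phi> (fpol n)) x = dseq (1 / 2) (QQ2 (\<phi> curve_a) (\<phi> curve_b) x)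
    (QQ3 (\<phi> curve_a) (\<phi> curve_b) x) (QQ4 (\<phi> curve_a) (\<phi> curve_b) x) n"
    and "poly (map_poly \<phi> weierstrass_rhs) x = QQ2 (\<phi> curve_a) (\<phi> curve_b) x"
    and "poly (map_poly \<phi> c3_poly) x = QQ3 (\<phi> curve_a) (\<phi> curve_b) x"
    and "poly (map_poly \<phi> c4_poly) x = QQ4 (\<phi> curve_a) (\<phi> curve_b) x"
proof -
  interpret fhom \<phi> by fact
  show 1: "poly (mp weierstrass_rhs) x = QQ2 (\<phi> curve_a) (\<phi> curve_b) x"
    unfolding weierstrass_rhs_alt QQ2_def poly_mp_hom ..
  show 2: "poly (mp c3_poly) x = QQ3 (\<phi> curve_a) (\<phi> curve_b) x"
    unfolding c3_poly_def QQ3_def poly_mp_hom ..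
  show 3: "poly (mp c4_poly) x = QQ4 (\<phi> curve_a) (\<phi> curve_b) x"
    unfolding c4_poly_def QQ4_def poly_mp_hom ..
  have "poly (mp (fpol n)) x = dseq (poly (mp [:1 / 2:]) x) (poly (mp weierstrass_rhs) x) (poly (mp c3_poly) x) (poly (mp c4_poly) x) n"
    unfolding fpol_def by (rule dseq_hom) (simp_all add: poly_mp_hom)
  moreover have "poly (mp [:1 / 2:]) x = 1 / 2"
    by (simp add: mp_pCons divide numeral)
  ultimately show "poly (mp (fpol n)) x = dseq (1 / 2) (QQ2 (\<phi> curve_a) (\<phi> curve_b) x)
    (QQ3 (\<phi> curve_a) (\<phi> curve_b) x) (QQ4 (\<phi> curve_a) (\<phi> curve_b) x) n"
    by (simp add: 1 2 3)
qed

definition of_poly :: "Qj poly \<Rightarrow> curve_fun" where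
  "of_poly p = of_ratfun (to_fract p)"

lemma fhom_of_ratfun: "fhom of_ratfun"
  by unfold_locales (simp_all add: of_ratfun_def one_curve_fun_def)

lemma of_poly_hom:
  "of_poly (p + q) = of_poly p + of_poly q" "of_poly (p - q) = of_poly p - of_poly q"
  "of_poly (p * q) = of_poly p * of_poly q" "of_poly 1 = 1" "of_poly 0 = 0"
  "of_poly (p ^ n) = of_poly p ^ n" "of_poly [:c:] = cf_const c" "of_poly [:0, 1:] = cf_x"
  "of_poly (numeral k) = numeral k"
  "of_poly p = of_poly q \<longleftrightarrow> p = q" "of_poly p = 0 \<longleftrightarrow> p = 0"
proof -
  interpret fhom of_ratfun by (rule fhom_of_ratfun)
  have pw: "to_fract (p ^ k) = to_fract p ^ k" for p :: "Qj poly" and k by (induction k) simp_all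
  have n: "to_fract (of_nat m :: Qj poly) = of_nat m" for m by (induction m) simp_all
  show "of_poly (p + q) = of_poly p + of_poly q" "of_poly (p - q) = of_poly p - of_poly q"
    "of_poly (p * q) = of_poly p * of_poly q" "of_poly 1 = 1" "of_poly 0 = 0"
    "of_poly (p ^ n) = of_poly p ^ n"
    by (simp_all add: of_poly_def add diff mult power pw)
  show "of_poly [:c:] = cf_const c" "of_poly [:0, 1:] = cf_x"
    by (simp_all add: of_poly_def cf_const_def cf_x_def)
  show "of_poly (numeral k) = numeral k"
    using n[of "numeral k"] by (simp add: of_poly_def numeral)
  show "of_poly p = of_poly q \<longleftrightarrow> p = q" "of_poly p = 0 \<longleftrightarrow> p = 0"
    by (simp_all add: of_poly_def of_ratfun_def zero_curve_fun_def)
qed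

lemma cf_y_sq: "cf_y ^ 2 = of_poly weierstrass_rhs"
  by (simp add: cf_y_def power2_eq_square of_poly_def of_ratfun_def)

lemma cf_y_nonzero: "cf_y \<noteq> 0"
  by (simp add: cf_y_def zero_curve_fun_def)

lemma curve_fun_two: "(2 :: curve_fun) \<noteq> 0"
  using of_poly_hom(11)[of 2] of_poly_hom(9)[of "num.Bit0 num.One"] by simp

lemma div_pol_eq:
  assumes "n > 0"
  shows "div_pol n = of_poly (fpol n) * (if even n then cf_y else 1)"
proof -
  have "div_pol n = dseq (1 / 2) (of_poly weierstrass_rhs) (of_poly c3_poly) (of_poly c4_poly) n * (if even n then cf_y else 1)"
  proof (rule dseq_unique[OF _ _ _ _ _ cf_y_sq _ _ assms])
    show "div_pol 1 = 1" "div_pol 2 = 2 * cf_y" by (subst div_pol.simps; simp)+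
    show "div_pol 3 = of_poly c3_poly"
      unfolding c3_poly_def of_poly_hom by (subst div_pol.simps) (simp add: Let_def)
    show "div_pol 4 = 4 * cf_y * of_poly c4_poly"
      unfolding c4_poly_def of_poly_hom by (subst div_pol.simps) (simp add: Let_def)
    show "2 * cf_y \<noteq> 0" using cf_y_nonzero curve_fun_two by simp
    show "div_pol (2 * m + 1) = div_pol (m + 2) * div_pol m ^ 3 - div_pol (m - 1) * div_pol (m + 1) ^ 3" if "m \<ge> 2" for m
      using that by (subst div_pol.simps) (simp add: Let_def)
    show "div_pol (2 * m) = (div_pol (m + 2) * div_pol (m - 1) ^ 2 - div_pol (m - 2) * div_pol (m + 1) ^ 2) * div_pol m / div_pol 2" if "m \<ge> 3" for m
      using that by (subst div_pol.simps) (simp add: Let_def)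
  qed
  also have "(1 / 2 :: curve_fun) = of_poly [:1 / 2:]"
  proof -
    have "of_poly [:1 / 2:] * 2 = of_poly ([:1 / 2:] * 2)" by (simp only: of_poly_hom)
    also have "[:1 / 2 :: Qj:] * 2 = 1" by (simp add: numeral_poly one_pCons)
    finally show ?thesis using curve_fun_two by (simp add: of_poly_hom(4) eq_divide_eq)
  qed
  also have "dseq (of_poly [:1 / 2:]) (of_poly weierstrass_rhs) (of_poly c3_poly) (of_poly c4_poly) n = of_poly (fpol n)"
    unfolding fpol_def by (rule dseq_hom[symmetric]) (simp_all only: of_poly_hom)
  finally show ?thesis .
qed

section \<open>Explicit torsion points and factorization of division polynomials\<close>

section \<open>Torsion points of the Tate curve\<close>

text \<open>With g = M every M-torsion point has integral exponents, so all orders dividing M are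
  handled over one field.\<close>

locale tate = fixes M :: nat assumes M_pos: "M > 0"
begin

sublocale theta_series "int M"
  by unfold_locales (use M_pos in simp)

lemma transc_s: "transc s_series"
  using has_val_s_series M_pos by (intro transc_fls) (auto simp: has_val_def)

definition emb :: "Qj \<Rightarrow> complex fls" where
  "emb = ev s_series"

sublocale emb: fhom emb
  unfolding emb_def by (rule fhom_ev[OF transc_s])

lemma emb_curve: "emb curve_a = a_ser" "emb curve_b = b_ser"
proof -
  have s: "emb s_var = s_series" unfolding emb_def by (rule ev_s_var[OF transc_s])
  have E: "E4 \<noteq> 0" "E6 \<noteq> 0" using has_val_E4 has_val_E6 by (auto simp: has_val_def)
  have s0: "s_series \<noteq> 0" using has_val_s_series by (simp add: has_val_def)
  have "emb j_inv = inverse s_series"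
    by (simp add: j_inv_def s emb.divide inverse_eq_divide)
  hence j: "emb j0 = inverse s_series / (inverse s_series - 1728)"
    by (simp add: j0_def emb.divide emb.diff emb.numeral)
  have 1: "1 - 1728 * s_series = E6 ^ 2 / E4 ^ 3"
  proof -
    have "(1 - 1728 * s_series) * E4 ^ 3 = E6 ^ 2" using E4_E6 by (simp add: algebra_simps)
    thus ?thesis using E by (simp add: eq_divide_eq)
  qed
  have "emb j0 = 1 / (1 - 1728 * s_series)"
    unfolding j using s0 by (simp add: divide_simps)
  also have "\<dots> = E4 ^ 3 / E6 ^ 2" unfolding 1 by simp
  finally have "emb j0 = E4 ^ 3 / E6 ^ 2" .
  thus "emb curve_a = a_ser" "emb curve_b = b_ser"
    by (simp_all add: curve_a_def curve_b_def a_ser_def b_ser_def emb.mult emb.uminus emb.numeral)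
qed

lemma fpol_theta:
  assumes t: "T p \<noteq> 0" "T (p + p) \<noteq> 0" and "n > 0"
  shows "W (int n) p = poly (emb.mp (fpol n)) (x_pt p) * (if even n then W 2 p / 2 else 1)"
  unfolding poly_fpol(1)[OF emb.fhom_axioms] emb_curve
proof (rule dseq_unique[where W = "\<lambda>n. W (int n) p", OF _ _ _ _ _ _ _ _ \<open>n > 0\<close>])
  note W = W_initial[OF t]
  show "W (int 1) p = 1" using W_1[OF t(1)] by simp
  show "W (int 2) p = 2 * (W 2 p / 2)" by simp
  show "W (int 3) p = QQ3 a_ser b_ser (x_pt p)" using W by simp
  show "W (int 4) p = 4 * (W 2 p / 2) * QQ4 a_ser b_ser (x_pt p)" using W by simp
  show "2 * (W 2 p / 2) \<noteq> 0" using W by simp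
  show "(W 2 p / 2) ^ 2 = QQ2 a_ser b_ser (x_pt p)" by (rule W(1))
  show "W (int (2 * m + 1)) p = W (int (m + 2)) p * W (int m) p ^ 3 - W (int (m - 1)) p * W (int (m + 1)) p ^ 3"
    if "m \<ge> 2" for m
    \<comment> \<open>The indices sum to 2m + 1 and differ by 1, and W 1 = 1.\<close>
    using W_eds[OF t(1), of "int m + 1" "int m"] W_1[OF t(1)] that
    by (simp add: of_nat_diff power2_eq_square power3_eq_cube algebra_simps)
  show "W (int (2 * m)) p = (W (int (m + 2)) p * W (int (m - 1)) p ^ 2 - W (int (m - 2)) p * W (int (m + 1)) p ^ 2) * W (int m) p / W (int 2) p"
    if "m \<ge> 3" for m
    \<comment> \<open>The indices sum to 2m and differ by 2, which accounts for the division by W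
      2.\<close>
    using W_eds[OF t(1), of "int m + 1" "int m - 1"] W(4) that
    by (simp add: of_nat_diff power2_eq_square eq_divide_eq algebra_simps)
qed

text \<open>Height 1/4 keeps p and 2p away from the zeros of theta, and the distinct absolute values
  exp(2n) of the constant parts keep the points apart. This gives the infinitely many x-values for
  polynomial identities.\<close>

lemma generic_points:
  fixes n :: nat
  defines "p \<equiv> \<lambda>n::nat. (of_nat n, int M) :: point"
  shows "T (p n) \<noteq> 0" "T (p n + p n) \<noteq> 0" "inj (\<lambda>n. x_pt (p n))"
proof -
  have Z: "\<not> is_zero (z, l)" if "0 < l" "l < 4 * int M" for z l
    using that zdvd_not_zless[of l "4 * int M"] by (auto simp: is_zero_def)
  show "T (p n) \<noteq> 0" using theta_has_val[OF Z, of "int M" "of_nat n"] M_pos by (auto simp: p_def has_val_def)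
  show "T (p n + p n) \<noteq> 0"
    using theta_has_val[OF Z, of "2 * int M" "of_nat n + of_nat n"] M_pos by (auto simp: p_def has_val_def)
  show "inj (\<lambda>n. x_pt (p n))"
  proof (rule injI, rule ccontr)
    fix m n assume eq: "x_pt (p m) = x_pt (p n)" and ne: "m \<noteq> n"
    have "exp (2 * (of_nat m - of_nat n)) \<noteq> (1 :: complex)"
    proof
      assume "exp (2 * (of_nat m - of_nat n)) = (1 :: complex)"
      hence "norm (exp (complex_of_real (2 * (real m - real n)))) = 1" by simp
      thus False using ne by (simp only: norm_exp_eq_Re Re_complex_of_real) simp
    qed
    hence nz: "\<not> is_zero (of_nat m - of_nat n, int M - int M)" by (simp add: is_zero_def)
    have "has_val (x_pt (p m) - x_pt (p n)) (2 * min (int M) (int M))"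
      unfolding p_def by (rule x_diff_has_val[OF _ _ _ _ Z Z Z nz]) (use M_pos in simp_all)
    thus False using eq by (simp add: has_val_def)
  qed
qed

end

text \<open>The relation is \<open>W_eds\<close> with n = 2, valid at infinitely many x, hence an
  identity of polynomials over Q(j). In the odd case the two y-factors of neighbours and the square
  of W 2 give w^2.\<close>

lemma somos_fpol:
  assumes "m \<ge> 2"
  shows "fpol (m + 2) * fpol (m - 2) =
    4 * (if even m then 1 else weierstrass_rhs ^ 2) * fpol (m + 1) * fpol (m - 1) - c3_poly * fpol m ^ 2"
    (is "?L = ?R")
proof -
  obtain M :: nat where M: "M > 0" by blast
  interpret tate M by unfold_locales (rule M)
  define p where "p = (\<lambda>n::nat. (of_nat n, int M) :: point)"
  have "poly (emb.mp (?L - ?R)) (x_pt (p n)) = 0" for n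
  proof -
    have t: "T (p n) \<noteq> 0" "T (p n + p n) \<noteq> 0" using generic_points by (auto simp: p_def)
    define x where "x = x_pt (p n)"
    define y where "y = W 2 (p n) / 2"
    define f where "f = (\<lambda>n. poly (emb.mp (fpol n)) x)"
    have y: "y \<noteq> 0" "y ^ 2 = poly (emb.mp weierstrass_rhs) x"
      using W_initial[OF t] poly_fpol(2)[OF emb.fhom_axioms] by (auto simp: y_def x_def emb_curve)
    have W: "W (int k) (p n) = f k * (if even k then y else 1)" for k
      using fpol_theta[OF t, of k] by (cases "k = 0") (auto simp: f_def x_def y_def fpol_def)
    have c3: "W 3 (p n) = poly (emb.mp c3_poly) x"
      using W_initial[OF t] poly_fpol(3)[OF emb.fhom_axioms] by (simp add: x_def emb_curve)
    have "W (int (m + 2)) (p n) * W (int (m - 2)) (p n) =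
      W (int (m + 1)) (p n) * W (int (m - 1)) (p n) * W 2 (p n) ^ 2 - W 3 (p n) * W (int m) (p n) ^ 2"
      using W_eds[OF t(1), of "int m" 2] W_1[OF t(1)] assms by (simp add: of_nat_diff add.commute)
    also have "W 2 (p n) = 2 * y" by (simp add: y_def)
    finally have e: "f (m + 2) * (if even m then y else 1) * (f (m - 2) * (if even m then y else 1)) =
      f (m + 1) * (if even m then 1 else y) * (f (m - 1) * (if even m then 1 else y)) * (2 * y) ^ 2 -
      poly (emb.mp c3_poly) x * (f m * (if even m then y else 1)) ^ 2"
      unfolding W c3 using assms by simp
    have "f (m + 2) * f (m - 2) = 4 * (if even m then 1 else (y ^ 2) ^ 2) * f (m + 1) * f (m - 1) - poly (emb.mp c3_poly) x * f m ^ 2"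
    proof (cases "even m")
      case True
      have "y ^ 2 * (f (m + 2) * f (m - 2)) = y ^ 2 * (4 * f (m + 1) * f (m - 1) - poly (emb.mp c3_poly) x * f m ^ 2)"
        using e True by (simp add: power2_eq_square algebra_simps)
      thus ?thesis using True y(1) by simp
    next
      case False
      thus ?thesis using e by (simp add: power2_eq_square algebra_simps)
    qed
    thus ?thesis unfolding y(2) f_def
      by (cases "even m") (simp_all add: emb.poly_mp_hom flip: x_def)
  qed
  hence "range (\<lambda>n. x_pt (p n)) \<subseteq> {x. poly (emb.mp (?L - ?R)) x = 0}" by auto
  moreover have "infinite (range (\<lambda>n. x_pt (p n)))"
    using generic_points(3) by (intro range_inj_infinite) (simp add: p_def)
  ultimately have "emb.mp (?L - ?R) = 0"
    using poly_roots_finite finite_subset by blast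
  thus ?thesis by (simp only: emb.mp_eq_0_iff right_minus_eq)
qed

text \<open>Representatives of \<open>(\<int>/m)\<^sup>2\<close> modulo \<open>\<plusminus>1\<close>, without the points killed by 2.\<close>

definition half_system :: "int \<Rightarrow> (int \<times> int) set" where
  "half_system m = {(a, c). 0 \<le> a \<and> a < m \<and> 0 \<le> c \<and> 2 * c \<le> m \<and> (c = 0 \<or> 2 * c = m \<longrightarrow> 0 < a \<and> 2 * a < m)}"

lemma finite_half_system: "finite (half_system m)"
  by (rule finite_subset[of _ "{0..<m} \<times> {0..m}"]) (auto simp: half_system_def)

lemma card_half_system:
  assumes "k > 0"
  shows "card (half_system (int k)) = ddeg k"
proof -
  \<comment> \<open>\<open>h\<close> counts the residues strictly between 0 and k/2. At heights
    strictly between 0 and 1/2 every \<open>a\<close> occurs; at the two end heights negation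
    preserves the height, so only \<open>h\<close> of them represent.\<close>
  define h where "h = (int k - 1) div 2"
  define A where "A = {0..<int k} \<times> {1..h}"
  define B where "B = {1..h} \<times> {0::int}"
  define C where "C = {1..h} \<times> (if even k then {int k div 2} else {})"
  have eq: "half_system (int k) = A \<union> (B \<union> C)"
  proof (intro equalityI subsetI)
    fix q assume "q \<in> half_system (int k)"
    then obtain a c where q: "q = (a, c)" and *: "0 \<le> a" "a < int k" "0 \<le> c" "2 * c \<le> int k"
      "c = 0 \<or> 2 * c = int k \<longrightarrow> 0 < a \<and> 2 * a < int k" by (auto simp: half_system_def)
    consider "c = 0" | "2 * c = int k" | "0 < c" "2 * c < int k" using * by linarith
    thus "q \<in> A \<union> (B \<union> C)"
    proof cases
      case 1
      hence "1 \<le> a \<and> a \<le> h" using * unfolding h_def by presburger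
      thus ?thesis using 1 by (simp add: q B_def)
    next
      case 2
      hence "1 \<le> a \<and> a \<le> h" "even k" "c = int k div 2" using * unfolding h_def by presburger+
      thus ?thesis by (simp add: q C_def)
    next
      case 3
      hence "1 \<le> c \<and> c \<le> h" unfolding h_def by presburger
      thus ?thesis using * by (simp add: q A_def)
    qed
  next
    fix q assume "q \<in> A \<union> (B \<union> C)"
    moreover obtain a c where q: "q = (a, c)" by (cases q)
    ultimately consider "0 \<le> a" "a < int k" "1 \<le> c" "c \<le> h" | "1 \<le> a" "a \<le> h" "c = 0"
      | "1 \<le> a" "a \<le> h" "even k" "c = int k div 2"
      by (auto simp: A_def B_def C_def split: if_splits)
    thus "q \<in> half_system (int k)"
    proof cases
      case 1
      hence "2 * c < int k" unfolding h_def by presburger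
      thus ?thesis using 1 by (simp add: q half_system_def)
    next
      case 2
      hence "2 * a < int k" unfolding h_def by presburger
      thus ?thesis using 2 by (simp add: q half_system_def)
    next
      case 3
      hence "2 * a < int k" "2 * c = int k" unfolding h_def by presburger+
      thus ?thesis using 3 by (simp add: q half_system_def)
    qed
  qed
  have h: "h < int k" "h \<ge> 0" "even k \<Longrightarrow> h < int k div 2" using assms unfolding h_def by presburger+
  have "A \<inter> (B \<union> C) = {}" "B \<inter> C = {}"
    using h assms by (auto simp: A_def B_def C_def split: if_splits)
  hence sum: "card (A \<union> (B \<union> C)) = card A + (card B + card C)"
    by (subst card_Un_disjoint, simp add: A_def, simp add: B_def C_def, simp, subst card_Un_disjoint)
      (auto simp: B_def C_def)
  have cards: "card A = k * nat h" "card B = nat h" "card C = (if even k then nat h else 0)"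
    by (simp_all add: A_def B_def C_def card_cartesian_product)
  have "k * nat h + (nat h + (if even k then nat h else 0)) = ddeg k"
  proof (cases "even k")
    case True
    then obtain i where i: "k = 2 * i" by (auto elim!: evenE)
    then obtain j where j: "i = Suc j" using assms by (cases i) auto
    have "h = int j" unfolding h_def i j by simp
    thus ?thesis by (simp add: i j ddeg_def power2_eq_square)
  next
    case False
    then obtain i where i: "k = 2 * i + 1" by (auto elim!: oddE)
    have "h = int i" unfolding h_def i by simp
    thus ?thesis by (simp add: i ddeg_def power2_eq_square)
  qed
  thus ?thesis unfolding eq sum cards .
qed

lemma prod_linear_dvd:
  fixes p :: "'a::field poly"
  assumes "finite A" "inj_on f A" "\<And>q. q \<in> A \<Longrightarrow> poly p (f q) = 0"
  shows "(\<Prod>q\<in>A. [:- f q, 1:]) dvd p"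
  using assms
proof (induction A)
  case (insert r A)
  then obtain s where s: "p = (\<Prod>q\<in>A. [:- f q, 1:]) * s" by (auto simp: dvd_def)
  have "(\<Prod>q\<in>A. f r - f q) \<noteq> 0" using insert by (auto simp: inj_on_def)
  moreover have "poly p (f r) = 0" using insert by simp
  ultimately have "poly s (f r) = 0" by (simp add: s poly_prod)
  hence r: "[:- f r, 1:] dvd s" by (simp add: poly_eq_0_iff_dvd)
  have "(\<Prod>q\<in>insert r A. [:- f q, 1:]) = [:- f r, 1:] * (\<Prod>q\<in>A. [:- f q, 1:])"
    by (rule prod.insert) (use insert in auto)
  also have "\<dots> dvd s * (\<Prod>q\<in>A. [:- f q, 1:])"
    by (rule mult_dvd_mono[OF r dvd_refl])
  finally show ?case by (simp only: s mult.commute)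
qed simp

lemma degree_prod_linear: "finite A \<Longrightarrow> degree (\<Prod>q\<in>A. [:- f q, 1:] :: 'a::field poly) = card A"
  by (subst degree_prod_eq_sum_degree) auto

lemma lead_coeff_prod_linear: "lead_coeff (\<Prod>q\<in>A. [:- f q, 1:] :: 'a::field poly) = 1"
  by (simp add: lead_coeff_prod)

lemma poly_eq_prod_linear:
  fixes p :: "'a::field poly"
  assumes "finite A" "inj_on f A" "\<And>q. q \<in> A \<Longrightarrow> poly p (f q) = 0" "degree p = card A" "p \<noteq> 0"
  shows "p = smult (lead_coeff p) (\<Prod>q\<in>A. [:- f q, 1:])"
proof -
  obtain s where s: "p = (\<Prod>q\<in>A. [:- f q, 1:]) * s"
    using prod_linear_dvd[OF assms(1-3)] by (auto simp: dvd_def)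
  have "(\<Prod>q\<in>A. [:- f q, 1:]) \<noteq> 0" "s \<noteq> 0" using s assms(5) by auto
  hence "degree s = 0"
    using assms(4) degree_mult_eq[of "\<Prod>q\<in>A. [:- f q, 1:]" s] degree_prod_linear[OF assms(1), of f] s by simp
  then obtain c where c: "s = [:c:]" by (auto elim: degree_eq_zeroE)
  have "lead_coeff p = lead_coeff (\<Prod>q\<in>A. [:- f q, 1:]) * lead_coeff s"
    by (simp only: s lead_coeff_mult)
  hence lc: "lead_coeff p = c" by (simp only: lead_coeff_prod_linear c) simp
  show ?thesis unfolding lc using s c by simp
qed

context tate
begin

text \<open>The point u = zeta^a q^(c/M) with zeta = exp(2 pi i / M): the first component is half a
  logarithm, and q = T^(8M).\<close>

definition pt :: "int \<Rightarrow> int \<Rightarrow> point" where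
  "pt a c = (of_int a * (of_real pi * \<i>) / of_nat M, 4 * c)"

lemma pt_add: "pt a c + pt a' c' = pt (a + a') (c + c')"
  and pt_diff: "pt a c - pt a' c' = pt (a - a') (c - c')"
  and smul_pt: "smul n (pt a c) = pt (n * a) (n * c)"
  by (simp_all add: pt_def smul_def field_simps diff_divide_distrib add_divide_distrib)

lemma is_zero_pt: "is_zero (pt a c) \<longleftrightarrow> int M dvd a \<and> int M dvd c"
proof -
  have "2 * (of_int a * (of_real pi * \<i>) / of_nat M) = \<i> * of_real (2 * pi * a / M)"
    by simp
  hence e: "exp (2 * fst (pt a c)) = cis (2 * pi * a / M)"
    by (simp only: pt_def fst_conv cis_conv_exp)
  have "cis (2 * pi * a / M) = 1 \<longleftrightarrow> int M dvd a"
  proof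
    assume "cis (2 * pi * a / M) = 1"
    hence "cos (2 * pi * a / M) = 1" by (simp add: complex_eq_iff)
    then obtain n :: int where "2 * pi * a / M = n * 2 * pi" by (auto simp: cos_one_2pi_int)
    hence "real_of_int a = real_of_int (int M * n)" using M_pos by (simp add: field_simps)
    hence "a = int M * n" by (simp only: of_int_eq_iff)
    thus "int M dvd a" by simp
  next
    assume "int M dvd a"
    then obtain n where "a = int M * n" by (elim dvdE)
    hence "2 * pi * a / M = 2 * pi * n" using M_pos by simp
    thus "cis (2 * pi * a / M) = 1" by (simp add: complex_eq_iff cos_int_2pin sin_int_2pin)
  qed
  thus ?thesis by (simp add: is_zero_def e) (auto simp: pt_def)
qed

abbreviation "H \<equiv> half_system (int M)"
definition xr :: "int \<times> int \<Rightarrow> complex fls" where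
  "xr q = x_pt (pt (fst q) (snd q))"

lemma H_not_two_torsion:
  assumes "(a, c) \<in> H"
  shows "\<not> (int M dvd 2 * a \<and> int M dvd 2 * c)"
proof
  assume d: "int M dvd 2 * a \<and> int M dvd 2 * c"
  have "c = 0 \<or> 0 < c" using assms by (auto simp: half_system_def)
  hence "2 * c = 0 \<or> 2 * c = int M"
    using d assms zdvd_imp_le[of "int M" "2 * c"] by (elim disjE) (auto simp: half_system_def)
  hence "0 < a" "2 * a < int M" using assms by (auto simp: half_system_def)
  thus False using d zdvd_imp_le[of "int M" "2 * a"] by auto
qed

lemma H_not_zero: "(a, c) \<in> H \<Longrightarrow> \<not> (int M dvd a \<and> int M dvd c)"
  using H_not_two_torsion[of a c] by auto

text \<open>Distinct representatives are neither equal nor opposite modulo M. Since c + c' is at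
  most M, opposite points would both have height 0 or both height 1/2, where a and a' lie strictly
  between 0 and M/2.\<close>

lemma H_diff:
  assumes "(a, c) \<in> H" "(a', c') \<in> H" "(a, c) \<noteq> (a', c')"
  shows "\<not> (int M dvd a - a' \<and> int M dvd c - c')" "\<not> (int M dvd a + a' \<and> int M dvd c + c')"
proof -
  have z: "z = 0" if "int M dvd z" "\<bar>z\<bar> < int M" for z
    using that by (metis dvd_imp_le_int abs_of_nat not_le)
  show "\<not> (int M dvd a - a' \<and> int M dvd c - c')"
  proof
    assume d: "int M dvd a - a' \<and> int M dvd c - c'"
    have "\<bar>a - a'\<bar> < int M" "\<bar>c - c'\<bar> < int M"
      using assms(1,2) M_pos unfolding abs_less_iff half_system_def by auto
    hence "a - a' = 0" "c - c' = 0" using d z by blast+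
    thus False using assms(3) by simp
  qed
  show "\<not> (int M dvd a + a' \<and> int M dvd c + c')"
  proof
    assume d: "int M dvd a + a' \<and> int M dvd c + c'"
    have "c + c' = 0 \<or> 0 < c + c'" "c + c' \<le> int M" using assms(1,2) by (auto simp: half_system_def)
    hence "c + c' = 0 \<or> c + c' = int M" using d zdvd_imp_le[of "int M" "c + c'"] by auto
    moreover have "0 \<le> c" "0 \<le> c'" "2 * c \<le> int M" "2 * c' \<le> int M" using assms(1,2) by (auto simp: half_system_def)
    ultimately have "(c = 0 \<or> 2 * c = int M) \<and> (c' = 0 \<or> 2 * c' = int M)" by linarith
    hence "0 < a" "2 * a < int M" "0 < a'" "2 * a' < int M" using assms(1,2) unfolding half_system_def mem_Collect_eq case_prod_conv by blast+
    hence "0 < a + a'" "a + a' < int M" by simp_all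
    hence "a + a' = 0" using d by (intro z) auto
    thus False using \<open>0 < a + a'\<close> by simp
  qed
qed

lemma H_range: "(a, c) \<in> H \<Longrightarrow> \<bar>4 * c\<bar> \<le> 4 * int M \<and> \<bar>4 * (c + c)\<bar> \<le> 4 * int M"
  by (auto simp: half_system_def)

lemma theta_H:
  assumes "(a, c) \<in> H"
  shows "T (pt a c) \<noteq> 0" "T (pt a c + pt a c) \<noteq> 0"
proof -
  have *: "T (pt b d) \<noteq> 0" if "\<not> is_zero (pt b d)" "\<bar>4 * d\<bar> \<le> 4 * int M" for b d
  proof -
    obtain z where z: "pt b d = (z, 4 * d)" by (simp add: pt_def)
    show ?thesis using has_val_nonzero[OF theta_has_val[of z "4 * d"]] that unfolding z by blast
  qed
  have nz: "\<not> is_zero (pt a c)" "\<not> is_zero (pt (a + a) (c + c))"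
    using H_not_zero[OF assms] H_not_two_torsion[OF assms] unfolding is_zero_pt mult_2 by blast+
  show "T (pt a c) \<noteq> 0" "T (pt a c + pt a c) \<noteq> 0"
    unfolding pt_add using *[OF nz(1)] *[OF nz(2)] H_range[OF assms] by blast+
qed

lemma xr_diff:
  assumes "(a, c) \<in> H" "(a', c') \<in> H" "(a, c) \<noteq> (a', c')"
  shows "has_val (xr (a, c) - xr (a', c')) (8 * min c c')"
proof -
  obtain z z' where z: "pt a c = (z, 4 * c)" "pt a' c' = (z', 4 * c')" by (simp add: pt_def)
  have s: "(z + z', 4 * c + 4 * c') = pt (a + a') (c + c')" "(z - z', 4 * c - 4 * c') = pt (a - a') (c - c')"
    using z by (simp_all flip: pt_add pt_diff)
  have "has_val (x_pt (z, 4 * c) - x_pt (z', 4 * c')) (2 * min (4 * c) (4 * c'))"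
  proof (rule x_diff_has_val)
    show "\<not> is_zero (z, 4 * c)" "\<not> is_zero (z', 4 * c')"
      "\<not> is_zero (z + z', 4 * c + 4 * c')" "\<not> is_zero (z - z', 4 * c - 4 * c')"
      unfolding s z[symmetric] is_zero_pt using H_not_zero[OF assms(1)] H_not_zero[OF assms(2)] H_diff[OF assms] by auto
  qed (use assms in \<open>auto simp: half_system_def\<close>)
  moreover have "2 * min (4 * c) (4 * c') = 8 * min c c'" by simp
  ultimately show ?thesis by (simp add: xr_def z)
qed

lemma xr_inj: "inj_on xr H"
proof (rule inj_onI, rule ccontr)
  fix q q' assume *: "q \<in> H" "q' \<in> H" "xr q = xr q'" "q \<noteq> q'"
  hence "has_val (xr q - xr q') (8 * min (snd q) (snd q'))"
    using xr_diff[of "fst q" "snd q" "fst q'" "snd q'"] by simp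
  thus False using * by (simp add: has_val_def)
qed

text \<open>Compare with the half period: x + 1 is the sum of x - x(q^(1/2)), of valuation 8c, and
  x(q^(1/2)) + 1, of valuation 4M. The first dominates below height 1/2; at height 1/2 they tie and
  only a bound remains.\<close>

lemma xr_plus_1:
  assumes "(a, c) \<in> H"
  shows "2 * c < int M \<Longrightarrow> has_val (xr (a, c) + 1) (8 * c)"
    and "2 * c = int M \<Longrightarrow> xr (a, c) + 1 = 0 \<or> fls_subdegree (xr (a, c) + 1) \<ge> 4 * int M"
proof -
  obtain z where z: "pt a c = (z, 4 * c)" by (simp add: pt_def)
  have Z: "\<not> is_zero (z', l)" if "l \<noteq> 0" "\<bar>l\<bar> < 4 * int M" for z' l
    using that dvd_imp_le_int[of l "4 * int M"] by (auto simp: is_zero_def)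
  have p: "\<not> is_zero (z, 4 * c)" using H_not_zero[OF assms] unfolding z[symmetric] is_zero_pt .
  have c: "0 \<le> c" "2 * c \<le> int M" using assms by (auto simp: half_system_def)
  have "\<not> is_zero (z + 0, 4 * c + 2 * int M) \<and> \<not> is_zero (z - 0, 4 * c - 2 * int M)"
  proof (cases "2 * c = int M")
    case True
    hence "\<not> int M dvd a" using assms H_not_zero zdvd_not_zless[of a "int M"] by (auto simp: half_system_def)
    moreover have "fst (pt a 0) = z" "snd (pt a 0) = 0" using z by (simp_all add: pt_def)
    ultimately have "exp (2 * z) \<noteq> 1" using is_zero_pt[of a 0] by (simp add: is_zero_def)
    thus ?thesis by (simp add: is_zero_def)
  next
    case False
    hence "2 * c < int M" using c by simp
    thus ?thesis using c M_pos by (intro conjI Z) auto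
  qed
  hence "has_val (x_pt (z, 4 * c) - x_pt (0, 2 * int M)) (2 * min (4 * c) (2 * int M))"
    using c M_pos p Z[of "2 * int M" 0] by (intro x_diff_has_val) auto
  moreover have "2 * min (4 * c) (2 * int M) = 8 * c" using c by simp
  ultimately have d: "has_val (xr (a, c) - x_pt (0, 2 * int M)) (8 * c)" by (simp add: xr_def z)
  have x: "xr (a, c) + 1 = (xr (a, c) - x_pt (0, 2 * int M)) + (x_pt (0, 2 * int M) + 1)" by simp
  show "has_val (xr (a, c) + 1) (8 * c)" if "2 * c < int M"
    unfolding x by (rule has_val_add[OF d]) (use that x_half_period_plus_1 in \<open>auto simp: has_val_def\<close>)
  show "xr (a, c) + 1 = 0 \<or> fls_subdegree (xr (a, c) + 1) \<ge> 4 * int M" if "2 * c = int M"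
  proof (cases "xr (a, c) + 1 = 0")
    case False
    hence "min (fls_subdegree (xr (a, c) - x_pt (0, 2 * int M))) (fls_subdegree (x_pt (0, 2 * int M) + 1))
        \<le> fls_subdegree (xr (a, c) + 1)"
      unfolding x by (rule fls_plus_subdegree)
    thus ?thesis using d x_half_period_plus_1(2) that by (simp add: has_val_def)
  qed simp
qed

definition ord :: "int \<times> int \<Rightarrow> nat" where
  "ord q = M div nat (gcd (gcd (fst q) (snd q)) (int M))"

lemma ord_dvd_iff: "ord q dvd k \<longleftrightarrow> int M dvd int k * fst q \<and> int M dvd int k * snd q"
proof -
  define d where "d = gcd (gcd (fst q) (snd q)) (int M)"
  have d: "d > 0" "d dvd int M" using M_pos by (auto simp: d_def)
  then obtain e where e: "int M = d * e" by (elim dvdE)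
  have "int (M div nat d) = int M div d" using d(1) by (simp add: zdiv_int)
  hence "int (ord q) = e"
    using d(1) unfolding e by (simp add: ord_def flip: d_def)
  hence "ord q dvd k \<longleftrightarrow> d * e dvd d * int k"
    using d(1) by (simp flip: int_dvd_int_iff)
  also have "\<dots> \<longleftrightarrow> int M dvd int k * d" by (simp add: e mult.commute)
  also have "int k * d = gcd (gcd (int k * fst q) (int k * snd q)) (int k * int M)"
    by (simp add: d_def gcd_mult_left)
  finally show ?thesis by simp
qed

lemma ord_dvd_M: "ord q dvd M"
  unfolding ord_dvd_iff by simp

lemma ord_ge_3:
  assumes "q \<in> H"
  shows "ord q \<ge> 3"
proof -
  have "ord q \<noteq> 0" using ord_dvd_M[of q] M_pos by (metis dvd_0_left_iff less_irrefl)
  moreover have nd: "\<not> ord q dvd 2"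
    using H_not_two_torsion[of "fst q" "snd q"] assms unfolding ord_dvd_iff by simp
  moreover have "ord q \<noteq> 1" "ord q \<noteq> 2" using nd by (metis one_dvd, metis dvd_refl)
  ultimately show ?thesis by linarith
qed

definition "torsion k = {q\<in>H. ord q dvd k}"
definition "prim k = {q\<in>H. ord q = k}"

lemma finite_torsion: "finite (torsion k)" and finite_prim: "finite (prim k)"
  by (auto simp: torsion_def prim_def intro: finite_subset[OF _ finite_half_system[of "int M"]])

lemma bij_scale:
  assumes "k dvd M" "k > 0"
  shows "bij_betw (\<lambda>q. (int (M div k) * fst q, int (M div k) * snd q)) (half_system (int k)) (torsion k)"
proof -
  define e where "e = int (M div k)"
  have Me: "int M = e * int k" using assms(1) by (simp add: e_def flip: of_nat_mult)
  have e0: "e > 0" using Me M_pos by (metis e_def mult_eq_0_iff of_nat_0_less_iff of_nat_eq_0_iff gr0I)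
  have k0: "int k \<noteq> 0" using assms by simp
  have mem: "(e * a, e * c) \<in> H \<longleftrightarrow> (a, c) \<in> half_system (int k)" for a c
  proof -
    have 1: "e * a < int M \<longleftrightarrow> a < int k" "2 * (e * a) < int M \<longleftrightarrow> 2 * a < int k"
      "2 * (e * c) \<le> int M \<longleftrightarrow> 2 * c \<le> int k" "2 * (e * c) = int M \<longleftrightarrow> 2 * c = int k"
      unfolding Me using e0 by (simp_all add: mult.left_commute[of 2])
    show ?thesis unfolding half_system_def using e0 by (simp add: 1 zero_le_mult_iff zero_less_mult_iff)
  qed
  have tor: "(a, c) \<in> torsion k \<longleftrightarrow> (a, c) \<in> H \<and> e dvd a \<and> e dvd c" for a c
    unfolding torsion_def ord_dvd_iff Me using k0 by (simp add: mult.commute)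
  show ?thesis unfolding bij_betw_def e_def[symmetric]
  proof
    show "inj_on (\<lambda>q. (e * fst q, e * snd q)) (half_system (int k))"
      using e0 by (auto simp: inj_on_def)
    show "(\<lambda>q. (e * fst q, e * snd q)) ` half_system (int k) = torsion k"
    proof (intro equalityI subsetI)
      fix q assume "q \<in> torsion k"
      moreover obtain a c where q: "q = (a, c)" by (cases q)
      ultimately obtain a' c' where "a = e * a'" "c = e * c'" "(a, c) \<in> H" by (auto simp: tor elim!: dvdE)
      thus "q \<in> (\<lambda>q. (e * fst q, e * snd q)) ` half_system (int k)"
        using mem by (auto simp: q image_iff intro!: bexI[of _ "(a', c')"])
    qed (use mem tor in auto)
  qed
qed

lemma card_torsion: "k dvd M \<Longrightarrow> k > 0 \<Longrightarrow> card (torsion k) = ddeg k"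
  using bij_betw_same_card[OF bij_scale] card_half_system by metis

lemma fpol_root:
  assumes "q \<in> torsion k" "k > 0"
  shows "poly (emb.mp (fpol k)) (xr q) = 0"
proof -
  obtain a c where q: "q = (a, c)" by (cases q)
  have H: "(a, c) \<in> H" using assms by (simp add: q torsion_def)
  note t = theta_H[OF H]
  have "is_zero (smul (int k) (pt a c))"
    using assms ord_dvd_iff[of q k] by (simp add: smul_pt is_zero_pt torsion_def q)
  hence "W (int k) (pt a c) = 0" by (simp add: W_def theta_zero)
  moreover have "W 2 (pt a c) \<noteq> 0" by (rule W_initial(4)[OF t])
  ultimately show ?thesis using fpol_theta[OF t assms(2)] by (simp add: q xr_def split: if_splits)
qed

lemma inj_xr_torsion: "inj_on xr (torsion k)"
  by (rule inj_on_subset[OF xr_inj]) (auto simp: torsion_def)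

text \<open>The torsion representatives supply as many distinct roots as the degree, so there are no
  others and all are simple.\<close>

lemma fpol_factorization:
  assumes "k dvd M" "k > 0"
  shows "emb.mp (fpol k) = smult (of_nat k) (\<Prod>q\<in>torsion k. [:- xr q, 1:])"
proof -
  have "fpol k \<noteq> 0" using lead_coeff_fpol[OF assms(2)] assms(2) by auto
  have "emb.mp (fpol k) = smult (lead_coeff (emb.mp (fpol k))) (\<Prod>q\<in>torsion k. [:- xr q, 1:])"
    by (rule poly_eq_prod_linear)
      (use assms finite_torsion inj_xr_torsion fpol_root \<open>fpol k \<noteq> 0\<close> in \<open>auto simp: degree_fpol card_torsion\<close>)
  also have "lead_coeff (emb.mp (fpol k)) = of_nat k"
    using lead_coeff_fpol[OF assms(2)] by (simp add: emb.of_nat)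
  finally show ?thesis .
qed

lemma torsion_eq: "k > 0 \<Longrightarrow> torsion k = (\<Union>d\<in>{d. d dvd k \<and> 3 \<le> d}. prim d)"
  using ord_ge_3 by (auto simp: torsion_def prim_def)

lemma prim_disjoint: "d \<noteq> d' \<Longrightarrow> prim d \<inter> prim d' = {}"
  by (auto simp: prim_def)

lemma prim_div_pol_1: "prim_div_pol 1 = 1"
proof -
  have "{d. d dvd 1 \<and> 0 < d \<and> d < (1::nat)} = {}" by auto
  thus ?thesis by (subst prim_div_pol.simps) (simp only: prod.empty, simp add: div_pol_eq fpol_def of_poly_hom)
qed

lemma prim_div_pol_2: "prim_div_pol 2 = 2 * cf_y"
proof -
  have "{d. d dvd 2 \<and> 0 < d \<and> d < (2::nat)} = {1}" by (auto dest: dvd_imp_le)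
  thus ?thesis using prim_div_pol_1
    by (subst prim_div_pol.simps) (simp add: div_pol_eq fpol_def of_poly_hom)
qed

text \<open>Only the valuation 0 of the leading constant is tracked, since nothing else about it
  affects valuations. The divisors 1 and 2 are set apart because q_2 = 2y is not a polynomial in
  x.\<close>

lemma prim_div_pol_poly:
  "k \<ge> 3 \<Longrightarrow> k dvd M \<Longrightarrow> \<exists>P lc. prim_div_pol k = of_poly P \<and> has_val lc 0 \<and>
     emb.mp P = smult lc (\<Prod>q\<in>prim k. [:- xr q, 1:])"
proof (induction k rule: less_induct)
  case (less k)
  define S where "S = {d. d dvd k \<and> 3 \<le> d \<and> d < k}"
  have k0: "k > 0" using less by simp
  have finS: "finite S" using k0 by (auto simp: S_def)
  have "\<forall>d\<in>S. \<exists>P lc. prim_div_pol d = of_poly P \<and> has_val lc 0 \<and> emb.mp P = smult lc (\<Prod>q\<in>prim d. [:- xr q, 1:])"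
    using less by (auto simp: S_def intro: dvd_trans)
  then obtain P lc where P: "\<And>d. d \<in> S \<Longrightarrow> prim_div_pol d = of_poly (P d)"
    "\<And>d. d \<in> S \<Longrightarrow> has_val (lc d) 0" "\<And>d. d \<in> S \<Longrightarrow> emb.mp (P d) = smult (lc d) (\<Prod>q\<in>prim d. [:- xr q, 1:])"
    by metis
  define R where "R = (\<Prod>d\<in>S. P d)"
  define L where "L = (\<Prod>d\<in>S. lc d)"
  have L: "has_val L 0" unfolding L_def using finS P(2)
  proof (induction S)
    case (insert x F)
    thus ?case using has_val_mult[of "lc x" 0 "prod lc F" 0] by simp
  qed (simp add: has_val_def)
  have div: "{d. d dvd k \<and> 0 < d \<and> d < k} = S \<union> ({1} \<union> (if even k then {2} else {}))"
  proof (intro equalityI subsetI)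
    fix d assume d: "d \<in> {d. d dvd k \<and> 0 < d \<and> d < k}"
    hence "d = 1 \<or> d = 2 \<or> 3 \<le> d" by auto
    thus "d \<in> S \<union> ({1} \<union> (if even k then {2} else {}))" using d by (auto simp: S_def)
  next
    fix d assume "d \<in> S \<union> ({1} \<union> (if even k then {2} else {}))"
    thus "d \<in> {d. d dvd k \<and> 0 < d \<and> d < k}" using less(2) by (auto simp: S_def split: if_splits)
  qed
  have prod: "(\<Prod>d\<in>{d. d dvd k \<and> 0 < d \<and> d < k}. prim_div_pol d) = of_poly R * (if even k then 2 * cf_y else 1)"
  proof -
    have "S \<inter> ({1} \<union> (if even k then {2} else {})) = {}" by (auto simp: S_def)
    hence "(\<Prod>d\<in>{d. d dvd k \<and> 0 < d \<and> d < k}. prim_div_pol d) =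
      (\<Prod>d\<in>S. prim_div_pol d) * (\<Prod>d\<in>{1} \<union> (if even k then {2} else {}). prim_div_pol d)"
      unfolding div using finS by (intro prod.union_disjoint) auto
    also have "(\<Prod>d\<in>{1} \<union> (if even k then {2} else {}). prim_div_pol d) = (if even k then 2 * cf_y else 1)"
      using prim_div_pol_1 prim_div_pol_2 by auto
    also have "(\<Prod>d\<in>S. prim_div_pol d) = of_poly R"
      unfolding R_def using finS P(1)
      by (induction S) (simp_all add: of_poly_hom)
    finally show ?thesis .
  qed
  have tor: "torsion k = prim k \<union> (\<Union>d\<in>S. prim d)"
  proof -
    have "{d. d dvd k \<and> 3 \<le> d} = insert k S"
      using less(2) k0 dvd_imp_le[of _ k] by (auto simp: S_def nat_less_le)
    thus ?thesis unfolding torsion_eq[OF k0] by simp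
  qed
  have "emb.mp R = (\<Prod>d\<in>S. smult (lc d) (\<Prod>q\<in>prim d. [:- xr q, 1:]))"
    unfolding R_def emb.mp_prod by (rule prod.cong) (use P(3) in auto)
  also have "\<dots> = smult L (\<Prod>d\<in>S. \<Prod>q\<in>prim d. [:- xr q, 1:])"
    by (simp add: prod_smult L_def)
  also have "(\<Prod>d\<in>S. \<Prod>q\<in>prim d. [:- xr q, 1:]) = (\<Prod>q\<in>(\<Union>d\<in>S. prim d). [:- xr q, 1:])"
    by (rule prod.UNION_disjoint[symmetric]) (use finS finite_prim prim_disjoint in auto)
  finally have mpR: "emb.mp R = smult L (\<Prod>q\<in>(\<Union>d\<in>S. prim d). [:- xr q, 1:])" .
  have "prim k \<inter> (\<Union>d\<in>S. prim d) = {}" by (auto simp: S_def prim_def)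
  hence "(\<Prod>q\<in>torsion k. [:- xr q, 1:]) = (\<Prod>q\<in>prim k. [:- xr q, 1:]) * (\<Prod>q\<in>(\<Union>d\<in>S. prim d). [:- xr q, 1:])"
    unfolding tor using finS finite_prim by (intro prod.union_disjoint) auto
  hence fk: "emb.mp (fpol k) = smult (of_nat k / L) (\<Prod>q\<in>prim k. [:- xr q, 1:]) * emb.mp R"
    using L unfolding fpol_factorization[OF less(3) k0] mpR by (simp add: has_val_def)
  \<comment> \<open>The factorization holds over Laurent series; divisibility descends to Q(j), so
    that the quotient has coefficients there.\<close>
  hence "R dvd fpol k" by (metis emb.mp_dvd_iff dvd_triv_right)
  then obtain Q where Q: "fpol k = R * Q" by (elim dvdE)
  have R0: "R \<noteq> 0" using Q lead_coeff_fpol[OF k0] k0 by auto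
  have "emb.mp Q * emb.mp R = smult (of_nat k / L) (\<Prod>q\<in>prim k. [:- xr q, 1:]) * emb.mp R"
    using fk by (simp only: Q emb.mp_mult mult.commute)
  hence mpQ: "emb.mp Q = smult (of_nat k / L) (\<Prod>q\<in>prim k. [:- xr q, 1:])"
    using R0 by (simp only: mult_cancel_right emb.mp_eq_0_iff) simp
  have lc: "has_val (of_nat k / L) 0" using has_val_divide[OF has_val_of_nat L, of k] k0 by simp
  have pk: "prim_div_pol k = of_poly (R * Q) * (if even k then cf_y else 1) / (of_poly R * (if even k then 2 * cf_y else 1))"
    by (subst prim_div_pol.simps) (simp only: prod div_pol_eq[OF k0] Q)
  have oR: "of_poly R \<noteq> 0" using R0 by (simp add: of_poly_hom)
  show ?case
  proof (cases "even k")
    case False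
    hence "prim_div_pol k = of_poly Q" using pk oR by (simp add: of_poly_hom)
    thus ?thesis using mpQ lc by blast
  next
    case True
    have h: "of_poly [:1 / 2:] * 2 = 1"
    proof -
      have "of_poly [:1 / 2:] * 2 = of_poly ([:1 / 2:] * 2)" by (simp only: of_poly_hom)
      also have "[:1 / 2 :: Qj:] * 2 = 1" by (simp add: numeral_poly one_pCons)
      finally show ?thesis by (simp add: of_poly_hom)
    qed
    have "prim_div_pol k = of_poly Q / 2"
      using pk oR True cf_y_nonzero curve_fun_two by (simp add: of_poly_hom(3) field_simps)
    also have "\<dots> = of_poly ([:1 / 2:] * Q)"
      using h curve_fun_two by (simp only: of_poly_hom(3)) (simp add: field_simps)
    finally have "prim_div_pol k = of_poly ([:1 / 2:] * Q)" .
    moreover have "emb.mp ([:1 / 2:] * Q) = smult (1 / 2 * (of_nat k / L)) (\<Prod>q\<in>prim k. [:- xr q, 1:])"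
      by (simp only: emb.mp_mult mpQ) (simp add: emb.mp_pCons emb.divide emb.numeral mult.commute)
    moreover have "has_val (1 / 2 * (of_nat k / L)) 0"
      using has_val_mult[OF has_val_divide[OF has_val_of_nat[of 1] has_val_numeral[of "num.Bit0 num.One"]] lc] by simp
    ultimately show ?thesis by blast
  qed
qed

end

section \<open>The group law and the number of points of exact order k\<close>

section \<open>Multiples of a point on the curve\<close>

lemma ec_mult_0: "ec_mult a 0 P = Infinity"
  and ec_mult_Suc: "ec_mult a (Suc n) P = ec_add a P (ec_mult a n P)"
  by (simp_all add: ec_mult_def)

text \<open>
  Only the Somos-4 relation of the division polynomials enters the addition law: it makes
  \<open>(\<psi>\<^sub>m\<^sub>+\<^sub>2 \<psi>\<^sub>m\<^sub>-\<^sub>1\<^sup>2 + \<psi>\<^sub>m\<^sub>-\<^sub>2 \<psi>\<^sub>m\<^sub>+\<^sub>1\<^sup>2 + \<psi>\<^sub>2\<^sup>2 \<psi>\<^sub>m\<^sup>3) / (\<psi>\<^sub>m\<^sub>+\<^sub>1 \<psi>\<^sub>m \<psi>\<^sub>m\<^sub>-\<^sub>1)\<close> independent of \<open>m\<close>.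
\<close>

locale somos_point =
  fixes a b x y :: "'a::field" and psi :: "nat \<Rightarrow> 'a"
  assumes two: "2 \<noteq> (0::'a)" and y: "y \<noteq> 0" "y ^ 2 = x ^ 3 + a * x + b"
    and psi: "psi 0 = 0" "psi 1 = 1" "psi 2 = 2 * y" "psi 3 = QQ3 a b x" "psi 4 = 4 * y * QQ4 a b x"
    and somos: "m \<ge> 2 \<Longrightarrow> psi (m + 2) * psi (m - 2) = psi 2 ^ 2 * psi (m + 1) * psi (m - 1) - psi 3 * psi m ^ 2"
begin

text \<open>The numerator of the tangent slope at the point; \<open>lam / psi 2\<close> is the slope
  itself.\<close>

definition "lam = 3 * x ^ 2 + a"

lemma psi_2_sq: "psi 2 ^ 2 = 4 * (x ^ 3 + a * x + b)"
  using y(2) by (simp add: psi power_mult_distrib)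

lemma lam_sq: "lam ^ 2 + psi 3 = 3 * x * psi 2 ^ 2"
  unfolding psi_2_sq unfolding psi(4) QQ3_def lam_def by (simp add: eval_nat_numeral algebra_simps)

lemma lam_initial: "psi 4 + psi 2 ^ 5 = 2 * lam * psi 3 * psi 2"
proof -
  have "psi 2 ^ 5 = psi 2 * (psi 2 ^ 2) ^ 2" by (simp add: eval_nat_numeral)
  also have "\<dots> = 2 * y * (16 * (x ^ 3 + a * x + b) ^ 2)"
  proof -
    have "(4 * u) ^ 2 = 16 * u ^ 2" for u :: 'a by (simp add: power_mult_distrib)
    thus ?thesis unfolding psi_2_sq by (simp only: psi mult.assoc)
  qed
  finally have "psi 4 + psi 2 ^ 5 = 2 * y * (2 * QQ4 a b x) + 2 * y * (16 * (x ^ 3 + a * x + b) ^ 2)"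
    unfolding psi(5) by simp
  also have "\<dots> = 2 * y * (2 * QQ4 a b x + 16 * (x ^ 3 + a * x + b) ^ 2)"
    by (simp only: distrib_left)
  also have "2 * QQ4 a b x + 16 * (x ^ 3 + a * x + b) ^ 2 = 2 * lam * QQ3 a b x"
    unfolding QQ4_def QQ3_def lam_def by (simp add: eval_nat_numeral algebra_simps)
  finally show ?thesis by (simp add: psi)
qed

lemma invariant:
  assumes "m \<ge> 2" "\<And>d. 0 < d \<Longrightarrow> d < m \<Longrightarrow> psi d \<noteq> 0"
  shows "psi (m + 2) * psi (m - 1) ^ 2 + psi (m - 2) * psi (m + 1) ^ 2 + psi 2 ^ 2 * psi m ^ 3 =
    2 * lam * psi (m + 1) * psi m * psi (m - 1)"
  using assms
proof (induction m rule: dec_induct)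
  case base
  have "psi (2 - 1) = 1" "psi (2 - 2) = 0" "psi (2 + 2) = psi 4" "psi (2 + 1) = psi 3"
    using psi(1,2) by simp_all
  moreover have "psi 2 ^ 2 * psi 2 ^ 3 = psi 2 ^ 5" by (simp flip: power_add)
  ultimately show ?case using lam_initial by simp
next
  case (step m)
  have 1: "psi (m + 2) * psi (m - 2) = psi 2 ^ 2 * psi (m + 1) * psi (m - 1) - psi 3 * psi m ^ 2"
    by (rule somos) (use step in simp)
  have 2: "psi (m + 3) * psi (m - 1) = psi 2 ^ 2 * psi (m + 2) * psi m - psi 3 * psi (m + 1) ^ 2"
    using somos[of "m + 1"] step by (simp add: eval_nat_numeral)
  have IH: "psi (m + 2) * psi (m - 1) ^ 2 + psi (m - 2) * psi (m + 1) ^ 2 + psi 2 ^ 2 * psi m ^ 3 =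
    2 * lam * psi (m + 1) * psi m * psi (m - 1)" using step by simp
  \<comment> \<open>Multiplication by \<open>psi (m - 1)\<close> makes two consecutive Somos
    relations applicable; afterwards this nonzero factor cancels.\<close>
  have "psi (m - 1) * (psi (m + 3) * psi m ^ 2 + psi (m - 1) * psi (m + 2) ^ 2 + psi 2 ^ 2 * psi (m + 1) ^ 3) =
    (psi (m + 3) * psi (m - 1)) * psi m ^ 2 + psi (m - 1) ^ 2 * psi (m + 2) ^ 2 + psi 2 ^ 2 * psi (m - 1) * psi (m + 1) ^ 3"
    by (simp add: power2_eq_square algebra_simps)
  also have "\<dots> = psi (m + 2) * (psi (m + 2) * psi (m - 1) ^ 2 + psi 2 ^ 2 * psi m ^ 3) +
      psi (m + 1) ^ 2 * (psi 2 ^ 2 * psi (m + 1) * psi (m - 1) - psi 3 * psi m ^ 2)"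
    unfolding 2 by (simp add: power2_eq_square power3_eq_cube algebra_simps)
  also have "\<dots> = psi (m + 2) * (psi (m + 2) * psi (m - 1) ^ 2 + psi (m - 2) * psi (m + 1) ^ 2 + psi 2 ^ 2 * psi m ^ 3)"
    unfolding 1[symmetric] by (simp add: power2_eq_square algebra_simps)
  also have "\<dots> = psi (m - 1) * (2 * lam * psi (m + 2) * psi (m + 1) * psi m)"
    unfolding IH by (simp add: algebra_simps)
  finally have "psi (m + 3) * psi m ^ 2 + psi (m - 1) * psi (m + 2) ^ 2 + psi 2 ^ 2 * psi (m + 1) ^ 3 =
      2 * lam * psi (m + 2) * psi (m + 1) * psi m"
    using step by (simp only: mult_cancel_left) auto
  thus ?case by (simp add: eval_nat_numeral)
qed

text \<open>The classical coordinates of the m-th multiple; \<open>2 * psi 2\<close> is 4y.\<close>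

definition "mx m = x - psi (m + 1) * psi (m - 1) / psi m ^ 2"
definition "my m = (psi (m + 2) * psi (m - 1) ^ 2 - psi (m - 2) * psi (m + 1) ^ 2) / (2 * psi 2 * psi m ^ 3)"

lemma ec_mult_2: "ec_mult a 2 (Affine x y) = Affine (mx 2) (my 2)"
proof -
  have ny: "y \<noteq> - y" using two y by (metis add_cancel_right_left eq_neg_iff_add_eq_0 mult_2 mult_eq_0_iff)
  define l where "l = (3 * x ^ 2 + a) / (2 * y)"
  have m: "ec_mult a 2 (Affine x y) = Affine (l ^ 2 - x - x) (l * (x - (l ^ 2 - x - x)) - y)"
    using ny by (simp add: ec_mult_Suc ec_mult_0 numeral_2_eq_2 l_def Let_def)
  have p2: "psi 2 \<noteq> 0" using two y by (simp add: psi)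
  have l: "l = lam / psi 2"
    by (simp add: l_def lam_def psi)
  have "l ^ 2 = 3 * x - psi 3 / psi 2 ^ 2"
    unfolding l using lam_sq p2 by (simp add: power_divide eq_diff_eq divide_simps)
  hence x2: "l ^ 2 - x - x = mx 2" by (simp add: mx_def psi(2)[unfolded One_nat_def])
  have "l * (x - mx 2) - y = lam / psi 2 * (psi 3 / psi 2 ^ 2) - psi 2 / 2"
    using two by (simp add: l mx_def psi(2)[unfolded One_nat_def] psi(3))
  also have "\<dots> = (2 * lam * psi 3 * psi 2 - psi 2 ^ 5) / (2 * psi 2 ^ 4)"
    using p2 two by (simp add: divide_simps) (simp add: eval_nat_numeral algebra_simps)
  also have "\<dots> = psi 4 / (2 * psi 2 ^ 4)"
    unfolding lam_initial[symmetric] by simp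
  also have "\<dots> = my 2"
  proof -
    have "psi 2 * psi 2 ^ 3 = psi 2 ^ 4" by (simp add: eval_nat_numeral)
    thus ?thesis by (simp add: my_def psi(1) psi(2)[unfolded One_nat_def] mult.assoc)
  qed
  finally show ?thesis unfolding m x2 by simp
qed

text \<open>If \<open>psi (m + 1)\<close> vanishes, the invariant gives \<open>my m = -y\<close> and
  the chord is vertical. Otherwise the invariant simplifies the chord slope and the Somos relation
  its square.\<close>

lemma ec_mult_step:
  assumes "m \<ge> 2" "\<And>d. 0 < d \<Longrightarrow> d \<le> m \<Longrightarrow> psi d \<noteq> 0"
  shows "ec_add a (Affine x y) (Affine (mx m) (my m)) =
    (if psi (m + 1) = 0 then Infinity else Affine (mx (m + 1)) (my (m + 1)))"
proof -
  define A B C D Z p2 where "A = psi (m - 1)" "B = psi m" "C = psi (m + 1)" "D = psi (m + 2)" "Z = psi (m - 2)" "p2 = psi 2"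
  note defs = this
  have nz: "A \<noteq> 0" "B \<noteq> 0" "p2 \<noteq> 0" using assms by (auto simp: defs)
  have inv: "D * A ^ 2 + Z * C ^ 2 + p2 ^ 2 * B ^ 3 = 2 * lam * C * B * A"
    using invariant[of m] assms by (simp add: defs)
  have som: "D * Z = p2 ^ 2 * C * A - psi 3 * B ^ 2"
    using somos[of m] assms by (simp add: defs)
  have X: "mx m = x - C * A / B ^ 2" and Y: "my m = (D * A ^ 2 - Z * C ^ 2) / (2 * p2 * B ^ 3)"
    by (simp_all add: mx_def my_def defs)
  have y2: "y = p2 / 2" using two by (simp add: defs psi)
  show ?thesis
  proof (cases "C = 0")
    case True
    have "D * A ^ 2 = - (p2 ^ 2 * B ^ 3)" using inv True by (simp add: eq_neg_iff_add_eq_0)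
    hence "my m = - (p2 ^ 2 * B ^ 3) / (2 * p2 * B ^ 3)" unfolding Y using True by simp
    also have "\<dots> = - y" using nz two by (simp add: y2 power2_eq_square)
    finally have "y = - my m" by simp
    thus ?thesis using True by (simp add: X defs)
  next
    case False
    have xne: "x \<noteq> mx m" using False nz by (simp add: X)
    define l where "l = (my m - y) / (mx m - x)"
    \<comment> \<open>The invariant removes Z from the numerator of the slope, after which the
      division by C A becomes exact.\<close>
    have l: "l = lam / p2 - D * A / (p2 * B * C)"
    proof -
      have "my m - y = (D * A ^ 2 - Z * C ^ 2 - p2 ^ 2 * B ^ 3) / (2 * p2 * B ^ 3)"
      proof -
        have "y = (p2 ^ 2 * B ^ 3) / (2 * p2 * B ^ 3)" using nz two by (simp add: y2 power2_eq_square)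
        thus ?thesis unfolding Y by (simp add: diff_divide_distrib)
      qed
      also have "D * A ^ 2 - Z * C ^ 2 - p2 ^ 2 * B ^ 3 = 2 * D * A ^ 2 - 2 * lam * C * B * A"
        unfolding inv[symmetric] by simp
      finally have "my m - y = (2 * D * A ^ 2 - 2 * lam * C * B * A) / (2 * p2 * B ^ 3)" .
      moreover have "mx m - x = - (C * A / B ^ 2)" by (simp add: X)
      ultimately have "l = (2 * D * A ^ 2 - 2 * lam * C * B * A) / (2 * p2 * B ^ 3) / (- (C * A / B ^ 2))"
        by (simp add: l_def)
      also have "\<dots> = lam / p2 - D * A / (p2 * B * C)"
        using nz two False by (simp add: divide_simps) (simp add: eval_nat_numeral algebra_simps)
      finally show ?thesis .
    qed
    have "l ^ 2 = 3 * x - C * A / B ^ 2 - D * B / C ^ 2"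
    proof -
      have lp: "l * (p2 * B * C) = lam * B * C - D * A"
        unfolding l using nz False by (simp add: left_diff_distrib)
      have inv': "D * (2 * lam) * C * B * A = D * (D * A ^ 2 + Z * C ^ 2 + p2 ^ 2 * B ^ 3)"
        unfolding inv by simp
      have "l ^ 2 * (p2 * B * C) ^ 2 = (lam * B * C - D * A) ^ 2"
        unfolding lp[symmetric] by (simp add: power_mult_distrib)
      also have "\<dots> = lam ^ 2 * B ^ 2 * C ^ 2 - D * (2 * lam) * C * B * A + D ^ 2 * A ^ 2"
        by (simp add: power2_eq_square algebra_simps)
      also have "\<dots> = lam ^ 2 * B ^ 2 * C ^ 2 - (D * Z) * C ^ 2 - p2 ^ 2 * D * B ^ 3"
        unfolding inv' by (simp add: power2_eq_square algebra_simps)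
      also have "\<dots> = (lam ^ 2 + psi 3) * B ^ 2 * C ^ 2 - p2 ^ 2 * C ^ 3 * A - p2 ^ 2 * D * B ^ 3"
        unfolding som by (simp add: power2_eq_square power3_eq_cube algebra_simps)
      also have "\<dots> = (3 * x - C * A / B ^ 2 - D * B / C ^ 2) * (p2 * B * C) ^ 2"
        unfolding lam_sq defs(6)[symmetric] using nz False by (simp add: field_simps power2_eq_square power3_eq_cube)
      finally show ?thesis using nz False by simp
    qed
    hence x3: "l ^ 2 - x - mx m = mx (m + 1)"
      by (simp add: X) (simp add: mx_def defs eval_nat_numeral)
    have inv2: "psi (m + 3) * B ^ 2 + A * D ^ 2 + p2 ^ 2 * C ^ 3 = 2 * lam * D * C * B"
    proof -
      have "d = m \<or> d < m" if "d < m + 1" for d using that by auto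
      thus ?thesis
        using invariant[of "m + 1"] assms by (simp add: defs eval_nat_numeral)
    qed
    have "l * (x - mx (m + 1)) - y = (lam / p2 - D * A / (p2 * B * C)) * (D * B / C ^ 2) - p2 / 2"
      by (simp add: l mx_def y2 defs eval_nat_numeral)
    also have "\<dots> = (2 * lam * D * C * B - 2 * D ^ 2 * A - p2 ^ 2 * C ^ 3) / (2 * p2 * C ^ 3)"
      using nz False two by (simp add: divide_simps) (simp add: eval_nat_numeral algebra_simps)
    also have "2 * lam * D * C * B - 2 * D ^ 2 * A - p2 ^ 2 * C ^ 3 = psi (m + 3) * B ^ 2 - A * D ^ 2"
      unfolding inv2[symmetric] by simp
    also have "\<dots> / (2 * p2 * C ^ 3) = my (m + 1)"
      by (simp add: my_def defs eval_nat_numeral)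
    finally have y3: "l * (x - mx (m + 1)) - y = my (m + 1)" .
    have "ec_add a (Affine x y) (Affine (mx m) (my m)) =
        Affine (l ^ 2 - x - mx m) (l * (x - (l ^ 2 - x - mx m)) - y)"
      using xne by (simp add: l_def Let_def)
    thus ?thesis using False unfolding x3 y3 by (simp add: defs(3))
  qed
qed

lemma ec_mult_affine:
  assumes "m \<ge> 2" "\<And>d. 0 < d \<Longrightarrow> d \<le> m \<Longrightarrow> psi d \<noteq> 0"
  shows "ec_mult a m (Affine x y) = Affine (mx m) (my m)"
  using assms
proof (induction m rule: dec_induct)
  case base
  show ?case by (rule ec_mult_2)
next
  case (step m)
  thus ?case using ec_mult_step[of m] by (simp add: ec_mult_Suc)
qed

lemma ec_mult_not_infinity:
  assumes "m > 0" "\<And>d. 0 < d \<Longrightarrow> d \<le> m \<Longrightarrow> psi d \<noteq> 0"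
  shows "ec_mult a m (Affine x y) \<noteq> Infinity"
proof (cases "m = 1")
  case True
  thus ?thesis by (simp add: ec_mult_Suc ec_mult_0)
next
  case False
  thus ?thesis using ec_mult_affine[of m] assms by simp
qed

lemma ec_mult_infinity:
  assumes "m > 0" "psi m = 0" "\<And>d. 0 < d \<Longrightarrow> d < m \<Longrightarrow> psi d \<noteq> 0"
  shows "ec_mult a m (Affine x y) = Infinity"
proof -
  have "psi 1 \<noteq> 0" "psi 2 \<noteq> 0" unfolding psi(2,3) using two y by simp_all
  hence "m \<noteq> 1" "m \<noteq> 2" using assms(2) by auto
  then obtain n where n: "m = Suc n" "n \<ge> 2" using assms(1) by (cases m) auto
  show ?thesis unfolding n(1) ec_mult_Suc
    using ec_mult_affine[of n] ec_mult_step[of n] n assms by simp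
qed

text \<open>The coordinate formulas hold up to the first zero of \<open>psi\<close>, and exact order
  asks for no more: the first multiple at infinity is the first zero.\<close>

lemma exact_order_iff:
  "exact_order a k (Affine x y) \<longleftrightarrow> k > 0 \<and> psi k = 0 \<and> (\<forall>d. 0 < d \<and> d < k \<longrightarrow> psi d \<noteq> 0)"
proof
  assume *: "exact_order a k (Affine x y)"
  hence k: "k > 0" "ec_mult a k (Affine x y) = Infinity"
    "\<And>d. 0 < d \<Longrightarrow> d < k \<Longrightarrow> ec_mult a d (Affine x y) \<noteq> Infinity"
    by (auto simp: exact_order_def)
  have "\<exists>d. 0 < d \<and> d \<le> k \<and> psi d = 0" using ec_mult_not_infinity k by blast
  define e where "e = (LEAST d. 0 < d \<and> d \<le> k \<and> psi d = 0)"
  have e: "0 < e" "e \<le> k" "psi e = 0" using LeastI_ex[OF \<open>\<exists>d. _\<close>] by (auto simp: e_def)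
  have min: "psi d \<noteq> 0" if "0 < d" "d < e" for d
    using not_less_Least[of d "\<lambda>d. 0 < d \<and> d \<le> k \<and> psi d = 0"] that e(2) by (auto simp: e_def)
  have "ec_mult a e (Affine x y) = Infinity" using ec_mult_infinity e min by blast
  hence "e = k" using k(3) e by (metis le_neq_implies_less)
  thus "k > 0 \<and> psi k = 0 \<and> (\<forall>d. 0 < d \<and> d < k \<longrightarrow> psi d \<noteq> 0)" using e min by blast
next
  assume "k > 0 \<and> psi k = 0 \<and> (\<forall>d. 0 < d \<and> d < k \<longrightarrow> psi d \<noteq> 0)"
  thus "exact_order a k (Affine x y)"
    unfolding exact_order_def using ec_mult_infinity ec_mult_not_infinity by (meson le_less_trans)
qed

end

lemma exact_order_two_torsion:
  assumes "k \<ge> 3" "exact_order a k (Affine x y)"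
  shows "y \<noteq> - y"
proof
  assume "y = - y"
  hence "ec_mult a 2 (Affine x y) = Infinity"
    by (simp add: ec_mult_Suc ec_mult_0 numeral_2_eq_2)
  thus False using assms by (auto simp: exact_order_def)
qed

section \<open>The number of points of exact order k\<close>

lemma dvd_prod_linear_root:
  fixes p :: "'a::field poly"
  assumes "finite A" "inj_on f A" "p dvd (\<Prod>q\<in>A. [:- f q, 1:])" "degree p > 0"
  obtains q where "q \<in> A" "poly p (f q) = 0"
proof -
  obtain h where h: "(\<Prod>q\<in>A. [:- f q, 1:]) = p * h" using assms(3) by (elim dvdE)
  have nz: "(\<Prod>q\<in>A. [:- f q, 1:]) \<noteq> 0" using assms(1) by simp
  have "\<exists>q\<in>A. poly p (f q) = 0"
  proof (rule ccontr)
    assume no: "\<not> ?thesis"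
    have "poly h (f q) = 0" if "q \<in> A" for q
    proof -
      have "poly (\<Prod>q\<in>A. [:- f q, 1:]) (f q) = 0" using assms(1) that by (auto simp: poly_prod)
      thus ?thesis using no that by (simp add: h)
    qed
    hence "(\<Prod>q\<in>A. [:- f q, 1:]) dvd h" by (intro prod_linear_dvd assms)
    moreover have "h \<noteq> 0" "p \<noteq> 0" using nz h by auto
    ultimately have "degree (p * h) \<le> degree h" unfolding h using dvd_imp_degree_le by blast
    thus False using assms(4) \<open>h \<noteq> 0\<close> \<open>p \<noteq> 0\<close> by (simp add: degree_mult_eq)
  qed
  thus ?thesis using that by blast
qed

text \<open>A nonzero combination of least degree divides both polynomials by division with
  remainder, hence is constant.\<close>

lemma poly_bezout:
  fixes p q :: "'a::field poly"
  assumes "p \<noteq> 0" "\<And>d. d dvd p \<Longrightarrow> d dvd q \<Longrightarrow> degree d = 0"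
  obtains u v where "u * p + v * q = 1"
proof -
  define I where "I = {u * p + v * q | u v. u * p + v * q \<noteq> 0}"
  have "1 * p + 0 * q \<in> I" unfolding I_def using assms(1) by (intro CollectI exI[of _ 1] exI[of _ 0]) auto
  then obtain d where d: "d \<in> I" "\<And>e. e \<in> I \<Longrightarrow> degree d \<le> degree e"
    using ex_has_least_nat[of "\<lambda>e. e \<in> I" _ degree] by blast
  then obtain u v where uv: "d = u * p + v * q" "d \<noteq> 0" by (auto simp: I_def)
  have dvd: "d dvd r * p + s * q" for r s
  proof -
    define m where "m = (r * p + s * q) mod d"
    have "m = r * p + s * q - ((r * p + s * q) div d) * d"
      by (simp add: m_def minus_div_mult_eq_mod)
    also have "\<dots> = (r - ((r * p + s * q) div d) * u) * p + (s - ((r * p + s * q) div d) * v) * q"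
      unfolding uv(1) by (simp add: algebra_simps)
    finally have m: "m = 0 \<or> m \<in> I" unfolding I_def by blast
    have "m = 0 \<or> degree m < degree d" unfolding m_def by (rule degree_mod_less[OF uv(2)])
    hence "m = 0" using m d(2) by force
    thus ?thesis by (simp add: m_def mod_eq_0_iff_dvd)
  qed
  have "degree d = 0" using dvd[of 1 0] dvd[of 0 1] by (intro assms(2)) auto
  then obtain c where c: "d = [:c:]" by (auto elim: degree_eq_zeroE)
  have "c \<noteq> 0" using uv(2) c by auto
  hence "smult (1 / c) u * p + smult (1 / c) v * q = 1"
  proof -
    have "smult (1 / c) u * p + smult (1 / c) v * q = smult (1 / c) d"
      unfolding uv(1) by (simp add: smult_add_right)
    thus ?thesis using \<open>c \<noteq> 0\<close> by (simp add: c one_pCons)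
  qed
  thus ?thesis using that by blast
qed

text \<open>Coprimality is checked in one extension field and used in another.\<close>

lemma no_common_root_transfer:
  assumes \<phi>: "fhom \<phi>" and \<psi>: "fhom \<psi>" and A: "finite A" "inj_on f A"
    and p: "map_poly \<phi> p = smult c (\<Prod>q\<in>A. [:- f q, 1:])" "c \<noteq> 0"
    and q: "\<And>r. r \<in> A \<Longrightarrow> poly (map_poly \<phi> q) (f r) \<noteq> 0"
    and x: "poly (map_poly \<psi> p) x = 0"
  shows "poly (map_poly \<psi> q) x \<noteq> 0"
proof
  interpret p: fhom \<phi> by fact
  interpret s: fhom \<psi> by fact
  assume x': "poly (s.mp q) x = 0"
  have "p.mp p \<noteq> 0" unfolding p(1) using p(2) A by simp
  hence p0: "p \<noteq> 0" by simp
  have "degree d = 0" if "d dvd p" "d dvd q" for d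
  proof (rule ccontr)
    assume "degree d \<noteq> 0"
    moreover have "p.mp d dvd (\<Prod>q\<in>A. [:- f q, 1:])"
      using that(1) p by (metis p.mp_dvd_iff dvd_smult_cancel)
    ultimately obtain r where "r \<in> A" "poly (p.mp d) (f r) = 0"
      using dvd_prod_linear_root[OF A, of "p.mp d"] by auto
    moreover have "p.mp d dvd p.mp q" using that(2) by (simp add: p.mp_dvd_iff)
    ultimately show False using q by (auto elim!: dvdE)
  qed
  then obtain u v where "u * p + v * q = 1" using poly_bezout[OF p0] by metis
  hence "s.mp u * s.mp p + s.mp v * s.mp q = 1" by (metis s.mp_add s.mp_mult s.mp_1)
  hence "poly (s.mp u * s.mp p + s.mp v * s.mp q) x = 1" by simp
  thus False using x x' by simp
qed

lemma card_simple_roots: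
  fixes p :: "'a::alg_closed_field poly"
  assumes "p \<noteq> 0" "\<And>x. poly p x = 0 \<Longrightarrow> poly (pderiv p) x \<noteq> 0"
  shows "card {x. poly p x = 0} = degree p"
  using assms
proof (induction "degree p" arbitrary: p)
  case 0
  then obtain c where "p = [:c:]" by (metis degree_eq_zeroE)
  thus ?case using 0 by auto
next
  case (Suc n)
  obtain r where r: "poly p r = 0" using alg_closed_imp_poly_has_root[of p] Suc by auto
  then obtain s where s: "p = [:- r, 1:] * s" by (auto simp: poly_eq_0_iff_dvd elim: dvdE)
  have s0: "s \<noteq> 0" using Suc s by auto
  have d: "poly (pderiv p) x = poly s x + (x - r) * poly (pderiv s) x" for x
    unfolding s pderiv_mult by (simp add: pderiv_pCons algebra_simps)
  have deg: "degree p = Suc (degree s)" using s0 unfolding s by (subst degree_mult_eq) auto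
  have "card {x. poly s x = 0} = degree s"
  proof (rule Suc.hyps(1)[OF _ s0])
    fix x assume x: "poly s x = 0"
    hence "poly p x = 0" by (simp add: s)
    thus "poly (pderiv s) x \<noteq> 0" using Suc.prems(2)[of x] x d by auto
  qed (use deg Suc in simp)
  moreover have "{x. poly p x = 0} = insert r {x. poly s x = 0}" by (auto simp: s)
  moreover have "poly s r \<noteq> 0" using Suc.prems(2)[OF r] d[of r] by auto
  moreover have "finite {x. poly s x = 0}" using s0 by (rule poly_roots_finite)
  ultimately show ?case using deg by simp
qed

lemma q_poly_eqI:
  assumes "prim_div_pol k = of_poly P"
  shows "q_poly k = P"
  unfolding q_poly_def
  by (rule the_equality) (use assms of_poly_hom(10) in \<open>auto simp: of_poly_def\<close>)

lemma (in tate) q_poly_factorization: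
  assumes "k \<ge> 3" "k dvd M"
  obtains lc where "has_val lc 0" "emb.mp (q_poly k) = smult lc (\<Prod>q\<in>prim k. [:- xr q, 1:])"
  using prim_div_pol_poly[OF assms] q_poly_eqI by metis

lemma prim_div_pol_q_poly:
  assumes "k \<ge> 3"
  shows "prim_div_pol k = of_poly (q_poly k)" "q_poly k \<noteq> 0"
proof -
  interpret tate k by unfold_locales (use assms in simp)
  obtain P lc where P: "prim_div_pol k = of_poly P" "has_val lc 0" "emb.mp P = smult lc (\<Prod>q\<in>prim k. [:- xr q, 1:])"
    using prim_div_pol_poly[OF assms] by auto
  thus "prim_div_pol k = of_poly (q_poly k)" using q_poly_eqI by metis
  have "emb.mp P \<noteq> 0" unfolding P(3) using P(2) finite_prim by (simp add: has_val_def)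
  thus "q_poly k \<noteq> 0" using q_poly_eqI[OF P(1)] by simp
qed

text \<open>For even k the constant 2 is what remains of the factor q_2 = 2y once y is removed from
  Q_k.\<close>

lemma fpol_eq_prod:
  assumes "k \<ge> 3"
  shows "fpol k = (if even k then 2 else 1) * (\<Prod>d\<in>{d. d dvd k \<and> 3 \<le> d}. q_poly d)"
proof -
  interpret tate k by unfold_locales (use assms in simp)
  define S where "S = {d. d dvd k \<and> 3 \<le> d}"
  have k0: "k > 0" using assms by simp
  have finS: "finite S" using k0 by (auto simp: S_def)
  have div: "{d. d dvd k \<and> 0 < d \<and> d < k} = (S - {k}) \<union> ({1} \<union> (if even k then {2} else {}))"
  proof (intro equalityI subsetI)
    fix d assume d: "d \<in> {d. d dvd k \<and> 0 < d \<and> d < k}"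
    hence "d = 1 \<or> d = 2 \<or> 3 \<le> d" by auto
    thus "d \<in> (S - {k}) \<union> ({1} \<union> (if even k then {2} else {}))" using d by (auto simp: S_def)
  next
    fix d assume "d \<in> (S - {k}) \<union> ({1} \<union> (if even k then {2} else {}))"
    hence "d \<in> S - {k} \<or> d = 1 \<or> even k \<and> d = 2" by (auto split: if_splits)
    moreover have "d < k" if "d \<in> S - {k}" using dvd_imp_le[of d k] that k0 by (simp add: S_def)
    ultimately show "d \<in> {d. d dvd k \<and> 0 < d \<and> d < k}" using assms by (auto simp: S_def)
  qed
  have q: "prim_div_pol d = of_poly (q_poly d)" if "d \<in> S" for d
    using prim_div_pol_q_poly[of d] that by (auto simp: S_def)
  define R where "R = (\<Prod>d\<in>S - {k}. q_poly d)"
  have R0: "of_poly R \<noteq> 0"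
    using prim_div_pol_q_poly(2) finS by (auto simp: R_def of_poly_hom S_def)
  have "(S - {k}) \<inter> ({1} \<union> (if even k then {2} else {})) = {}" by (auto simp: S_def)
  hence "(\<Prod>d\<in>{d. d dvd k \<and> 0 < d \<and> d < k}. prim_div_pol d) =
      (\<Prod>d\<in>S - {k}. prim_div_pol d) * (\<Prod>d\<in>{1} \<union> (if even k then {2} else {}). prim_div_pol d)"
    unfolding div using finS by (intro prod.union_disjoint) auto
  also have "(\<Prod>d\<in>{1} \<union> (if even k then {2} else {}). prim_div_pol d) = (if even k then 2 * cf_y else 1)"
    using prim_div_pol_1 prim_div_pol_2 by auto
  also have "(\<Prod>d\<in>S - {k}. prim_div_pol d) = of_poly R"
  proof -
    have "(\<Prod>d\<in>F. prim_div_pol d) = of_poly (\<Prod>d\<in>F. q_poly d)" if "finite F" "F \<subseteq> S" for F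
      using that by (induction F) (simp_all add: of_poly_hom q)
    thus ?thesis using finS by (simp add: R_def)
  qed
  finally have prod: "(\<Prod>d\<in>{d. d dvd k \<and> 0 < d \<and> d < k}. prim_div_pol d) = of_poly R * (if even k then 2 * cf_y else 1)" .
  have kS: "k \<in> S" using assms by (simp add: S_def)
  have "of_poly (q_poly k) = of_poly (fpol k) * (if even k then cf_y else 1) / (of_poly R * (if even k then 2 * cf_y else 1))"
    using q[OF kS] by (subst (asm) prim_div_pol.simps) (simp only: prod div_pol_eq[OF k0])
  hence "of_poly (fpol k) = (if even k then 2 else 1) * of_poly R * of_poly (q_poly k)"
    using R0 cf_y_nonzero curve_fun_two by (simp add: field_simps split: if_splits)
  also have "(if even k then 2 else 1) = of_poly (if even k then 2 else 1)" by (simp add: of_poly_hom)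
  finally have "fpol k = (if even k then 2 else 1) * (R * q_poly k)"
    by (simp only: of_poly_hom(3)[symmetric] of_poly_hom(10) mult.assoc)
  also have "R * q_poly k = (\<Prod>d\<in>S. q_poly d)"
    using finS kS by (simp add: R_def prod.remove[of S k] mult.commute)
  finally show ?thesis by (simp add: S_def)
qed

lemma Qj_of_nat: "n \<noteq> 0 \<Longrightarrow> (of_nat n :: Qj) \<noteq> 0"
proof -
  interpret tate 1 by unfold_locales simp
  show "n \<noteq> 0 \<Longrightarrow> (of_nat n :: Qj) \<noteq> 0" using emb.of_nat[of n] by (metis emb.zero of_nat_eq_0_iff)
qed

lemma Qj_two: "(2 :: Qj) \<noteq> 0"
  using Qj_of_nat[OF zero_neq_numeral[symmetric], of "num.Bit0 num.One"] unfolding of_nat_numeral .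

lemma ddeg_eq_sum:
  assumes "k \<ge> 3"
  shows "ddeg k = (\<Sum>d\<in>{d. d dvd k \<and> 3 \<le> d}. degree (q_poly d))"
proof -
  have "ddeg k = degree (fpol k)" using assms by (simp add: degree_fpol)
  also have "\<dots> = degree (\<Prod>d\<in>{d. d dvd k \<and> 3 \<le> d}. q_poly d)"
  proof -
    have "2 * P = smult 2 P" for P :: "Qj poly"
    proof -
      have "smult 2 P = smult (1 + 1) P" by (simp only: one_add_one)
      also have "\<dots> = P + P" by (simp only: smult_add_left smult_1_left)
      finally show ?thesis by (simp only: mult_2)
    qed
    hence "degree ((if even k then 2 else 1) * P) = degree P" for P :: "Qj poly"
      using Qj_two by (cases "even k") (simp_all only: if_True if_False mult_1_left degree_smult_eq)
    thus ?thesis unfolding fpol_eq_prod[OF assms] .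
  qed
  also have "\<dots> = (\<Sum>d\<in>{d. d dvd k \<and> 3 \<le> d}. degree (q_poly d))"
    by (rule degree_prod_eq_sum_degree) (use prim_div_pol_q_poly(2) in auto)
  finally show ?thesis .
qed

lemma degree_q_poly_3: "degree (q_poly 3) = 4"
proof -
  have "{d::nat. d dvd 3 \<and> 3 \<le> d} = {3}" by (auto dest: dvd_imp_le)
  thus ?thesis using ddeg_eq_sum[of 3] by (simp add: ddeg_def)
qed

text \<open>Prepares the divisibility of m_k by 12. The residue 4 is the contribution of q_3, of
  degree 4.\<close>

lemma ddeg_mod_6:
  assumes "k \<ge> 3"
  shows "ddeg k mod 6 = (if 3 dvd k then 4 else 0)"
proof -
  define i where "i = k div 2"
  define j where "j = i div 3"
  have i0: "i > 0" using assms by (simp add: i_def)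
  have arith: "(2 * (3 * u) - 2) mod 6 = (4::nat)" if "u > 0" for u :: nat
  proof -
    have "2 * (3 * u) - 2 = 4 + 6 * (u - 1)" using that by simp
    thus ?thesis by (simp only: mod_mult_self2) simp
  qed
  have "i = 3 * j \<or> i = 3 * j + 1 \<or> i = 3 * j + 2" unfolding j_def by presburger
  then consider "i = 3 * j" | "i = 3 * j + 1" | "i = 3 * j + 2" by blast
  thus ?thesis
  proof cases
    case 1
    have sq: "i ^ 2 = 3 * (3 * j ^ 2)" by (simp add: 1 power2_eq_square)
    have "3 dvd k \<longleftrightarrow> even k" using 1 unfolding i_def by presburger
    moreover have "even k \<Longrightarrow> ddeg k = 2 * (3 * (3 * j ^ 2)) - 2" using sq by (simp add: ddeg_def i_def)
    moreover have "odd k \<Longrightarrow> ddeg k = 6 * (3 * j ^ 2 + j)" using sq 1 by (simp add: ddeg_def i_def)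
    moreover have "3 * j ^ 2 > 0" using i0 1 by simp
    ultimately show ?thesis using arith[of "3 * j ^ 2"] by (cases "even k") auto
  next
    case 2
    have sq: "i ^ 2 = 3 * (3 * j ^ 2 + 2 * j) + 1" by (simp add: 2 power2_eq_square algebra_simps)
    have d: "3 dvd k \<longleftrightarrow> odd k" using 2 unfolding i_def by presburger
    have 0: "even k \<Longrightarrow> ddeg k = 6 * (3 * j ^ 2 + 2 * j)" using sq by (simp add: ddeg_def i_def)
    have 1: "odd k \<Longrightarrow> ddeg k = 6 * (3 * j ^ 2 + 3 * j) + 4" using sq 2 by (simp add: ddeg_def i_def)
    have 4: "(6 * u + 4) mod 6 = 4" for u :: nat by (simp only: mod_mult_self4) simp
    show ?thesis
    proof (cases "even k")
      case True
      show ?thesis unfolding 0[OF True] mod_mult_self1_is_0 using d True by simp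
    next
      case False
      show ?thesis unfolding 1[OF False] 4 using d False by simp
    qed
  next
    case 3
    have sq: "i ^ 2 = 3 * (3 * j ^ 2 + 4 * j + 1) + 1" by (simp add: 3 power2_eq_square algebra_simps)
    have d: "\<not> 3 dvd k" using 3 unfolding i_def by presburger
    show ?thesis
    proof (cases "even k")
      case True
      hence "ddeg k = 6 * (3 * j ^ 2 + 4 * j + 1)" using sq by (simp add: ddeg_def i_def)
      thus ?thesis using d by (simp only: mod_mult_self1_is_0 if_False)
    next
      case False
      hence "ddeg k = 6 * (3 * j ^ 2 + 5 * j + 2)" using sq 3 by (simp add: ddeg_def i_def)
      thus ?thesis using d by (simp only: mod_mult_self1_is_0 if_False)
    qed
  qed
qed

text \<open>Subtract from the degree of \<open>fpol k\<close> those of the proper factors: q_3, when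
  it occurs, cancels the residue 4, and the others are divisible by 6 by induction.\<close>

lemma six_dvd_degree_q_poly: "k > 3 \<Longrightarrow> 6 dvd degree (q_poly k)"
proof (induction k rule: less_induct)
  case (less k)
  define S where "S = {d. d dvd k \<and> 3 < d \<and> d < k}"
  have finS: "finite S" using less by (auto simp: S_def)
  have eq: "{d. d dvd k \<and> 3 \<le> d} = insert k (S \<union> (if 3 dvd k then {3} else {}))"
    using less(2) dvd_imp_le[of _ k] by (auto simp: S_def nat_less_le)
  have "ddeg k = degree (q_poly k) + ((\<Sum>d\<in>S. degree (q_poly d)) + (if 3 dvd k then 4 else 0))"
  proof -
    have "ddeg k = degree (q_poly k) + (\<Sum>d\<in>S \<union> (if 3 dvd k then {3} else {}). degree (q_poly d))"
      unfolding ddeg_eq_sum[OF less_imp_le[OF less(2)]] eq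
      by (rule sum.insert) (use finS less(2) in \<open>auto simp: S_def\<close>)
    also have "(\<Sum>d\<in>S \<union> (if 3 dvd k then {3} else {}). degree (q_poly d)) =
        (\<Sum>d\<in>S. degree (q_poly d)) + (if 3 dvd k then 4 else 0)"
      by (subst sum.union_disjoint) (use finS degree_q_poly_3 in \<open>auto simp: S_def\<close>)
    finally show ?thesis .
  qed
  moreover have "6 dvd D" if "dd = D + (s + e)" "6 dvd s" "dd mod 6 = e" for D dd s e :: nat
  proof -
    have "dd = 6 * (dd div 6) + e" using that(3) mult_div_mod_eq[of 6 dd] by simp
    hence "D + s = 6 * (dd div 6)" using that(1) by simp
    thus ?thesis using that(2) by (metis dvd_add_left_iff dvd_triv_left)
  qed
  moreover have "6 dvd (\<Sum>d\<in>S. degree (q_poly d))"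
    using less by (intro dvd_sum) (auto simp: S_def)
  moreover have "ddeg k mod 6 = (if 3 dvd k then 4 else 0)" using less(2) by (intro ddeg_mod_6) simp
  ultimately show ?case by blast
qed

lemma fhom_to_ac: "fhom to_ac"
  by unfold_locales simp_all

text \<open>The roots of q_k are simple, and over each lie exactly two points, since the cubic does
  not vanish there. Both facts are seen on theta points and transferred to the algebraic
  closure.\<close>

lemma num_exact_order_eq:
  assumes k: "k \<ge> 3"
  shows "num_exact_order k = 2 * degree (q_poly k)"
proof -
  interpret ac: fhom to_ac by (rule fhom_to_ac)
  define a b where "a = to_ac curve_a" and "b = to_ac curve_b"
  define w where "w = (\<lambda>x. QQ2 a b x)"
  define root where "root = (\<lambda>x. poly (ac.mp (q_poly k)) x = 0)"
  have two: "2 \<noteq> (0 :: Qj alg_closure)" using Qj_two to_ac_eq_0_iff[of "2 :: Qj"] unfolding to_ac_numeral by blast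
  have w: "w x = x ^ 3 + a * x + b" for x by (simp add: w_def QQ2_def)
  have wp: "poly (ac.mp weierstrass_rhs) x = w x" for x
    using poly_fpol(2)[OF fhom_to_ac] by (simp add: w_def a_def b_def)
  have root_w: "w x \<noteq> 0" if "root x" for x
  proof -
    interpret tate k by unfold_locales (use k in simp)
    obtain lc where lc: "has_val lc 0" "emb.mp (q_poly k) = smult lc (\<Prod>q\<in>prim k. [:- xr q, 1:])"
      using q_poly_factorization[OF k dvd_refl] by blast
    have "poly (ac.mp weierstrass_rhs) x \<noteq> 0"
    proof (rule no_common_root_transfer[OF emb.fhom_axioms fhom_to_ac finite_prim _ lc(2) _ _ that[unfolded root_def]])
      show "inj_on xr (prim k)" by (rule inj_on_subset[OF xr_inj]) (auto simp: prim_def)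
      show "lc \<noteq> 0" using lc(1) by (simp add: has_val_def)
      fix r assume "r \<in> prim k"
      hence r: "(fst r, snd r) \<in> H" by (simp add: prim_def)
      show "poly (emb.mp weierstrass_rhs) (xr r) \<noteq> 0"
        using W_initial(4)[OF theta_H[OF r]] poly_fpol(2)[OF emb.fhom_axioms]
        by (simp add: xr_def emb_curve flip: W_initial(1)[OF theta_H[OF r]])
    qed
    thus ?thesis by (simp add: wp)
  qed
  have root_minimal: "poly (ac.mp (fpol d)) x \<noteq> 0" if "root x" "0 < d" "d < k" for x d
  proof -
    \<comment> \<open>A common multiple puts the points of order k and the d-torsion into one system
      of representatives.\<close>
    interpret tate "k * d" by unfold_locales (use k that in simp)
    obtain lc where lc: "has_val lc 0" "emb.mp (q_poly k) = smult lc (\<Prod>q\<in>prim k. [:- xr q, 1:])"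
      using q_poly_factorization[OF k dvd_triv_left] by blast
    show ?thesis
    proof (rule no_common_root_transfer[OF emb.fhom_axioms fhom_to_ac finite_prim _ lc(2) _ _ that(1)[unfolded root_def]])
      show "inj_on xr (prim k)" by (rule inj_on_subset[OF xr_inj]) (auto simp: prim_def)
      show "lc \<noteq> 0" using lc(1) by (simp add: has_val_def)
      fix r assume r: "r \<in> prim k"
      have "\<not> k dvd d" using that k by (auto dest: dvd_imp_le)
      hence "r \<notin> torsion d" using r by (auto simp: prim_def torsion_def)
      hence "xr r \<notin> xr ` torsion d"
        using r inj_onD[OF xr_inj, of r] by (auto simp: prim_def torsion_def)
      thus "poly (emb.mp (fpol d)) (xr r) \<noteq> 0"
        using that finite_torsion[of d] by (auto simp: fpol_factorization poly_prod)
    qed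
  qed
  have root_fpol: "root x" if "poly (ac.mp (fpol k)) x = 0" "\<And>d. 0 < d \<Longrightarrow> d < k \<Longrightarrow> poly (ac.mp (fpol d)) x \<noteq> 0" for x
  proof -
    have e: "poly (ac.mp (fpol n)) x = (if even n then 2 else 1) * (\<Prod>d\<in>{d. d dvd n \<and> 3 \<le> d}. poly (ac.mp (q_poly d)) x)"
      if "n \<ge> 3" for n
      unfolding fpol_eq_prod[OF that] by (cases "even n") (simp_all add: ac.mp_mult ac.mp_prod poly_prod ac.poly_mp_hom)
    have fin: "finite {d. d dvd n \<and> 3 \<le> d}" if "n \<ge> 3" for n :: nat using that by auto
    have "(\<Prod>d\<in>{d. d dvd k \<and> 3 \<le> d}. poly (ac.mp (q_poly d)) x) = 0"
      using that(1) e[OF k] two by (auto split: if_splits)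
    then obtain d where d: "d dvd k" "3 \<le> d" "poly (ac.mp (q_poly d)) x = 0"
      using fin[OF k] by (auto simp: prod_zero_iff)
    have "poly (ac.mp (fpol d)) x = 0"
    proof -
      have "\<exists>d'\<in>{d'. d' dvd d \<and> 3 \<le> d'}. poly (ac.mp (q_poly d')) x = 0"
        using d(2,3) by (intro bexI[of _ d]) auto
      thus ?thesis using e[OF d(2)] fin[OF d(2)] by (simp add: prod_zero_iff)
    qed
    hence "\<not> d < k" using that(2) d(2) by auto
    hence "d = k" using d k by (auto dest: dvd_imp_le)
    thus ?thesis using d by (simp add: root_def)
  qed
  have fpol_root: "poly (ac.mp (fpol k)) x = 0" if "root x" for x
  proof -
    have "q_poly k dvd (\<Prod>d\<in>{d. d dvd k \<and> 3 \<le> d}. q_poly d)"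
      by (rule dvd_prodI) (use k in auto)
    hence "q_poly k dvd fpol k" unfolding fpol_eq_prod[OF k] by (rule dvd_mult)
    thus ?thesis using that by (auto simp: root_def ac.mp_mult elim!: dvdE)
  qed
  have order: "exact_order a k (Affine x y) \<longleftrightarrow> root x" if y: "y \<noteq> 0" "y ^ 2 = w x" for x y
  proof -
    define psi where "psi = (\<lambda>n. poly (ac.mp (fpol n)) x * (if even n then y else 1))"
    interpret somos_point a b x y psi
    proof
      show "2 \<noteq> (0 :: Qj alg_closure)" "y \<noteq> 0" "y ^ 2 = x ^ 3 + a * x + b" using two y w by auto
      show "psi 0 = 0" "psi 1 = 1" "psi 2 = 2 * y"
        by (simp_all add: psi_def fpol_def ac.poly_mp_hom del: One_nat_def)
      show "psi 3 = QQ3 a b x"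
        using poly_fpol(3)[OF fhom_to_ac, of x] by (simp add: psi_def fpol_def a_def b_def)
      show "psi 4 = 4 * y * QQ4 a b x"
        using poly_fpol(4)[OF fhom_to_ac, of x] by (simp add: psi_def fpol_def a_def b_def ac.poly_mp_hom)
      fix m :: nat assume m: "m \<ge> 2"
      define f where "f = (\<lambda>n. poly (ac.mp (fpol n)) x)"
      have "f (m + 2) * f (m - 2) = 4 * (if even m then 1 else w x ^ 2) * f (m + 1) * f (m - 1) - poly (ac.mp c3_poly) x * f m ^ 2"
        using arg_cong[OF somos_fpol[OF m], of "\<lambda>p. poly (ac.mp p) x"]
        by (cases "even m") (simp_all add: f_def ac.poly_mp_hom wp)
      hence e: "f (m + 2) * f (m - 2) = 4 * (if even m then 1 else (y ^ 2) ^ 2) * f (m + 1) * f (m - 1) - poly (ac.mp c3_poly) x * f m ^ 2"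
        unfolding y(2) .
      have p23: "psi 3 = poly (ac.mp c3_poly) x" "psi 2 = 2 * y"
        by (simp_all add: psi_def fpol_def ac.poly_mp_hom)
      have p: "psi n = f n * (if even n then y else 1)" for n by (simp add: psi_def f_def)
      show "psi (m + 2) * psi (m - 2) = psi 2 ^ 2 * psi (m + 1) * psi (m - 1) - psi 3 * psi m ^ 2"
      proof (cases "even m")
        case True
        have "psi (m + 2) * psi (m - 2) = y ^ 2 * (f (m + 2) * f (m - 2))"
          using True m by (simp add: p power2_eq_square)
        also have "\<dots> = (2 * y) ^ 2 * f (m + 1) * f (m - 1) - poly (ac.mp c3_poly) x * (f m * y) ^ 2"
          unfolding e using True by (simp add: power2_eq_square algebra_simps)
        finally show ?thesis unfolding p23 using True m by (simp add: p)
      next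
        case False
        have "psi (m + 2) * psi (m - 2) = f (m + 2) * f (m - 2)" using False m by (simp add: p)
        also have "\<dots> = (2 * y) ^ 2 * (f (m + 1) * y) * (f (m - 1) * y) - poly (ac.mp c3_poly) x * f m ^ 2"
          unfolding e using False by (simp add: power2_eq_square algebra_simps)
        finally show ?thesis unfolding p23 using False m by (simp add: p)
      qed
    qed
    have psi0: "psi n = 0 \<longleftrightarrow> poly (ac.mp (fpol n)) x = 0" for n using y(1) by (simp add: psi_def)
    show ?thesis unfolding exact_order_iff psi0
    proof
      assume "0 < k \<and> poly (ac.mp (fpol k)) x = 0 \<and> (\<forall>d. 0 < d \<and> d < k \<longrightarrow> poly (ac.mp (fpol d)) x \<noteq> 0)"
      thus "root x" by (intro root_fpol) blast+
    next
      assume x: "root x"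
      have "0 < k" using k by simp
      thus "0 < k \<and> poly (ac.mp (fpol k)) x = 0 \<and> (\<forall>d. 0 < d \<and> d < k \<longrightarrow> poly (ac.mp (fpol d)) x \<noteq> 0)"
        using fpol_root[OF x] root_minimal[OF x] by blast
    qed
  qed
  have "{P \<in> ec_points a b. exact_order a k P} = (\<Union>x\<in>{x. root x}. Affine x ` {y. y ^ 2 = w x})"
  proof (intro equalityI subsetI)
    fix P assume P: "P \<in> {P \<in> ec_points a b. exact_order a k P}"
    have "\<not> exact_order a k Infinity"
      using k by (auto simp: exact_order_def ec_mult_Suc ec_mult_0 intro!: exI[of _ 1])
    then obtain x y where xy: "P = Affine x y" "y ^ 2 = w x" using P by (auto simp: ec_points_def w)
    have "y \<noteq> 0" using exact_order_two_torsion[OF k] P xy by (metis (no_types, lifting) mem_Collect_eq neg_equal_0_iff_equal)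
    thus "P \<in> (\<Union>x\<in>{x. root x}. Affine x ` {y. y ^ 2 = w x})" using order P xy by auto
  next
    fix P assume "P \<in> (\<Union>x\<in>{x. root x}. Affine x ` {y. y ^ 2 = w x})"
    then obtain x y where xy: "P = Affine x y" "root x" "y ^ 2 = w x" by auto
    have "y \<noteq> 0" using root_w[OF xy(2)] xy(3) by auto
    thus "P \<in> {P \<in> ec_points a b. exact_order a k P}" using order xy by (auto simp: ec_points_def w)
  qed
  hence "num_exact_order k = card (\<Union>x\<in>{x. root x}. Affine x ` {y. y ^ 2 = w x})"
    by (simp add: num_exact_order_def a_def b_def)
  also have "\<dots> = (\<Sum>x\<in>{x. root x}. card (Affine x ` {y. y ^ 2 = w x}))"
  proof (rule card_UN_disjoint)
    show "finite {x. root x}" unfolding root_def using prim_div_pol_q_poly(2)[OF k] by (intro poly_roots_finite) simp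
    have "finite {y. y ^ 2 = w x}" for x
    proof -
      have "{y. y ^ 2 = w x} = {y. poly [:- w x, 0, 1:] y = 0}" by (auto simp: power2_eq_square algebra_simps)
      thus ?thesis by (simp only: poly_roots_finite) (rule poly_roots_finite, simp)
    qed
    thus "\<forall>x\<in>{x. root x}. finite (Affine x ` {y. y ^ 2 = w x})" by simp
  qed auto
  also have "\<dots> = (\<Sum>x\<in>{x. root x}. 2)"
  proof (rule sum.cong)
    fix x assume "x \<in> {x. root x}"
    hence w0: "w x \<noteq> 0" using root_w by simp
    obtain y where y: "y ^ 2 = w x" using nth_root_exists[of 2 "w x"] by auto
    have "{z. z ^ 2 = w x} = {y, - y}" by (auto simp: y[symmetric] power2_eq_iff)
    moreover have "y \<noteq> - y"
    proof
      assume "y = - y"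
      hence "2 * y = 0" by (metis add.right_inverse mult_2)
      thus False using two y w0 by auto
    qed
    moreover have "card (Affine x ` {z. z ^ 2 = w x}) = card {z. z ^ 2 = w x}"
      by (rule card_image) (auto simp: inj_on_def)
    ultimately show "card (Affine x ` {y. y ^ 2 = w x}) = 2" by simp
  qed simp
  also have "\<dots> = 2 * card {x. root x}" by simp
  also have "card {x. root x} = degree (ac.mp (q_poly k))"
    unfolding root_def
  proof (rule card_simple_roots)
    show "ac.mp (q_poly k) \<noteq> 0" using prim_div_pol_q_poly(2)[OF k] by simp
    fix x assume x: "poly (ac.mp (q_poly k)) x = 0"
    interpret tate k by unfold_locales (use k in simp)
    obtain lc where lc: "has_val lc 0" "emb.mp (q_poly k) = smult lc (\<Prod>q\<in>prim k. [:- xr q, 1:])"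
      using q_poly_factorization[OF k dvd_refl] by blast
    have inj: "inj_on xr (prim k)" by (rule inj_on_subset[OF xr_inj]) (auto simp: prim_def)
    \<comment> \<open>Simplicity of roots is coprimality with the derivative, so it transfers like
      any other coprimality.\<close>
    show "poly (pderiv (ac.mp (q_poly k))) x \<noteq> 0"
      unfolding ac.mp_pderiv[symmetric]
    proof (rule no_common_root_transfer[OF emb.fhom_axioms fhom_to_ac finite_prim inj lc(2) _ _ x])
      show "lc \<noteq> 0" using lc(1) by (simp add: has_val_def)
      fix r assume r: "r \<in> prim k"
      have "emb.mp (q_poly k) = [:- xr r, 1:] * smult lc (\<Prod>q\<in>prim k - {r}. [:- xr q, 1:])"
        unfolding lc(2) prod.remove[OF finite_prim r] by (simp only: mult_smult_right)
      hence "poly (emb.mp (pderiv (q_poly k))) (xr r) = poly (smult lc (\<Prod>q\<in>prim k - {r}. [:- xr q, 1:])) (xr r)"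
        unfolding emb.mp_pderiv by (simp only: pderiv_mult) (simp add: pderiv_pCons)
      also have "\<dots> \<noteq> 0"
        using \<open>lc \<noteq> 0\<close> finite_prim inj r by (auto simp: poly_prod inj_on_def)
      finally show "poly (emb.mp (pderiv (q_poly k))) (xr r) \<noteq> 0" .
    qed
  qed
  finally show ?thesis by simp
qed

section \<open>Expansions in s, their conjugacy classes and ramification\<close>

section \<open>Puiseux expansions\<close>

lemma fhom_puiseux_of:
  assumes "d > 0"
  shows "fhom (puiseux_of d)"
proof
  fix f g
  show "puiseux_of d (f + g) = puiseux_of d f + puiseux_of d g"
    using assms by transfer (simp add: puiseux_rel_def fls_compose_power_compose_power)
  show "puiseux_of d (f * g) = puiseux_of d f * puiseux_of d g"
    using assms by transfer (simp add: puiseux_rel_def fls_compose_power_compose_power)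
  show "puiseux_of d 1 = 1"
    using assms by transfer (simp add: puiseux_rel_def)
qed

lemma puiseux_of_X_power: "d > 0 \<Longrightarrow> puiseux_of d (fls_X ^ d) = puiseux_s"
  unfolding puiseux_s_def
  by transfer (simp add: puiseux_rel_def fls_X_power_conv_shift_1)

lemma puiseux_of_compose_power:
  "d > 0 \<Longrightarrow> e > 0 \<Longrightarrow> puiseux_of (d * e) (fls_compose_power f d) = puiseux_of e f"
  by transfer (simp add: puiseux_rel_def fls_compose_power_compose_power)

lemma v_s_puiseux_of:
  "d > 0 \<Longrightarrow> v_s (puiseux_of d f) = (if f = 0 then \<infinity> else ereal (of_int (fls_subdegree f) / of_nat d))"
  by transfer simp

lemma v_s_has_val: "d > 0 \<Longrightarrow> has_val f n \<Longrightarrow> v_s (puiseux_of d f) = ereal (of_int n / of_nat d)"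
  by (auto simp: v_s_puiseux_of has_val_def)

lemma transc_puiseux_s: "transc puiseux_s"
  unfolding puiseux_s_def by (rule fhom_ev_comp(1)[OF fhom_puiseux_of]) (auto intro: transc_fls)

lemma Qj_embed_eq: "Qj_embed = ev puiseux_s"
  by (simp add: Qj_embed_def ev_def)

lemma fhom_Qj_embed: "fhom Qj_embed"
  unfolding Qj_embed_eq by (rule fhom_ev[OF transc_puiseux_s])

lemma fhom_compose_fps:
  fixes G :: "'a::field fps"
  assumes "G \<noteq> 0" "fps_nth G 0 = 0"
  shows "fhom (\<lambda>f. fls_compose_fps f G)"
  by unfold_locales (simp_all add: assms fls_compose_fps_add fls_compose_fps_mult)

subsection \<open>Conjugacy classes are nonempty\<close>

lemma fhom_puiseux_of_rat_fls: "fhom puiseux_of_rat_fls"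
proof -
  define m :: "rat fls \<Rightarrow> complex fls" where "m = (\<lambda>f. Abs_fls (\<lambda>n. of_rat (f $$ n)))"
  have nth: "m f $$ n = of_rat (f $$ n)" for f n
    unfolding m_def by (rule nth_Abs_fls_lower_bound[of "fls_subdegree f"]) simp
  have "fhom m"
  proof
    fix f g
    show "m (f + g) = m f + m g" by (rule fls_eqI) (simp add: nth of_rat_add)
    show "m (f * g) = m f * m g"
    proof (rule fls_eqI)
      fix n
      have "(m f * m g) $$ n = (\<Sum>i=fls_subdegree f..n - fls_subdegree g. m f $$ i * m g $$ (n - i))"
        by (rule fls_times_nth_bounds) (simp_all add: nth)
      also have "\<dots> = of_rat ((f * g) $$ n)"
        by (simp add: fls_times_nth(2) of_rat_sum of_rat_mult nth)
      finally show "m (f * g) $$ n = (m f * m g) $$ n" by (simp add: nth)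
    qed
    show "m 1 = 1" by (rule fls_eqI) (simp add: nth)
  qed
  from fhom_comp[OF this fhom_puiseux_of[of 1]] show ?thesis
    by (simp add: puiseux_of_rat_fls_def[abs_def] m_def)
qed

lemma puiseux_of_rat_fls_X: "puiseux_of_rat_fls fls_X = puiseux_s"
proof -
  have "Abs_fls (\<lambda>n. of_rat ((fls_X :: rat fls) $$ n)) = (fls_X :: complex fls)"
  proof (rule fls_eqI)
    fix n
    show "Abs_fls (\<lambda>n. of_rat ((fls_X :: rat fls) $$ n)) $$ n = (fls_X :: complex fls) $$ n"
      by (subst nth_Abs_fls_lower_bound[of 0]) auto
  qed
  thus ?thesis by (simp add: puiseux_of_rat_fls_def puiseux_s_def)
qed

text \<open>Conjugacy is defined by a common irreducible polynomial, so reflexivity needs a minimal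
  polynomial over Q((s)). Without it an equivalence class might be empty and the order at a cusp
  undetermined.\<close>

lemma conjugate_refl:
  assumes "N \<ge> 3" "p \<in> expansions N"
  shows "conjugate_over_Qs p p"
proof -
  interpret h: fhom puiseux_of_rat_fls by (rule fhom_puiseux_of_rat_fls)
  have t: "transc (fls_X :: rat fls)" by (rule transc_fls) simp_all
  interpret e: fhom "ev (fls_X :: rat fls)" by (rule fhom_ev[OF t])
  have comp: "puiseux_of_rat_fls (ev fls_X r) = Qj_embed r" for r
    unfolding Qj_embed_eq puiseux_of_rat_fls_X[symmetric] by (rule fhom_ev_comp(2)[OF fhom_puiseux_of_rat_fls t])
  define Z where "Z = (\<lambda>P. P \<noteq> 0 \<and> poly (h.mp P) p = 0)"
  have "Z (e.mp (q_poly N))"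
    using assms prim_div_pol_q_poly(2)[OF assms(1)]
    by (simp add: Z_def expansions_def map_poly_comp[OF e.fhom_axioms h.fhom_axioms] comp)
  then obtain P where P: "Z P" "\<And>R. Z R \<Longrightarrow> degree P \<le> degree R"
    using ex_has_least_nat[of Z _ degree] by blast
  have P0: "P \<noteq> 0" "poly (h.mp P) p = 0" using P by (auto simp: Z_def)
  have unit: "is_unit R" if "R \<noteq> 0" "degree R = 0" for R :: "rat fls poly"
    using that by (auto simp: is_unit_iff_degree)
  have "Factorial_Ring.irreducible P"
  proof (rule Factorial_Ring.irreducibleI)
    show "\<not> is_unit P"
    proof
      assume "is_unit P"
      hence "degree P = 0" using P0 by (simp add: is_unit_iff_degree)
      then obtain c where "P = [:c:]" by (auto elim: degree_eq_zeroE)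
      thus False using P0 by (simp add: h.mp_pCons)
    qed
    fix A B assume AB: "P = A * B"
    hence nz: "A \<noteq> 0" "B \<noteq> 0" using P0 by auto
    have deg: "degree P = degree A + degree B" unfolding AB using nz by (rule degree_mult_eq)
    have "poly (h.mp A) p = 0 \<or> poly (h.mp B) p = 0" using P0(2) by (simp add: AB h.mp_mult)
    hence "Z A \<or> Z B" using nz by (auto simp: Z_def)
    hence "degree B = 0 \<or> degree A = 0" using P(2)[of A] P(2)[of B] deg by auto
    thus "is_unit A \<or> is_unit B" using unit nz by blast
  qed (use P0 in simp)
  thus ?thesis using P0 by (auto simp: conjugate_over_Qs_def)
qed

lemma cusp_subset: "C \<in> cusps N \<Longrightarrow> C \<subseteq> expansions N"
  unfolding cusps_def by (auto simp: quotient_def)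

lemma cusp_nonempty: "N \<ge> 3 \<Longrightarrow> C \<in> cusps N \<Longrightarrow> C \<noteq> {}"
  unfolding cusps_def using conjugate_refl by (auto simp: quotient_def)

subsection \<open>From \<open>q\<close>-expansions to \<open>s\<close>-expansions\<close>

context tate
begin

text \<open>\<open>param\<close> is \<open>s\<^bsup>1/8M\<^esup>\<close> as a series in \<open>T = q\<^bsup>1/8M\<^esup>\<close>; composition with its inverse rewrites series in terms of it.\<close>

definition param :: "complex fps" where
  "param = (SOME u. fps_to_fls u ^ (8 * M) = s_series \<and> u $ 0 = 0 \<and> u $ 1 \<noteq> 0)"

lemma param: "fps_to_fls param ^ (8 * M) = s_series" "param $ 0 = 0" "param $ 1 \<noteq> 0"
proof -
  have "has_val s_series (int (8 * M) * 1)" using has_val_s_series by simp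
  then obtain h where h: "h ^ (8 * M) = s_series" "has_val h 1"
    using has_val_root[of s_series "8 * M" 1] M_pos by auto
  have "fps_to_fls (fls_regpart h) = h" using h(2) by (intro fls_regpart_to_fls_trivial) (simp add: has_val_def)
  moreover have "h $$ 0 = 0" "h $$ 1 \<noteq> 0"
    using h(2) nth_fls_subdegree_nonzero[of h] by (auto simp: has_val_def)
  ultimately have "\<exists>u. fps_to_fls u ^ (8 * M) = s_series \<and> u $ 0 = 0 \<and> u $ 1 \<noteq> 0"
    using h(1) by (intro exI[of _ "fls_regpart h"]) auto
  from someI_ex[OF this] show "fps_to_fls param ^ (8 * M) = s_series" "param $ 0 = 0" "param $ 1 \<noteq> 0"
    by (auto simp: param_def)
qed

definition comp :: "complex fls \<Rightarrow> complex fls" where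
  "comp f = fls_compose_fps f (fps_inv param)"

lemma fps_inv_param: "fps_inv param \<noteq> 0" "fps_inv param $ 0 = 0" "subdegree (fps_inv param) = 1"
proof -
  have 0: "fps_inv param $ 0 = 0" by (simp add: fps_inv_def)
  have 1: "fps_inv param $ 1 \<noteq> 0" using param by (simp add: fps_inv_def)
  show "fps_inv param $ 0 = 0" by (rule 0)
  show "fps_inv param \<noteq> 0" using 1 by auto
  show "subdegree (fps_inv param) = 1" using 0 1 by (intro subdegreeI) auto
qed

sublocale comp: fhom comp
  unfolding comp_def by (rule fhom_compose_fps) (rule fps_inv_param)+

lemma has_val_comp: "has_val (comp f) n \<longleftrightarrow> has_val f n"
  by (simp add: has_val_def comp_def fps_inv_param subdegree_fls_compose_fps fls_compose_fps_eq_0_iff)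

lemma comp_s_series: "comp s_series = fls_X ^ (8 * M)"
proof -
  have "comp (fps_to_fls param) = fps_to_fls (param oo fps_inv param)"
    unfolding comp_def by (rule fls_compose_fps_to_fls) (rule fps_inv_param)+
  also have "param oo fps_inv param = fps_X"
    by (rule fps_inv_right) (use param in auto)
  finally have "comp (fps_to_fls param) = fls_X" by simp
  thus ?thesis using comp.power[of "fps_to_fls param" "8 * M"] by (simp add: param(1))
qed

definition puis :: "complex fls \<Rightarrow> puiseux" where
  "puis f = puiseux_of (8 * M) (comp f)"

lemma fhom_puis: "fhom puis"
  unfolding puis_def using M_pos by (intro fhom_comp[OF comp.fhom_axioms] fhom_puiseux_of) simp

sublocale puis: fhom puis by (rule fhom_puis)

lemma puis_emb: "puis (emb r) = Qj_embed r"
proof -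
  have "puis s_series = puiseux_s"
    unfolding puis_def comp_s_series using M_pos by (intro puiseux_of_X_power) simp
  thus ?thesis unfolding emb_def Qj_embed_eq using fhom_ev_comp(2)[OF fhom_puis transc_s] by simp
qed

lemma v_s_puis: "has_val f n \<Longrightarrow> v_s (puis f) = ereal (of_int n / (8 * real M))"
  unfolding puis_def using v_s_has_val[of "8 * M" "comp f" n] M_pos by (simp add: has_val_comp)

lemma poly_puis: "poly (map_poly Qj_embed P) (puis x) = puis (poly (emb.mp P) x)"
proof -
  have "map_poly Qj_embed P = puis.mp (emb.mp P)"
    by (simp add: map_poly_comp[OF emb.fhom_axioms fhom_puis] puis_emb)
  thus ?thesis by (simp add: puis.poly_mp)
qed

lemma expansions_eq:
  assumes "N \<ge> 3" "N dvd M"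
  shows "expansions N = puis ` xr ` prim N"
proof -
  obtain lc where lc: "has_val lc 0" "emb.mp (q_poly N) = smult lc (\<Prod>q\<in>prim N. [:- xr q, 1:])"
    using q_poly_factorization[OF assms] by blast
  have "map_poly Qj_embed (q_poly N) = puis.mp (emb.mp (q_poly N))"
    by (simp add: map_poly_comp[OF emb.fhom_axioms fhom_puis] puis_emb)
  also have "\<dots> = smult (puis lc) (\<Prod>q\<in>prim N. [:- puis (xr q), 1:])"
  proof -
    have "puis.mp (smult lc P) = smult (puis lc) (puis.mp P)" for P
      by (simp add: poly_eq_iff puis.mult)
    thus ?thesis unfolding lc(2) by (simp add: puis.mp_prod puis.mp_pCons puis.uminus)
  qed
  finally have "poly (map_poly Qj_embed (q_poly N)) p = puis lc * (\<Prod>q\<in>prim N. p - puis (xr q))" for p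
    by (simp add: poly_prod)
  thus ?thesis unfolding expansions_def using lc(1) finite_prim[of N] by (auto simp: has_val_def)
qed

text \<open>The expansions before the passage to Puiseux series, where a rotation of the variable is
  still a substitution.\<close>

lemma comp_root_iff:
  assumes "N \<ge> 3" "N dvd M"
  shows "poly (map_poly (\<lambda>r. comp (emb r)) (q_poly N)) y = 0 \<longleftrightarrow> (\<exists>q\<in>prim N. y = comp (xr q))"
proof -
  obtain lc where lc: "has_val lc 0" "emb.mp (q_poly N) = smult lc (\<Prod>q\<in>prim N. [:- xr q, 1:])"
    using q_poly_factorization[OF assms] by blast
  have "map_poly (\<lambda>r. comp (emb r)) (q_poly N) = comp.mp (emb.mp (q_poly N))"
    by (simp add: map_poly_comp[OF emb.fhom_axioms comp.fhom_axioms])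
  also have "\<dots> = smult (comp lc) (\<Prod>q\<in>prim N. [:- comp (xr q), 1:])"
  proof -
    have "comp.mp (smult lc P) = smult (comp lc) (comp.mp P)" for P
      by (simp add: poly_eq_iff comp.mult)
    thus ?thesis unfolding lc(2) by (simp add: comp.mp_prod comp.mp_pCons comp.uminus)
  qed
  finally show ?thesis using lc(1) finite_prim[of N] by (auto simp: poly_prod has_val_def)
qed

text \<open>
  The Galois action \<open>T \<mapsto> \<omega> T\<close> permutes the expansions.  Two different expansions of the same height
  \<open>c / M\<close> differ exactly in valuation \<open>c / M\<close>, so an expansion whose term of that order is fixed by
  \<open>\<omega>\<close> is fixed itself.
\<close>

lemma rotation_fixed:
  fixes \<omega> :: complex
  assumes N: "N \<ge> 3" "N dvd M" and q: "(a, c) \<in> prim N" and \<omega>: "\<omega> \<noteq> 0" "\<omega> ^ (8 * M) = 1"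
    and fixed: "comp (xr (a, c) + 1) $$ (8 * c) = 0 \<or> \<omega> powi (8 * c) = 1"
    and nz: "xr (a, c) + 1 \<noteq> 0"
  shows "comp (xr (a, c)) $$ n * \<omega> powi n = comp (xr (a, c)) $$ n"
proof -
  define G where "G = fps_const \<omega> * fps_X"
  have G: "G \<noteq> 0" "G $ 0 = 0" "subdegree G = 1" using \<omega>(1) by (auto simp: G_def intro!: subdegreeI)
  define rho where "rho = (\<lambda>f. fls_compose_fps f G)"
  interpret rho: fhom rho unfolding rho_def by (rule fhom_compose_fps[OF G(1,2)])
  have nth: "rho f $$ n = f $$ n * \<omega> powi n" for f n
    using \<omega>(1) by (simp add: rho_def G_def fls_nth_fls_compose_fps_linear)
  have val: "has_val (rho f) n \<longleftrightarrow> has_val f n" for f n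
    using G by (simp add: has_val_def rho_def subdegree_fls_compose_fps fls_compose_fps_eq_0_iff)
  \<comment> \<open>As \<omega>^(8M) = 1, the rotation fixes s and with it Q(j); hence it maps roots
    of q_N to roots.\<close>
  have rs: "rho (comp s_series) = comp s_series"
  proof -
    have "rho fls_X = fls_const \<omega> * fls_X"
      using G(1,2) by (simp add: rho_def G_def fls_times_fps_to_fls)
    hence "rho (comp s_series) = fls_const (\<omega> ^ (8 * M)) * fls_X ^ (8 * M)"
      by (simp only: comp_s_series rho.power power_mult_distrib fls_const_power)
    thus ?thesis by (simp add: \<omega>(2) comp_s_series)
  qed
  have ce: "comp (emb r) = ev (comp s_series) r" for r
    unfolding emb_def by (rule fhom_ev_comp(2)[OF comp.fhom_axioms transc_s])
  have tc: "transc (comp s_series)" by (rule fhom_ev_comp(1)[OF comp.fhom_axioms transc_s])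
  have re: "rho (comp (emb r)) = comp (emb r)" for r
    unfolding ce fhom_ev_comp(2)[OF rho.fhom_axioms tc] rs ..
  define F where "F = comp (xr (a, c))"
  have "poly (map_poly (\<lambda>r. comp (emb r)) (q_poly N)) F = 0"
    using comp_root_iff[OF N] q by (auto simp: F_def)
  hence "rho (poly (map_poly (\<lambda>r. comp (emb r)) (q_poly N)) F) = 0" by simp
  hence "poly (map_poly (\<lambda>r. comp (emb r)) (q_poly N)) (rho F) = 0"
    unfolding rho.poly_mp[symmetric] map_poly_comp[OF fhom_comp[OF emb.fhom_axioms comp.fhom_axioms] rho.fhom_axioms] re .
  then obtain a' c' where q': "(a', c') \<in> prim N" "rho F = comp (xr (a', c'))"
    using comp_root_iff[OF N] by auto
  have H: "(a, c) \<in> H" "(a', c') \<in> H" using q q' by (auto simp: prim_def)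
  have rng: "0 \<le> c" "2 * c \<le> int M" "0 \<le> c'" "2 * c' \<le> int M" using H by (auto simp: half_system_def)
  have F1: "F + 1 = comp (xr (a, c) + 1)" "rho (F + 1) = comp (xr (a', c') + 1)"
    by (simp_all add: F_def comp.add rho.add flip: q'(2))
  have "has_val (xr (a, c) + 1) n \<longleftrightarrow> has_val (xr (a', c') + 1) n" for n
    by (metis F1 val has_val_comp)
  hence same: "fls_subdegree (xr (a', c') + 1) = fls_subdegree (xr (a, c) + 1)" "xr (a', c') + 1 \<noteq> 0"
    using nz by (auto simp: has_val_def)
  have "c' = c"
  proof (cases "2 * c = int M"; cases "2 * c' = int M")
    assume "2 * c = int M" "2 * c' \<noteq> int M"
    thus ?thesis using xr_plus_1(2)[OF H(1)] xr_plus_1(1)[OF H(2)] rng same nz by (auto simp: has_val_def)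
  next
    assume "2 * c \<noteq> int M" "2 * c' = int M"
    thus ?thesis using xr_plus_1(1)[OF H(1)] xr_plus_1(2)[OF H(2)] rng same nz by (auto simp: has_val_def)
  next
    assume "2 * c \<noteq> int M" "2 * c' \<noteq> int M"
    thus ?thesis using xr_plus_1(1)[OF H(1)] xr_plus_1(1)[OF H(2)] rng same nz by (auto simp: has_val_def)
  qed auto
  have "rho F = F"
  proof (cases "(a, c) = (a', c')")
    case False
    from xr_diff[OF H False] have "has_val (comp (xr (a, c) - xr (a', c'))) (8 * c)"
      using \<open>c' = c\<close> by (simp add: has_val_comp)
    hence ne: "(F - rho F) $$ (8 * c) \<noteq> 0"
      using nth_fls_subdegree_nonzero[of "F - rho F"] by (auto simp: has_val_def comp.diff F_def simp flip: q'(2))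
    have d: "(F - rho F) $$ (8 * c) = (F + 1) $$ (8 * c) - rho (F + 1) $$ (8 * c)"
      by (simp add: rho.add)
    have z: "(F + 1) $$ (8 * c) - rho (F + 1) $$ (8 * c) = 0" using fixed unfolding nth F1(1) by auto
    show ?thesis using ne unfolding d z by simp
  qed (use q' in \<open>simp add: F_def\<close>)
  thus ?thesis using nth[of F n] by (simp add: F_def)
qed

end

lemma fls_compose_power_exists:
  fixes f :: "complex fls"
  assumes "d > 0" "\<And>n. \<not> int d dvd n \<Longrightarrow> f $$ n = 0"
  obtains h where "fls_compose_power h d = f"
proof -
  define h where "h = Abs_fls (\<lambda>n. f $$ (int d * n))"
  have h: "h $$ n = f $$ (int d * n)" for n
    unfolding h_def
  \<comment> \<open>For negative \<open>n\<close> one has \<open>int d * n \<le> n\<close>, so the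
    old bound on exponents still serves.\<close>
  proof (rule nth_Abs_fls_lower_bound[of "- \<bar>fls_subdegree f\<bar>"], intro allI impI)
    fix n assume n: "n < - \<bar>fls_subdegree f\<bar>"
    hence "int d * n \<le> 1 * n" using assms(1) by (intro mult_right_mono_neg) auto
    thus "f $$ (int d * n) = 0" using n by (intro fls_eq0_below_subdegree) linarith
  qed
  have "fls_compose_power h d = f"
    by (rule fls_eqI) (use assms in \<open>auto simp: fls_nth_compose_power h\<close>)
  thus ?thesis using that by blast
qed

context tate
begin

text \<open>Invariance under rotations of order k = 8M/e shows that only powers of s^(1/e) occur.
  Conversely, the lowest exponent c0/N of p + 1 has reduced denominator e outside the exceptional
  case, where e = 1 leaves nothing to show.\<close>

lemma ramification_eq:
  assumes N: "N \<ge> 3" "N dvd M" and q: "(a, c) \<in> prim N"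
    and c: "c * int N = int c0 * int M" "c0 \<le> N div 2"
    and v: "v_s (puis (xr (a, c)) + 1) = ereal (if N = 4 \<and> c0 = 2 then 1 else real c0 / real N)"
  shows "ramification (puis (xr (a, c))) = e_cusp c0 N"
proof -
  define special where "special \<longleftrightarrow> N = 4 \<and> c0 = 2"
  define g where "g = gcd c0 N"
  define e where "e = e_cusp c0 N"
  have g: "g > 0" "g dvd N" "g dvd c0" using N by (auto simp: g_def)
  have e_eq: "e = (if special then 1 else N div g)" by (simp add: e_def e_cusp_def special_def g_def)
  have "N div g dvd N" using g(2) by (metis dvd_mult_div_cancel dvd_triv_right)
  hence eN: "e dvd N" by (simp add: e_eq)
  have e0: "e > 0" using eN N by (auto intro!: Nat.gr0I)
  define k where "k = 8 * M div e"
  have "e dvd 8 * M" using eN N(2) by (meson dvd_mult dvd_trans)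
  hence k: "8 * M = k * e" by (simp add: k_def)
  have k0: "k > 0" using k M_pos by (auto intro!: Nat.gr0I)
  have E0: "8 * M > 0" using M_pos by simp
  have v1: "puis (xr (a, c)) + 1 = puiseux_of (8 * M) (comp (xr (a, c) + 1))"
    by (simp add: puis.add flip: puis_def)
  define F1 where "F1 = comp (xr (a, c) + 1)"
  have F1: "F1 \<noteq> 0" "real_of_int (fls_subdegree F1) = (if special then 1 else real c0 / real N) * real (8 * M)"
    using v unfolding v1 F1_def[symmetric] v_s_puiseux_of[OF E0] special_def using E0
    by (auto split: if_splits simp: field_simps)
  have nz: "xr (a, c) + 1 \<noteq> 0" using F1(1) by (auto simp: F1_def)
  have rc: "real_of_int (8 * c) = real c0 / real N * real (8 * M)"
  proof -
    have "real_of_int (c * int N) = real_of_int (int c0 * int M)" using c(1) by simp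
    thus ?thesis using N by (simp add: field_simps)
  qed
  have fixed: "F1 $$ (8 * c) = 0 \<or> \<omega> powi (8 * c) = 1" if \<omega>: "\<omega> ^ k = 1" for \<omega> :: complex
  proof (cases special)
    case True
    hence "real_of_int (8 * c) < real_of_int (fls_subdegree F1)"
      using rc F1(2) M_pos by (simp add: special_def)
    hence "8 * c < fls_subdegree F1" by linarith
    thus ?thesis by simp
  next
    case False
    have "8 * c * int N = int c0 * int (8 * M)" using c(1) by simp
    also have "int (8 * M) = int k * int e" by (simp add: k)
    finally have "8 * c * (int g * int e) = int g * int (c0 div g) * (int k * int e)"
      using False g by (simp add: e_eq flip: of_nat_mult)
    hence "8 * c = int (k * (c0 div g))" using g e0 by simp
    hence "\<omega> powi (8 * c) = \<omega> ^ (k * (c0 div g))" by (metis power_int_of_nat)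
    thus ?thesis by (simp add: power_mult \<omega>)
  qed
  define F where "F = comp (xr (a, c))"
  have coeff: "F $$ n = 0" if n: "\<not> int k dvd n" for n
  proof -
    \<comment> \<open>A primitive k-th root of unity: its n-th power is 1 only for multiples n of
      k.\<close>
    define \<omega> where "\<omega> = cis (2 * pi / k)"
    have w: "\<omega> \<noteq> 0" "\<omega> ^ k = 1" using k0 by (simp_all add: \<omega>_def DeMoivre)
    have "\<omega> ^ (8 * M) = 1" using w by (simp add: k power_mult)
    hence "F $$ n * \<omega> powi n = F $$ n"
      unfolding F_def using rotation_fixed[OF N q w(1) _ fixed[OF w(2), unfolded F1_def] nz] by blast
    moreover have "\<omega> powi n \<noteq> 1"
    proof
      assume "\<omega> powi n = 1"
      hence "cis (n * (2 * pi / k)) = 1" by (simp add: \<omega>_def cis_power_int)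
      hence "cos (n * (2 * pi / k)) = 1" by (simp add: complex_eq_iff)
      then obtain m :: int where "n * (2 * pi / k) = m * 2 * pi" by (auto simp: cos_one_2pi_int)
      hence "real_of_int n = real_of_int (int k * m)" using k0 by (simp add: field_simps)
      hence "n = int k * m" by (simp only: of_int_eq_iff)
      thus False using n by simp
    qed
    ultimately show ?thesis by simp
  qed
  obtain h where "fls_compose_power h k = F" using fls_compose_power_exists[OF k0 coeff] by blast
  hence "puis (xr (a, c)) = puiseux_of e h"
    unfolding puis_def F_def[symmetric] k using puiseux_of_compose_power[OF k0 e0, of h] by simp
  hence mem: "e > 0 \<and> puis (xr (a, c)) \<in> range (puiseux_of e)" using e0 by simp
  have min: "e \<le> d" if d: "d > 0 \<and> puis (xr (a, c)) \<in> range (puiseux_of d)" for d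
  proof (cases special)
    case False
    obtain h where h: "puis (xr (a, c)) = puiseux_of d h" using d by auto
    interpret pd: fhom "puiseux_of d" by (rule fhom_puiseux_of) (use d in simp)
    have "puis (xr (a, c)) + 1 = puiseux_of d (h + 1)" by (simp add: h pd.add)
    hence "ereal (real c0 / real N) = v_s (puiseux_of d (h + 1))"
      using v False by (simp add: special_def)
    hence "real c0 / real N = real_of_int (fls_subdegree (h + 1)) / real d"
      using d by (auto simp: v_s_puiseux_of split: if_splits)
    hence "real_of_int (int c0 * int d) = real_of_int (fls_subdegree (h + 1) * int N)"
      using d N by (simp add: field_simps)
    hence "int c0 * int d = fls_subdegree (h + 1) * int N" by (simp only: of_int_eq_iff)
    hence "int N dvd int c0 * int d" by simp
    hence "N dvd c0 * d" by (simp flip: of_nat_mult add: int_dvd_int_iff)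
    hence "e * g dvd (c0 div g) * d * g" using g False by (simp add: e_eq mult.commute mult.left_commute)
    hence "e dvd (c0 div g) * d" using g by simp
    moreover have "coprime e (c0 div g)"
    proof -
      have "coprime (c0 div g) (N div g)" unfolding g_def using N by (intro div_gcd_coprime) auto
      thus ?thesis using False by (simp add: e_eq coprime_commute)
    qed
    ultimately have "e dvd d" by (simp add: coprime_dvd_mult_right_iff)
    thus ?thesis using d by (auto intro: dvd_imp_le)
  qed (use d in \<open>simp add: e_eq\<close>)
  show ?thesis unfolding ramification_def e_def[symmetric] by (rule Least_equality) (use mem min in auto)
qed

end

section \<open>Arithmetic origin of the numbers n_c(k)\<close>

subsection \<open>Counting points of given order and height\<close>

lemma card_coprime_periodic:
  fixes d m :: nat
  assumes "d > 0"
  shows "card {a \<in> {..<d * m}. coprime a d} = m * totient d"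
proof (induction m)
  case (Suc m)
  have split: "{a \<in> {..<d * Suc m}. coprime a d} = {a \<in> {..<d * m}. coprime a d} \<union> (\<lambda>a. d * m + a) ` {a \<in> {..<d}. coprime a d}"
  proof (intro equalityI subsetI)
    fix x assume x: "x \<in> {a \<in> {..<d * Suc m}. coprime a d}"
    show "x \<in> {a \<in> {..<d * m}. coprime a d} \<union> (\<lambda>a. d * m + a) ` {a \<in> {..<d}. coprime a d}"
    proof (cases "x < d * m")
      case False
      then obtain y where y: "x = d * m + y" using le_Suc_ex by (metis not_less)
      have "gcd (d * m + y) d = gcd y d" by (metis add.commute gcd.commute gcd_add_mult mult.commute)
      hence "coprime y d" using x y by (simp add: coprime_iff_gcd_eq_1)
      thus ?thesis using x y by auto
    qed (use x in auto)
  next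
    fix x assume "x \<in> {a \<in> {..<d * m}. coprime a d} \<union> (\<lambda>a. d * m + a) ` {a \<in> {..<d}. coprime a d}"
    moreover have "gcd (d * m + y) d = gcd y d" for y by (metis add.commute gcd.commute gcd_add_mult mult.commute)
    ultimately show "x \<in> {a \<in> {..<d * Suc m}. coprime a d}" by (auto simp: coprime_iff_gcd_eq_1)
  qed
  have c1: "card {a \<in> {..<d}. coprime a d} = totient d"
  proof (cases "d = 1")
    case False
    have "{a \<in> {..<d}. coprime a d} = totatives d"
      using assms False by (auto simp: totatives_def intro!: Nat.gr0I le_neq_implies_less)
    thus ?thesis by (simp add: totient_def)
  next
    case True
    have "{a::nat. a < 1} = {0}" by auto
    thus ?thesis by (simp add: True)
  qed
  have c2: "card ((\<lambda>a. d * m + a) ` {a \<in> {..<d}. coprime a d}) = card {a \<in> {..<d}. coprime a d}"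
    by (rule card_image) simp
  have "card {a \<in> {..<d * Suc m}. coprime a d} = card {a \<in> {..<d * m}. coprime a d} + card ((\<lambda>a. d * m + a) ` {a \<in> {..<d}. coprime a d})"
    unfolding split by (rule card_Un_disjoint) auto
  thus ?case unfolding Suc.IH c2 c1 by simp
qed simp

definition prim_half :: "nat \<Rightarrow> (int \<times> int) set" where
  "prim_half k = {q \<in> half_system (int k). gcd (gcd (fst q) (snd q)) (int k) = 1}"

text \<open>Exact order k means that a is prime to d = gcd(c, k). Below height 1/2, a runs through
  all residues modulo k, that is k/d periods of length d; at height 1/2 one has d = c and a runs
  below c only.\<close>

lemma card_prim_half_fibre:
  assumes "k \<ge> 3" "1 \<le> c" "c \<le> k div 2"
  shows "card {q \<in> prim_half k. snd q = int c} = n_count c k"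
proof -
  define d where "d = gcd c k"
  have d: "d > 0" "d dvd k" using assms by (auto simp: d_def)
  have cop: "gcd (gcd (int a) (int c)) (int k) = 1 \<longleftrightarrow> coprime a d" for a
    by (simp add: d_def coprime_iff_gcd_eq_1 gcd.assoc gcd_int_int_eq)
  show ?thesis
  proof (cases "2 * c = k")
    case False
    have "{q \<in> prim_half k. snd q = int c} = (\<lambda>a. (int a, int c)) ` {a \<in> {..<d * (k div d)}. coprime a d}"
    proof (intro equalityI subsetI)
      fix q assume q: "q \<in> {q \<in> prim_half k. snd q = int c}"
      then obtain a' where "q = (a', int c)" "0 \<le> a'" by (cases q) (auto simp: prim_half_def half_system_def)
      then obtain a where a: "q = (int a, int c)" by (metis nonneg_int_cases)
      hence "a < k" "gcd (gcd (int a) (int c)) (int k) = 1" using q by (auto simp: prim_half_def half_system_def)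
      thus "q \<in> (\<lambda>a. (int a, int c)) ` {a \<in> {..<d * (k div d)}. coprime a d}" using cop d a by auto
    next
      fix q assume "q \<in> (\<lambda>a. (int a, int c)) ` {a \<in> {..<d * (k div d)}. coprime a d}"
      then obtain a where "q = (int a, int c)" "a < k" "coprime a d" using d by auto
      thus "q \<in> {q \<in> prim_half k. snd q = int c}"
        using cop assms False by (auto simp: prim_half_def half_system_def)
    qed
    hence "card {q \<in> prim_half k. snd q = int c} = k div d * totient d"
      using card_coprime_periodic[OF d(1), of "k div d"] by (simp add: card_image inj_on_def)
    thus ?thesis using assms False by (auto simp: n_count_def d_def mult.commute)
  next
    case True
    hence dc: "d = c" by (simp add: d_def flip: True)
    have c2: "c \<ge> 2" using assms True by simp
    have "{q \<in> prim_half k. snd q = int c} = (\<lambda>a. (int a, int c)) ` totatives c"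
    proof (intro equalityI subsetI)
      fix q assume q: "q \<in> {q \<in> prim_half k. snd q = int c}"
      then obtain a' where "q = (a', int c)" "0 \<le> a'" by (cases q) (auto simp: prim_half_def half_system_def)
      then obtain a where a: "q = (int a, int c)" by (metis nonneg_int_cases)
      hence "0 < a" "a < c" "gcd (gcd (int a) (int c)) (int k) = 1"
        using q True by (auto simp: prim_half_def half_system_def)
      thus "q \<in> (\<lambda>a. (int a, int c)) ` totatives c" using cop dc a by (auto simp: totatives_def)
    next
      fix q assume "q \<in> (\<lambda>a. (int a, int c)) ` totatives c"
      then obtain a where a: "q = (int a, int c)" "0 < a" "a \<le> c" "coprime a c" by (auto simp: totatives_def)
      \<comment> \<open>Totatives of c include c itself only for c = 1, which k \<ge> 3 rules
        out.\<close>
      hence "a \<noteq> c" using c2 by auto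
      thus "q \<in> {q \<in> prim_half k. snd q = int c}"
        using a cop dc True by (auto simp: prim_half_def half_system_def)
    qed
    hence "card {q \<in> prim_half k. snd q = int c} = totient c"
      by (simp add: card_image inj_on_def totient_def)
    thus ?thesis using assms True by (auto simp: n_count_def)
  qed
qed

lemma (in tate) bij_prim:
  assumes "k dvd M" "k > 0"
  shows "bij_betw (\<lambda>q. (int (M div k) * fst q, int (M div k) * snd q)) (prim_half k) (prim k)"
proof -
  let ?f = "\<lambda>q. (int (M div k) * fst q, int (M div k) * snd q)"
  define e where "e = int (M div k)"
  have Me: "int M = e * int k" using assms(1) by (simp add: e_def flip: of_nat_mult)
  have e0: "e > 0" using Me M_pos by (metis e_def mult_eq_0_iff of_nat_0_less_iff of_nat_eq_0_iff gr0I)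
  have ord: "ord (?f q) = k \<longleftrightarrow> gcd (gcd (fst q) (snd q)) (int k) = 1" for q
  proof -
    define d where "d = gcd (gcd (fst q) (snd q)) (int k)"
    have d: "d > 0" "d dvd int k" using assms(2) by (auto simp: d_def)
    have "gcd (gcd (fst (?f q)) (snd (?f q))) (int M) = e * d"
      unfolding Me d_def e_def[symmetric] using e0 by (simp add: gcd_mult_left)
    hence "int (ord (?f q)) = int M div (e * d)"
      unfolding ord_def using e0 d(1) by (simp add: zdiv_int)
    also have "\<dots> = int k div d" unfolding Me using e0 by simp
    finally have "int (ord (?f q)) = int k div d" .
    hence "ord (?f q) = k \<longleftrightarrow> int k div d = int k" by (metis of_nat_eq_iff)
    also have "\<dots> \<longleftrightarrow> d = 1"
    proof
      assume "int k div d = int k"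
      hence "int k = d * int k" using d(2) by (metis dvd_mult_div_cancel)
      thus "d = 1" using assms(2) by simp
    qed simp
    finally show ?thesis by (simp add: d_def)
  qed
  have "bij_betw f {x \<in> A. P (f x)} {y \<in> B. P y}" if "bij_betw f A B"
    for f :: "int \<times> int \<Rightarrow> int \<times> int" and A B P
    using that by (auto simp: bij_betw_def inj_on_def)
  from this[OF bij_scale[OF assms], of "\<lambda>q. ord q = k"]
  have "bij_betw ?f {q \<in> half_system (int k). ord (?f q) = k} {q \<in> torsion k. ord q = k}" .
  moreover have "{q \<in> torsion k. ord q = k} = prim k" by (auto simp: torsion_def prim_def)
  ultimately show ?thesis by (simp add: ord prim_half_def)
qed

lemma sum_prim_half:
  assumes "k \<ge> 3" "t \<ge> 0"
  shows "(\<Sum>q\<in>prim_half k. min t (real_of_int (snd q) / real k)) =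
    (\<Sum>c = 1..k div 2. real (n_count c k) * min t (real c / real k))"
proof -
  have fin: "finite (prim_half k)" unfolding prim_half_def using finite_half_system by simp
  have nn: "0 \<le> snd q \<and> snd q \<le> int (k div 2)" if "q \<in> prim_half k" for q
    using that by (auto simp: prim_half_def half_system_def zdiv_int)
  have "(\<Sum>q\<in>prim_half k. min t (real_of_int (snd q) / real k)) =
    (\<Sum>c\<in>{0..k div 2}. \<Sum>q\<in>{q \<in> prim_half k. nat (snd q) = c}. min t (real_of_int (snd q) / real k))"
    by (rule sum.group[symmetric]) (use fin nn in \<open>auto simp: nat_le_iff\<close>)
  also have "\<dots> = (\<Sum>c\<in>{0..k div 2}. real (card {q \<in> prim_half k. nat (snd q) = c}) * min t (real c / real k))"
  proof (rule sum.cong[OF refl])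
    fix c
    have "(\<Sum>q\<in>{q \<in> prim_half k. nat (snd q) = c}. min t (real_of_int (snd q) / real k)) =
      (\<Sum>q\<in>{q \<in> prim_half k. nat (snd q) = c}. min t (real c / real k))"
      by (rule sum.cong) (use nn in auto)
    thus "(\<Sum>q\<in>{q \<in> prim_half k. nat (snd q) = c}. min t (real_of_int (snd q) / real k)) =
      real (card {q \<in> prim_half k. nat (snd q) = c}) * min t (real c / real k)" by simp
  qed
  also have "\<dots> = (\<Sum>c\<in>{1..k div 2}. real (card {q \<in> prim_half k. nat (snd q) = c}) * min t (real c / real k))"
    \<comment> \<open>The term of height 0 contributes \<open>min t 0\<close>, which is 0 because t
      \<ge> 0.\<close>
    by (rule sum.mono_neutral_right) (use assms(2) in \<open>auto simp: not_le\<close>)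
  also have "\<dots> = (\<Sum>c = 1..k div 2. real (n_count c k) * min t (real c / real k))"
  proof (rule sum.cong[OF refl])
    fix c assume c: "c \<in> {1..k div 2}"
    have "{q \<in> prim_half k. nat (snd q) = c} = {q \<in> prim_half k. snd q = int c}" using c nn by fastforce
    thus "real (card {q \<in> prim_half k. nat (snd q) = c}) * min t (real c / real k) = real (n_count c k) * min t (real c / real k)"
      using card_prim_half_fibre[OF assms(1)] c by simp
  qed
  finally show ?thesis .
qed

lemma (in tate) sum_prim:
  assumes "k \<ge> 3" "k dvd M" "c \<ge> 0"
  shows "real_of_int (\<Sum>r\<in>prim k. 8 * min c (snd r)) / (8 * real M) =
    (\<Sum>c' = 1..k div 2. real (n_count c' k) * min (real_of_int c / real M) (real c' / real k))"
proof -
  have k0: "k > 0" using assms by simp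
  have e: "real M = real (M div k) * real k" using assms(2) by (simp flip: of_nat_mult)
  have "(\<Sum>r\<in>prim k. 8 * min c (snd r)) = (\<Sum>q\<in>prim_half k. 8 * min c (int (M div k) * snd q))"
    using sum.reindex_bij_betw[OF bij_prim[OF assms(2) k0], of "\<lambda>r. 8 * min c (snd r)"] by simp
  hence "real_of_int (\<Sum>r\<in>prim k. 8 * min c (snd r)) / (8 * real M) =
      (\<Sum>q\<in>prim_half k. real_of_int (8 * min c (int (M div k) * snd q)) / (8 * real M))"
    by (simp add: sum_divide_distrib)
  also have "\<dots> = (\<Sum>q\<in>prim_half k. min (real_of_int c / real M) (real_of_int (snd q) / real k))"
  proof (rule sum.cong[OF refl])
    fix q
    have "real_of_int (8 * min c (int (M div k) * snd q)) / (8 * real M) =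
      min (real_of_int c) (real (M div k) * real_of_int (snd q)) / real M" by (simp add: of_int_min)
    also have "\<dots> = min (real_of_int c / real M) (real (M div k) * real_of_int (snd q) / real M)"
      using M_pos by (simp add: min_divide_distrib_right)
    also have "real (M div k) * real_of_int (snd q) / real M = real_of_int (snd q) / real k"
    proof -
      have "real (M div k) \<noteq> 0"
      proof
        assume "real (M div k) = 0"
        thus False using e M_pos by simp
      qed
      thus ?thesis using k0 unfolding e by simp
    qed
    finally show "real_of_int (8 * min c (int (M div k) * snd q)) / (8 * real M) =
      min (real_of_int c / real M) (real_of_int (snd q) / real k)" .
  qed
  also have "\<dots> = (\<Sum>c' = 1..k div 2. real (n_count c' k) * min (real_of_int c / real M) (real c' / real k))"
    by (rule sum_prim_half) (use assms in auto)
  finally show ?thesis .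
qed

section \<open>Assembly of the order of F_k\<close>

section \<open>The valuation of \<open>F\<^sub>k\<close> at a cusp\<close>

lemma has_val_prod:
  assumes "finite A" "\<And>x. x \<in> A \<Longrightarrow> has_val (f x) (n x)"
  shows "has_val (prod f A) (sum n A)"
  using assms
proof (induction A)
  case (insert x A)
  thus ?case using has_val_mult[of "f x" "n x" "prod f A" "sum n A"] by simp
qed (simp add: has_val_def)

lemma F_ratfun_eqI:
  assumes "F_fun k = of_poly n / of_poly d" "d \<noteq> 0"
  shows "F_ratfun k = Fraction_Field.Fract n d"
proof -
  interpret fhom of_ratfun by (rule fhom_of_ratfun)
  have "Fraction_Field.Fract n d = to_fract n / to_fract d" using assms(2) by (simp add: to_fract_def)
  hence "of_ratfun (Fraction_Field.Fract n d) = F_fun k" by (simp add: assms(1) of_poly_def divide)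
  thus ?thesis unfolding F_ratfun_def using eq_iff by (intro the_equality) metis+
qed

lemma prim_div_pol_2_power: "prim_div_pol 2 ^ (2 * n) = of_poly ((4 * weierstrass_rhs) ^ n)"
proof -
  interpret tate 1 by unfold_locales simp
  have "prim_div_pol 2 ^ 2 = of_poly (4 * weierstrass_rhs)"
    unfolding prim_div_pol_2 by (simp add: power_mult_distrib cf_y_sq of_poly_hom)
  thus ?thesis by (simp add: power_mult of_poly_hom)
qed

context tate
begin

text \<open>The cubic is the square of y = W 2 / 2, whose theta expression has valuation 8c.\<close>

lemma has_val_weierstrass:
  assumes "(a, c) \<in> H"
  shows "has_val (poly (emb.mp weierstrass_rhs) (xr (a, c))) (16 * c)"
proof -
  have k2: "has_val (kappa ^ 2) (2 * int M)" using has_val_kappa_sq by (simp add: kappa_sq)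
  hence k: "has_val kappa (int M)" using kappa_nonzero by (simp add: has_val_def fls_subdegree_pow)
  have t: "has_val (T (pt b d)) (int M - \<bar>4 * d\<bar>)" if "\<not> is_zero (pt b d)" "\<bar>4 * d\<bar> \<le> 4 * int M" for b d
  proof -
    obtain z where z: "pt b d = (z, 4 * d)" by (simp add: pt_def)
    show ?thesis using theta_has_val[of z "4 * d"] that unfolding z by blast
  qed
  have c: "0 \<le> c" "2 * c \<le> int M" using assms by (auto simp: half_system_def)
  have t1: "has_val (T (pt a c)) (int M - 4 * c)"
    using t[of a c] H_not_zero[OF assms] c unfolding is_zero_pt by auto
  have t2: "has_val (T (pt (2 * a) (2 * c))) (int M - 8 * c)"
    using t[of "2 * a" "2 * c"] H_not_two_torsion[OF assms] c unfolding is_zero_pt by auto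
  have "has_val ((kappa / T (pt a c)) ^ 4 * T (pt (2 * a) (2 * c)) / kappa / 2)
      (int 4 * (int M - (int M - 4 * c)) + (int M - 8 * c) - int M - 0)"
    by (intro has_val_divide has_val_mult has_val_power k t1 t2 has_val_numeral)
  hence "has_val (W 2 (pt a c) / 2) (8 * c)" by (simp add: W_def smul_pt)
  hence "has_val ((W 2 (pt a c) / 2) ^ 2) (int 2 * (8 * c))" by (rule has_val_power)
  thus ?thesis
    using poly_fpol(2)[OF emb.fhom_axioms] W_initial(1)[OF theta_H[OF assms]] by (simp add: xr_def emb_curve)
qed

lemma has_val_q_poly:
  assumes "k \<ge> 3" "k dvd M" "(a, c) \<in> H" "ord (a, c) \<noteq> k"
  shows "has_val (poly (emb.mp (q_poly k)) (xr (a, c))) (\<Sum>r\<in>prim k. 8 * min c (snd r))"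
proof -
  obtain lc where lc: "has_val lc 0" "emb.mp (q_poly k) = smult lc (\<Prod>q\<in>prim k. [:- xr q, 1:])"
    using q_poly_factorization[OF assms(1,2)] by blast
  have "has_val (\<Prod>q\<in>prim k. xr (a, c) - xr q) (\<Sum>r\<in>prim k. 8 * min c (snd r))"
  proof (rule has_val_prod[OF finite_prim])
    fix q assume "q \<in> prim k"
    hence "(fst q, snd q) \<in> H" "(a, c) \<noteq> (fst q, snd q)" using assms(4) by (auto simp: prim_def)
    from xr_diff[OF assms(3) this] show "has_val (xr (a, c) - xr q) (8 * min c (snd q))" by simp
  qed
  hence "has_val (lc * (\<Prod>q\<in>prim k. xr (a, c) - xr q)) (0 + (\<Sum>r\<in>prim k. 8 * min c (snd r)))"
    by (rule has_val_mult[OF lc(1)])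
  thus ?thesis unfolding lc(2) by (simp add: poly_prod)
qed

lemma v_s_ratfun:
  assumes "has_val (poly (emb.mp n) x) m" "has_val (poly (emb.mp d) x) m'"
  shows "v_s (ratfun_eval Qj_embed (puis x) (Fraction_Field.Fract n d)) = ereal (of_int (m - m') / (8 * real M))"
proof -
  have "poly (map_poly Qj_embed d) (puis x) \<noteq> 0"
    unfolding poly_puis using assms(2) by (simp add: has_val_def)
  hence "ratfun_eval Qj_embed (puis x) (Fraction_Field.Fract n d) = puis (poly (emb.mp n) x / poly (emb.mp d) x)"
    using ratfun_eval_Fract[OF fhom_Qj_embed] by (simp add: poly_puis puis.divide)
  thus ?thesis using v_s_puis[OF has_val_divide[OF assms]] by simp
qed

lemma has_val_w_power:
  assumes "(a, c) \<in> H"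
  shows "has_val (poly (emb.mp ((4 * weierstrass_rhs) ^ n)) (xr (a, c))) (int n * (16 * c))"
proof -
  have "has_val (4 * poly (emb.mp weierstrass_rhs) (xr (a, c))) (0 + 16 * c)"
    by (intro has_val_mult has_val_numeral has_val_weierstrass assms)
  from has_val_power[OF this, of n] show ?thesis by (simp add: emb.poly_mp_hom)
qed

text \<open>j_0 is a unit and j_0 - 1 is a unit times s; this is the source of the summand -1 in
  v_2.\<close>

lemma has_val_F2_denominator: "has_val (emb (1728 * j0 ^ 2 * (j0 - 1))) (8 * int M)"
proof -
  have E: "E4 \<noteq> 0" "E6 \<noteq> 0" using has_val_E4 has_val_E6 by (auto simp: has_val_def)
  have "- 3 * emb j0 = - 3 * (E4 ^ 3 / E6 ^ 2)"
    using emb_curve(1) by (simp add: curve_a_def a_ser_def emb.mult emb.uminus emb.numeral)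
  hence j: "emb j0 = E4 ^ 3 / E6 ^ 2" by (simp only: mult_cancel_left) simp
  have "E4 ^ 3 / E6 ^ 2 - 1 = (E4 ^ 3 - E6 ^ 2) / E6 ^ 2" using E by (simp add: diff_divide_distrib)
  hence j1: "emb (j0 - 1) = 1728 * E4 ^ 3 * s_series / E6 ^ 2" by (simp add: emb.diff j E4_E6)
  have "has_val (1728 * (E4 ^ 3 / E6 ^ 2) ^ 2 * (1728 * E4 ^ 3 * s_series / E6 ^ 2))
    (0 + int 2 * (int 3 * 0 - int 2 * 0) + (0 + int 3 * 0 + 8 * int M - int 2 * 0))"
    by (intro has_val_mult has_val_power has_val_divide has_val_E4 has_val_E6 has_val_numeral has_val_s_series)
  thus ?thesis by (simp add: emb.mult emb.power emb.numeral j j1)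
qed

lemma v_s_F:
  assumes k: "k > 1" "k dvd M" and q: "(a, c) \<in> H" "ord (a, c) \<noteq> k"
  shows "v_s (ratfun_eval Qj_embed (puis (xr (a, c))) (F_ratfun k)) = ereal (v_fun k (real_of_int c / real M))"
proof -
  have M0: "real M > 0" using M_pos by simp
  have w0: "(4 * weierstrass_rhs) ^ n \<noteq> 0" for n
    using has_val_nonzero[OF has_val_w_power[OF q(1), of n]] by (metis emb.mp_0 poly_0)
  show ?thesis
  proof (cases "k = 2")
    case True
    define D where "D = 1728 * j0 ^ 2 * (j0 - 1)"
    have D: "has_val (emb D) (8 * int M)" unfolding D_def by (rule has_val_F2_denominator)
    have "F_fun k = of_poly ((4 * weierstrass_rhs) ^ 2) / of_poly [:D:]"
      using prim_div_pol_2_power[of 2] by (simp add: F_fun_def True D_def of_poly_hom(7))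
    moreover have "[:D:] \<noteq> 0" using D by (auto simp: has_val_def)
    ultimately have F: "F_ratfun k = Fraction_Field.Fract ((4 * weierstrass_rhs) ^ 2) [:D:]" by (rule F_ratfun_eqI)
    have d: "has_val (poly (emb.mp [:D:]) (xr (a, c))) (8 * int M)" using D by (simp add: emb.mp_pCons)
    show ?thesis unfolding F v_s_ratfun[OF has_val_w_power[OF q(1)] d]
      using M0 by (simp add: v_fun_def True field_simps)
  next
    case False
    hence k3: "k \<ge> 3" using k by simp
    have pq: "prim_div_pol k = of_poly (q_poly k)" by (rule prim_div_pol_q_poly(1)[OF k3])
    note qv = has_val_q_poly[OF k3 k(2) q]
    have c0: "c \<ge> 0" using q by (simp add: half_system_def)
    note sp = sum_prim[OF k3 k(2) c0]
    define S where "S = (\<Sum>r\<in>prim k. 8 * min c (snd r))"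
    show ?thesis
    proof (cases "k = 3")
      case True
      have "F_fun k = of_poly (q_poly k ^ 3) / of_poly ((4 * weierstrass_rhs) ^ 4)"
        using prim_div_pol_2_power[of 4] pq by (simp add: F_fun_def True of_poly_hom)
      hence F: "F_ratfun k = Fraction_Field.Fract (q_poly k ^ 3) ((4 * weierstrass_rhs) ^ 4)" using w0 by (rule F_ratfun_eqI)
      have n: "has_val (poly (emb.mp (q_poly k ^ 3)) (xr (a, c))) (int 3 * S)"
        using has_val_power[OF qv, of 3] by (simp add: emb.poly_mp_hom S_def)
      have num: "num_exact_order 3 = 8" using num_exact_order_eq[of 3] degree_q_poly_3 by simp
      \<comment> \<open>The denominator q_2^8 has valuation 8t, which is 3 times m_3 t / 3 with m_3
        = 8.\<close>
      have "real_of_int (int 3 * S - int 4 * (16 * c)) / (8 * real M) = 3 * (real_of_int S / (8 * real M) - 8 / 3 * (real_of_int c / real M))"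
        using M0 by (simp add: field_simps)
      thus ?thesis unfolding F v_s_ratfun[OF n has_val_w_power[OF q(1)]]
        using sp by (simp add: v_fun_def True num S_def)
    next
      case False
      hence "6 dvd degree (q_poly k)" using k3 by (intro six_dvd_degree_q_poly) simp
      then obtain h where h: "degree (q_poly k) = 6 * h" by (elim dvdE)
      have num: "num_exact_order k = 12 * h" using num_exact_order_eq[OF k3] h by simp
      have "F_fun k = of_poly (q_poly k) / of_poly ((4 * weierstrass_rhs) ^ (2 * h))"
        using prim_div_pol_2_power[of "2 * h"] pq \<open>k \<noteq> 2\<close> False by (simp add: F_fun_def num)
      hence F: "F_ratfun k = Fraction_Field.Fract (q_poly k) ((4 * weierstrass_rhs) ^ (2 * h))" using w0 by (rule F_ratfun_eqI)
      have "real_of_int (S - int (2 * h) * (16 * c)) / (8 * real M) = real_of_int S / (8 * real M) - real (12 * h) / 3 * (real_of_int c / real M)"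
        using M0 by (simp add: field_simps)
      thus ?thesis unfolding F v_s_ratfun[OF qv has_val_w_power[OF q(1)]]
        using sp \<open>k \<noteq> 2\<close> False by (simp add: v_fun_def num S_def)
    qed
  qed
qed

end

theorem theorem4p2:
  fixes N k c :: nat and C :: "puiseux set"
  assumes "N > 2" and "k > 1" and "k \<noteq> N" and "c \<le> N div 2"
    and "is_cusp N c C"
  shows "cusp_order C (F_ratfun k) = ereal (real (e_cusp c N) * v_fun k (real c / real N))"
proof -
  \<comment> \<open>Both orders divide N k. As k differs from N, the cusp expansions are not among
    the roots of q_k.\<close>
  interpret tate "N * k" by unfold_locales (use assms in simp)
  have N: "N \<ge> 3" "N dvd N * k" using assms by auto
  have C: "C \<in> cusps N" and v: "\<And>p. p \<in> C \<Longrightarrow> v_s (p + 1) = ereal (if N = 4 \<and> c = 2 then 1 else real c / real N)"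
    using assms(5) by (auto simp: is_cusp_def)
  have ne: "C \<noteq> {}" by (rule cusp_nonempty[OF N(1) C])
  have val: "ereal (real (ramification p)) * v_s (ratfun_eval Qj_embed p (F_ratfun k)) =
      ereal (real (e_cusp c N) * v_fun k (real c / real N))" if p: "p \<in> C" for p
  proof -
    have "p \<in> puis ` xr ` prim N" using cusp_subset[OF C] p expansions_eq[OF N] by auto
    then obtain a c' where q: "(a, c') \<in> prim N" "p = puis (xr (a, c'))" by auto
    have H: "(a, c') \<in> H" "ord (a, c') = N" using q by (auto simp: prim_def)
    have rng: "0 \<le> c'" "2 * c' \<le> int (N * k)" using H by (auto simp: half_system_def)
    have M0: "real (N * k) > 0" using M_pos by simp
    have p1: "p + 1 = puis (xr (a, c') + 1)" by (simp add: q puis.add)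
    have cN: "real c / real N \<le> 1 / 2" using assms(1,4) by (simp add: field_simps)
    \<comment> \<open>The height is recovered from the valuation of p + 1. Below 1/2 they agree, and
      the exceptional value 1 cannot occur; at height 1/2 the lower bound 1/2 meets c/N \<le>
      1/2.\<close>
    have "real_of_int c' / real (N * k) = real c / real N"
    proof (cases "2 * c' < int (N * k)")
      case True
      have "v_s (p + 1) = ereal (real_of_int (8 * c') / (8 * real (N * k)))"
        unfolding p1 by (rule v_s_puis[OF xr_plus_1(1)[OF H(1) True]])
      hence e: "(if N = 4 \<and> c = 2 then 1 else real c / real N) = real_of_int c' / real (N * k)"
        using v[OF p] by simp
      have "2 * real_of_int c' < real (N * k)" using True by linarith
      hence "real_of_int c' / real (N * k) < 1 / 2" using M0 by (simp add: field_simps)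
      thus ?thesis using e by (simp split: if_splits)
    next
      case False
      hence c': "2 * c' = int (N * k)" using rng by simp
      have nz: "xr (a, c') + 1 \<noteq> 0"
      proof
        assume "xr (a, c') + 1 = 0"
        hence "v_s (p + 1) = \<infinity>" unfolding p1 using assms(1,2) by (simp add: puis_def v_s_puiseux_of comp.zero)
        thus False using v[OF p] by simp
      qed
      hence "has_val (xr (a, c') + 1) (fls_subdegree (xr (a, c') + 1))" by (simp add: has_val_def)
      from v_s_puis[OF this] v[OF p]
      have e: "(if N = 4 \<and> c = 2 then 1 else real c / real N) = real_of_int (fls_subdegree (xr (a, c') + 1)) / (8 * real (N * k))"
        unfolding p1 by simp
      have "fls_subdegree (xr (a, c') + 1) \<ge> 4 * int (N * k)" using xr_plus_1(2)[OF H(1) c'] nz by simp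
      hence "real_of_int (fls_subdegree (xr (a, c') + 1)) \<ge> 4 * real (N * k)" by linarith
      hence "1 / 2 \<le> real_of_int (fls_subdegree (xr (a, c') + 1)) / (8 * real (N * k))"
        using M0 by (simp add: field_simps)
      hence "real c / real N = 1 / 2" 
      proof (cases "N = 4 \<and> c = 2")
        case False
        hence "real c / real N = real_of_int (fls_subdegree (xr (a, c') + 1)) / (8 * real (N * k))"
          using e by (simp only: if_False)
        thus ?thesis using cN \<open>1 / 2 \<le> _\<close> by linarith
      qed simp
      moreover have "2 * real_of_int c' = real (N * k)" using c' by linarith
      hence "real_of_int c' / real (N * k) = 1 / 2" using assms(1,2) by (simp add: field_simps)
      ultimately show ?thesis by (simp only:)
    qed
    moreover from this have "real_of_int (c' * int N) = real_of_int (int c * int (N * k))"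
      using assms(1,2) by (simp add: field_simps)
    hence "c' * int N = int c * int (N * k)" by (simp only: of_int_eq_iff)
    from ramification_eq[OF N q(1) this assms(4) v[OF p, unfolded q(2)]]
    have "ramification p = e_cusp c N" by (simp add: q(2))
    moreover have "v_s (ratfun_eval Qj_embed p (F_ratfun k)) = ereal (v_fun k (real_of_int c' / real (N * k)))"
      unfolding q(2) by (rule v_s_F) (use assms H in auto)
    ultimately show ?thesis by simp
  qed
  show ?thesis unfolding cusp_order_def
  proof (rule the_equality)
    show "\<forall>p\<in>C. ereal (real (e_cusp c N) * v_fun k (real c / real N)) =
        ereal (real (ramification p)) * v_s (ratfun_eval Qj_embed p (F_ratfun k))"
      using val by simp
  next
    \<comment> \<open>An empty class would satisfy the description for every x; nonemptiness makes
      the value unique.\<close>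
    fix x assume "\<forall>p\<in>C. x = ereal (real (ramification p)) * v_s (ratfun_eval Qj_embed p (F_ratfun k))"
    moreover obtain p where "p \<in> C" using ne by blast
    ultimately show "x = ereal (real (e_cusp c N) * v_fun k (real c / real N))" using val by metis
  qed
qed

end
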